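(* Let $(A,B)$, $(C,D)$ be bounded intervals, $\varkappa,\varrho,\sigma,\eta,\Upsilon\in\mathbb{C}$ with positive real parts, and $\gamma_1,\gamma_2,\nu_1,\nu_2\in\mathbb{C}$. On the space $L_1((A,B)\times(C,D))$ the integral operator ${}_{A^+,C^+}\mathbb{I}_{\varkappa,\varrho,\Upsilon,\nu_1,\nu_2}^{(\gamma_1;\gamma_2;\frac{\gamma_1+1}{2};\gamma_2)}$ has a left inverse operator, namely the operator ${}_{A^+,C^+}\mathbb{D}_{\varkappa,\varrho,\Upsilon,\nu_1,\nu_2}^{(\gamma_1;\gamma_2;\frac{\gamma_1+1}{2};\gamma_2)}$ defined by $$\left({}_{A^+,C^+}\mathbb{D}_{\varkappa,\varrho,\Upsilon,\nu_1,\nu_2}^{(\gamma_1;\gamma_2;\frac{\gamma_1+1}{2};\gamma_2)}f\right)(X,Y)={}_{Y}D_{C^+}^{\varrho+\eta}\,{}_{X}D_{A^+}^{\varkappa+\sigma}\left({}_{A^+,C^+}\mathbb{I}_{\sigma,\eta,\Upsilon,\nu_1,\nu_2}^{(-\gamma_1;-\gamma_2;\frac{-\gamma_1+1}{2};-\gamma_2)}f\right)(X,Y);$$ that is, for every $\psi\in L_1((A,B)\times(C,D))$, ${}_{A^+,C^+}\mathbb{D}_{\varkappa,\varrho,\Upsilon,\nu_1,\nu_2}^{(\gamma_1;\gamma_2;\frac{\gamma_1+1}{2};\gamma_2)}\;{}_{A^+,C^+}\mathbb{I}_{\varkappa,\varrho,\Upsilon,\nu_1,\nu_2}^{(\gamma_1;\gamma_2;\frac{\gamma_1+1}{2};\gamma_2)}\psi=\psi$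 (almost everywhere).
   Context: $(a)_k$ is the Pochhammer symbol. The modified bivariate H–K Mittag-Leffler function is $$E_{\varkappa,\varrho,\Upsilon}^{(\gamma_1;\gamma_2;\gamma_3;\gamma_4)}(X,Y)=\sum_{s=0}^\infty\sum_{r=0}^\infty\frac{(\gamma_1)_{2s}(\gamma_2)_{s+r}X^sY^{\Upsilon r}}{(\gamma_3)_s(\gamma_4)_s\Gamma(\varkappa+s)\Gamma(\varrho+\Upsilon r)\,r!\,s!}.$$ When $\gamma_3=\frac{\gamma_1+1}{2}$ and $\gamma_4=\gamma_2$, the ratios are read as $\frac{(\gamma_1)_{2s}}{(\frac{\gamma_1+1}{2})_s}=4^s\left(\frac{\gamma_1}{2}\right)_s$ and $\frac{(\gamma_2)_{s+r}}{(\gamma_2)_s}=(\gamma_2+s)_r$, also where the left-hand sides are of the form $0/0$. The operator is, for $X>A$, $Y>C$, $$\left({}_{A^+,C^+}\mathbb{I}_{\varkappa,\varrho,\Upsilon,\nu_1,\nu_2}^{(\gamma_1;\gamma_2;\gamma_3;\gamma_4)}\psi\right)(X,Y)=\int_C^Y\int_A^X(X-t)^{\varkappa-1}(Y-\Omega)^{\varrho-1}E_{\varkappa,\varrho,\Upsilon}^{(\gamma_1;\gamma_2;\gamma_3;\gamma_4)}(\nu_1(X-t),\nu_2(Y-\Omega))\psi(t,\Omega)\,dt\,d\Omega,$$ with $(\nu_2(Y-\Omega))^{\Upsilon r}=(\nu_2^\Upsilon)^r(Y-\Omega)^{\Upsilon r}$ for a fixed value of $\nu_2^\Upsilon$. The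 partial Riemann–Liouville fractional derivative is $$({}_{Y}D_{C^+}^{\beta}\,{}_{X}D_{A^+}^{\alpha})g(X,Y)=\frac{\partial^n}{\partial X^n}\frac{\partial^m}{\partial Y^m}({}_{X}I_{A^+}^{n-\alpha}\,{}_{Y}I_{C^+}^{m-\beta})g(X,Y),\quad n=[\mathrm{Re}(\alpha)]+1,\ m=[\mathrm{Re}(\beta)]+1,$$ where ${}_{X}I_{A^+}^{\lambda}f(X)=\frac{1}{\Gamma(\lambda)}\int_A^X(X-t)^{\lambda-1}f(t)\,dt$, and similarly in $Y$; derivatives are understood almost everywhere. *)

theory Defs
  imports "HOL-Analysis.Analysis"
begin

(* The coefficient (g1)_{2s} (g2)_{s+r} / ((g3)_s (g4)_s).  In the case g3 = (g1+1)/2, g4 = g2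
   numerator and denominator may vanish simultaneously, and the cancelled form is used. *)
definition hk_coeff ::
    "complex \<Rightarrow> complex \<Rightarrow> complex \<Rightarrow> complex \<Rightarrow> nat \<Rightarrow> nat \<Rightarrow> complex" where
  "hk_coeff g1 g2 g3 g4 s r =
     (if g3 = (g1 + 1) / 2 \<and> g4 = g2
      then 4 ^ s * pochhammer (g1 / 2) s * pochhammer (g2 + of_nat s) r
      else pochhammer g1 (2 * s) * pochhammer g2 (s + r) / (pochhammer g3 s * pochhammer g4 s))"

(* The function is multivalued in its second variable Y.  The argument P supplies the chosen
   values: P r stands for Y^(\<Upsilon> r), and \<Upsilon> enters otherwise only through the Gamma factor. *)
definition hk_mittag_leffler ::
    "complex \<Rightarrow> complex \<Rightarrow> complex \<Rightarrow> complex \<Rightarrow> complex \<Rightarrow> complex \<Rightarrow> complex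
      \<Rightarrow> complex \<Rightarrow> (nat \<Rightarrow> complex) \<Rightarrow> complex" where
  "hk_mittag_leffler \<kappa> \<rho> \<Upsilon> g1 g2 g3 g4 X P =
     (\<Sum>s. \<Sum>r. hk_coeff g1 g2 g3 g4 s r * X ^ s * P r /
        (Gamma (\<kappa> + of_nat s) * Gamma (\<rho> + \<Upsilon> * of_nat r) * fact r * fact s))"

(* w is one of the values of the power \<nu>^\<Upsilon> (used for Re \<Upsilon> > 0, where 0^\<Upsilon> = 0). *)
definition power_value :: "complex \<Rightarrow> complex \<Rightarrow> complex \<Rightarrow> bool" where
  "power_value \<nu> \<Upsilon> w \<longleftrightarrow>
     (if \<nu> = 0 then w = 0 else (\<exists>L. exp L = \<nu> \<and> w = exp (\<Upsilon> * L)))"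

(* w is the fixed value of \<nu>2^\<Upsilon>, so that (\<nu>2 (Y - \<Omega>))^(\<Upsilon> r) is w^r (Y - \<Omega>)^(\<Upsilon> r);
   real bases of powr are positive throughout. *)
definition hk_integral ::
    "real \<Rightarrow> real \<Rightarrow> complex \<Rightarrow> complex \<Rightarrow> complex \<Rightarrow> complex \<Rightarrow> complex
      \<Rightarrow> complex \<Rightarrow> complex \<Rightarrow> complex \<Rightarrow> complex
      \<Rightarrow> (real \<times> real \<Rightarrow> complex) \<Rightarrow> real \<times> real \<Rightarrow> complex" where
  "hk_integral A C \<kappa> \<rho> \<Upsilon> \<nu>1 w g1 g2 g3 g4 \<psi> = (\<lambda>(X, Y).
     (LINT \<Omega>:{C<..<Y}|lebesgue. (LINT t:{A<..<X}|lebesgue.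
        of_real (X - t) powr (\<kappa> - 1) * of_real (Y - \<Omega>) powr (\<rho> - 1) *
        hk_mittag_leffler \<kappa> \<rho> \<Upsilon> g1 g2 g3 g4 (\<nu>1 * of_real (X - t))
          (\<lambda>r. w ^ r * of_real (Y - \<Omega>) powr (\<Upsilon> * of_nat r)) *
        \<psi> (t, \<Omega>))))"

definition rl_integral :: "real \<Rightarrow> complex \<Rightarrow> (real \<Rightarrow> complex) \<Rightarrow> real \<Rightarrow> complex" where
  "rl_integral a l f x =
     1 / Gamma l * (LINT t:{a<..<x}|lebesgue. of_real (x - t) powr (l - 1) * f t)"

definition rl_integral_X ::
    "real \<Rightarrow> complex \<Rightarrow> (real \<times> real \<Rightarrow> complex) \<Rightarrow> real \<times> real \<Rightarrow> complex" where
  "rl_integral_X A l g = (\<lambda>(X, Y). rl_integral A l (\<lambda>t. g (t, Y)) X)"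

definition rl_integral_Y ::
    "real \<Rightarrow> complex \<Rightarrow> (real \<times> real \<Rightarrow> complex) \<Rightarrow> real \<times> real \<Rightarrow> complex" where
  "rl_integral_Y C l g = (\<lambda>(X, Y). rl_integral C l (\<lambda>u. g (X, u)) Y)"

(* f has k-th derivative d at x; the lower-order derivatives are required to exist near x. *)
primrec has_nth_derivative ::
    "nat \<Rightarrow> (real \<Rightarrow> complex) \<Rightarrow> real \<Rightarrow> complex \<Rightarrow> bool" where
  "has_nth_derivative 0 f x d \<longleftrightarrow> f x = d"
| "has_nth_derivative (Suc k) f x d \<longleftrightarrow>
     (\<exists>h. (\<forall>\<^sub>F y in nhds x. has_nth_derivative k f y (h y)) \<and> (h has_vector_derivative d) (at x))"

(* d is the value at the given point of the n-th X-derivative of the m-th Y-derivative of g. *)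
definition has_mixed_derivative ::
    "nat \<Rightarrow> nat \<Rightarrow> (real \<times> real \<Rightarrow> complex) \<Rightarrow> real \<times> real \<Rightarrow> complex \<Rightarrow> bool" where
  "has_mixed_derivative n m g = (\<lambda>(X, Y) d.
     \<exists>h. (\<forall>\<^sub>F x in nhds X. has_nth_derivative m (\<lambda>y. g (x, y)) Y (h x)) \<and>
         has_nth_derivative n h X d)"

(* Order \<alpha> in X (base point A) and order \<beta> in Y (base point C). *)
definition has_rl_derivative ::
    "real \<Rightarrow> real \<Rightarrow> complex \<Rightarrow> complex
      \<Rightarrow> (real \<times> real \<Rightarrow> complex) \<Rightarrow> real \<times> real \<Rightarrow> complex \<Rightarrow> bool" where
  "has_rl_derivative A C \<alpha> \<beta> g z d \<longleftrightarrow>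
     (let n = nat \<lfloor>Re \<alpha>\<rfloor> + 1; m = nat \<lfloor>Re \<beta>\<rfloor> + 1 in
        has_mixed_derivative n m
          (rl_integral_X A (of_nat n - \<alpha>) (rl_integral_Y C (of_nat m - \<beta>) g)) z d)"

definition rl_derivative ::
    "real \<Rightarrow> real \<Rightarrow> complex \<Rightarrow> complex
      \<Rightarrow> (real \<times> real \<Rightarrow> complex) \<Rightarrow> real \<times> real \<Rightarrow> complex" where
  "rl_derivative A C \<alpha> \<beta> g z = (THE d. has_rl_derivative A C \<alpha> \<beta> g z d)"

(* The parameters (g1; g2; (g1+1)/2; g2) of the operator are given by g1 and g2 alone. *)
definition hk_derivative ::
    "real \<Rightarrow> real \<Rightarrow> complex \<Rightarrow> complex \<Rightarrow> complex \<Rightarrow> complex \<Rightarrow> complex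
      \<Rightarrow> complex \<Rightarrow> complex \<Rightarrow> complex \<Rightarrow> complex
      \<Rightarrow> (real \<times> real \<Rightarrow> complex) \<Rightarrow> real \<times> real \<Rightarrow> complex" where
  "hk_derivative A C \<kappa> \<rho> \<sigma> \<eta> \<Upsilon> \<nu>1 w g1 g2 f =
     rl_derivative A C (\<kappa> + \<sigma>) (\<rho> + \<eta>)
       (hk_integral A C \<sigma> \<eta> \<Upsilon> \<nu>1 w (- g1) (- g2) ((- g1 + 1) / 2) (- g2) f)"

(* The derivatives in the definition of hk_derivative exist at z, i.e. its value there is not
   an arbitrary one. *)
definition hk_derivative_exists ::
    "real \<Rightarrow> real \<Rightarrow> complex \<Rightarrow> complex \<Rightarrow> complex \<Rightarrow> complex \<Rightarrow> complex
      \<Rightarrow> complex \<Rightarrow> complex \<Rightarrow> complex \<Rightarrow> complex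
      \<Rightarrow> (real \<times> real \<Rightarrow> complex) \<Rightarrow> real \<times> real \<Rightarrow> bool" where
  "hk_derivative_exists A C \<kappa> \<rho> \<sigma> \<eta> \<Upsilon> \<nu>1 w g1 g2 f z \<longleftrightarrow>
     (\<exists>d. has_rl_derivative A C (\<kappa> + \<sigma>) (\<rho> + \<eta>)
       (hk_integral A C \<sigma> \<eta> \<Upsilon> \<nu>1 w (- g1) (- g2) ((- g1 + 1) / 2) (- g2) f) z d)"

end

theory Submission
  imports Defs
begin

text \<open>Both kernels are double series of products of Riemann--Liouville kernels
  $x^{a-1}/\Gamma(a)$, and convolution adds the orders $a$. Hence the convolution of the two kernels
  is the series whose coefficients are the Cauchy product of the two coefficient arrays. The array for
  $(\gamma_1, \gamma_2)$ is generated by $(1-y)^{-\gamma_2} (1 - 4x/(1-y))^{-\gamma_1/2}$, and changing the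
  signs of the parameters gives the reciprocal, so only the term of orders $\varkappa+\sigma$ and
  $\varrho+\eta$ survives. After the fractional integrations in the definition of the derivative, the
  composition is, at every point, the iterated integral of $\psi$ of integer orders $n$ and $m$. Its
  derivatives exist almost everywhere by Lebesgue differentiation in each variable; the $Y$-derivative has
  to exist at almost every $Y$ for all $X$ simultaneously.\<close>

text \<open>The gap between "almost everywhere" and "everywhere" shapes the proof. The two integral
  operators compose to one convolution only almost everywhere, because its orders \<kappa> +
  \<sigma> and \<rho> + \<eta> may have real part below 1, where the kernels are unbounded; a
  derivative needs all values near the point. The fractional integrations bridge this gap: they
  ignore null sets of their argument, and they raise the orders to integers n, m \<ge> 1, for which
  the absolute integral of the product of the two kernels stays bounded, so that Fubini's theorem
  applies at each single point. The Y-derivatives are required on a whole X-neighbourhood, so the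
  null sets of uncountably many X must be covered by a single one, whereas for the X-derivative one
  row Y at a time suffices. For this \<psi> is exchanged for a Borel function that vanishes off the
  rectangle and is integrable along every row, not merely almost every one. The truncation lengths
  of the kernels are the side lengths of the rectangle.\<close>

section \<open>Differentiation of indefinite integrals\<close>

text \<open>At a bad point \<open>x\<close> the interval between \<open>x\<close> and \<open>x + h\<close>, tagged with \<open>x\<close>, contributes at least \<open>c |h|\<close>
  to the sum in Henstock's lemma; a disjoint subfamily of such intervals has been selected by Vitali's lemma.\<close>
lemma negligible_not_differentiable_at_scale:
  fixes f :: "real \<Rightarrow> 'n::euclidean_space"
  assumes f: "f integrable_on {a..b}" and c: "c > 0"
  shows "negligible {x \<in> {a<..<b}. \<forall>\<delta>>0. \<exists>h. h \<noteq> 0 \<and> \<bar>h\<bar> < \<delta> \<and> x + h \<in> {a<..<b} \<and>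
     norm (integral {a..x + h} f - integral {a..x} f - h *\<^sub>R f x) > c * \<bar>h\<bar>}" (is "negligible ?S")
  unfolding negligible_outer
proof (intro allI impI)
  define S where "S = ?S"
  have S: "a < x" "x < b" "\<And>\<delta>. \<delta> > 0 \<Longrightarrow> \<exists>h. h \<noteq> 0 \<and> \<bar>h\<bar> < \<delta> \<and> x + h \<in> {a<..<b} \<and>
     norm (integral {a..x + h} f - integral {a..x} f - h *\<^sub>R f x) > c * \<bar>h\<bar>" if "x \<in> S" for x
    using that by (auto simp: S_def)
  fix e :: real assume e: "e > 0"
  \<comment> \<open>Vitali's lemma enlarges the radii by 5, so the ball at \<open>x\<close> gets
    length \<open>10 * \<bar>h x\<bar>\<close>. The radii of the disjoint balls add up to at most
    \<open>e' / c\<close>, which makes the covering smaller than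
    \<open>10 * (e' / c) = e / 2\<close>.\<close>
  define e' where "e' = c * e / 20"
  have e': "e' > 0" using e c by (simp add: e'_def)
  obtain g where g: "gauge g" and H: "\<And>p. \<lbrakk>p tagged_partial_division_of cbox a b; g fine p\<rbrakk>
       \<Longrightarrow> (\<Sum>(x,K)\<in>p. norm (measure lborel K *\<^sub>R f x - integral K f)) < e'"
    using Henstock_lemma[of f a b e'] f e' by (auto simp: cbox_interval)
  \<comment> \<open>The whole ball is kept inside the gauge, so the tagged interval is fine
    whichever sign \<open>h\<close> has. The bound 1 is the uniform bound on the radii in Vitali's
    lemma.\<close>
  have "\<forall>x\<in>S. \<exists>h. h \<noteq> 0 \<and> \<bar>h\<bar> < 1 \<and> x + h \<in> {a<..<b} \<and> cball x \<bar>h\<bar> \<subseteq> g x \<and>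
     norm (integral {a..x + h} f - integral {a..x} f - h *\<^sub>R f x) > c * \<bar>h\<bar>"
  proof
    fix x assume x: "x \<in> S"
    have "open (g x)" "x \<in> g x" using g by (auto simp: gauge_def)
    then obtain d where d: "d > 0" "ball x d \<subseteq> g x" by (meson openE)
    from d S(3)[OF x, of "min d 1"] obtain h where h: "h \<noteq> 0" "\<bar>h\<bar> < min d 1" "x + h \<in> {a<..<b}"
      "norm (integral {a..x + h} f - integral {a..x} f - h *\<^sub>R f x) > c * \<bar>h\<bar>" by auto
    moreover have "cball x \<bar>h\<bar> \<subseteq> ball x d" using h by auto
    ultimately show "\<exists>h. h \<noteq> 0 \<and> \<bar>h\<bar> < 1 \<and> x + h \<in> {a<..<b} \<and> cball x \<bar>h\<bar> \<subseteq> g x \<and>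
     norm (integral {a..x + h} f - integral {a..x} f - h *\<^sub>R f x) > c * \<bar>h\<bar>"
      using d by (intro exI[of _ h]) auto
  qed
  then obtain h where h: "\<And>x. x \<in> S \<Longrightarrow> h x \<noteq> 0" "\<And>x. x \<in> S \<Longrightarrow> \<bar>h x\<bar> < 1" 
     "\<And>x. x \<in> S \<Longrightarrow> x + h x \<in> {a<..<b}" "\<And>x. x \<in> S \<Longrightarrow> cball x \<bar>h x\<bar> \<subseteq> g x"
     "\<And>x. x \<in> S \<Longrightarrow> norm (integral {a..x + h x} f - integral {a..x} f - h x *\<^sub>R f x) > c * \<bar>h x\<bar>"
    by (metis (no_types, lifting))
  obtain C where C: "countable C" "C \<subseteq> S"
     and disj: "pairwise (\<lambda>i j. disjnt (cball i \<bar>h i\<bar>) (cball j \<bar>h j\<bar>)) C"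
     and cov: "S \<subseteq> (\<Union>i\<in>C. cball i (5 * \<bar>h i\<bar>))"
  proof (rule Vitali_covering_lemma_cballs[where S=S and a="\<lambda>x. x" and K=S and r="\<lambda>x. \<bar>h x\<bar>" and B=1])
    show "S \<subseteq> (\<Union>i\<in>S. cball i \<bar>h i\<bar>)" by auto
    show "0 < \<bar>h i\<bar> \<and> \<bar>h i\<bar> \<le> 1" if "i \<in> S" for i using h(1,2)[OF that] by auto
  qed blast
  have fin: "(\<Sum>x\<in>F. \<bar>h x\<bar>) \<le> e' / c" if F: "finite F" "F \<subseteq> C" for F
  proof -
    define I where "I x = {min x (x + h x)..max x (x + h x)}" for x
    have FS: "x \<in> S" if "x \<in> F" for x using that F C by auto
    have I1: "I x \<subseteq> cball x \<bar>h x\<bar>" for x by (auto simp: I_def dist_real_def)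
    define p where "p = (\<lambda>x. (x, I x)) ` F"
    have inj: "inj_on (\<lambda>x. (x, I x)) F" by (auto simp: inj_on_def)
    have "p tagged_partial_division_of cbox a b"
      unfolding tagged_partial_division_of_def
    proof (intro conjI allI impI)
      show "finite p" using F by (simp add: p_def)
      fix x K assume xK: "(x, K) \<in> p"
      then have x: "x \<in> F" "K = I x" by (auto simp: p_def)
      show "x \<in> K" using x by (auto simp: I_def)
      show "K \<subseteq> cbox a b" using S(1,2)[OF FS[OF x(1)]] h(3)[OF FS[OF x(1)]] x(2) by (auto simp: I_def)
      show "\<exists>a b. K = cbox a b" using x by (auto simp: I_def cbox_interval)
    next
      fix x K y L assume yL: "(x, K) \<in> p \<and> (y, L) \<in> p \<and> (x, K) \<noteq> (y, L)"
      then have x: "x \<in> F" "K = I x" by (auto simp: p_def)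
      from yL have y: "y \<in> F" "L = I y" by (auto simp: p_def)
      with yL x have "x \<noteq> y" by auto
      then have "disjnt (cball x \<bar>h x\<bar>) (cball y \<bar>h y\<bar>)"
        using disj x y F by (auto simp: pairwise_def)
      then show "interior K \<inter> interior L = {}"
        using I1[of x] I1[of y] x y interior_subset[of K] interior_subset[of L]
        unfolding disjnt_def by blast
    qed
    moreover have "g fine p" unfolding fine_def p_def using h(4)[OF FS] I1 by blast
    ultimately have "(\<Sum>(x,K)\<in>p. norm (measure lborel K *\<^sub>R f x - integral K f)) < e'" by (rule H)
    also have "(\<Sum>(x,K)\<in>p. norm (measure lborel K *\<^sub>R f x - integral K f)) =
       (\<Sum>x\<in>F. norm (measure lborel (I x) *\<^sub>R f x - integral (I x) f))"
      unfolding p_def by (subst sum.reindex[OF inj]) simp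
    finally have lt: "\<dots> < e'" .
    have "c * \<bar>h x\<bar> \<le> norm (measure lborel (I x) *\<^sub>R f x - integral (I x) f)" if x: "x \<in> F" for x
    proof -
      note hx = h[OF FS[OF x]]
      have ax: "a < x" "x < b" using S[OF FS[OF x]] by auto
      have int: "f integrable_on {a..y}" if "y \<le> b" for y
        using f by (rule integrable_subinterval_real) (use that in auto)
      show ?thesis
      proof (cases "h x > 0")
        case True
        have "integral {a..x} f + integral {x..x + h x} f = integral {a..x + h x} f"
          by (rule Henstock_Kurzweil_Integration.integral_combine) (use True ax hx(3) int in auto)
        then have "integral (I x) f = integral {a..x + h x} f - integral {a..x} f"
          using True by (simp add: I_def algebra_simps)
        then show ?thesis using hx(5) True by (simp add: I_def norm_minus_commute)
      next
        case False
        then have neg: "h x < 0" using hx(1) by auto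
        have "integral {a..x + h x} f + integral {x + h x..x} f = integral {a..x} f"
          by (rule Henstock_Kurzweil_Integration.integral_combine) (use neg ax hx(3) int in auto)
        then have eq: "integral (I x) f = integral {a..x} f - integral {a..x + h x} f"
          using neg by (simp add: I_def algebra_simps)
        have m: "measure lborel (I x) = - h x" using neg by (simp add: I_def)
        have "norm (measure lborel (I x) *\<^sub>R f x - integral (I x) f) =
            norm (integral {a..x + h x} f - integral {a..x} f - h x *\<^sub>R f x)"
          unfolding m eq by (simp add: algebra_simps)
          then show ?thesis using hx(5) by simp
      qed
    qed
    then have "(\<Sum>x\<in>F. c * \<bar>h x\<bar>) \<le> (\<Sum>x\<in>F. norm (measure lborel (I x) *\<^sub>R f x - integral (I x) f))"
      by (rule sum_mono)
    with lt have "c * (\<Sum>x\<in>F. \<bar>h x\<bar>) < e'" by (simp add: sum_distrib_left)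
    then show ?thesis using c by (simp add: field_simps)
  qed
  define T where "T = (\<Union>i\<in>C. cball i (5 * \<bar>h i\<bar>))"
  have m: "measure lebesgue (\<Union>i\<in>F. cball i (5 * \<bar>h i\<bar>)) \<le> 10 * (e' / c)" if F: "F \<subseteq> C" "finite F" for F
  proof -
    have "measure lebesgue (\<Union>i\<in>F. cball i (5 * \<bar>h i\<bar>)) \<le> (\<Sum>i\<in>F. measure lebesgue (cball i (5 * \<bar>h i\<bar>)))"
      by (rule measure_UNION_le) (use F in auto)
    also have "\<dots> = (\<Sum>i\<in>F. 10 * \<bar>h i\<bar>)"
      by (intro sum.cong) (auto simp: cball_eq_atLeastAtMost)
    also have "\<dots> = 10 * (\<Sum>i\<in>F. \<bar>h i\<bar>)" by (simp add: sum_distrib_left)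
    also have "\<dots> \<le> 10 * (e' / c)" by (intro mult_left_mono fin F) simp
    finally show ?thesis .
  qed
  have "T \<in> lmeasurable" "measure lebesgue T \<le> 10 * (e' / c)"
    unfolding T_def by (rule fmeasurable_UN_bound measure_UN_bound; use C m in auto)+
  moreover have "10 * (e' / c) < e" using e c by (simp add: e'_def)
  ultimately show "\<exists>T. ?S \<subseteq> T \<and> T \<in> lmeasurable \<and> measure lebesgue T < e"
    using cov unfolding T_def[symmetric] S_def[symmetric] by auto
qed

text \<open>A failure of differentiability at \<open>x\<close> is a failure at one of the scales
  \<open>1 / Suc n\<close>, so the bad points lie in a countable union of the sets treated
  above.\<close>

theorem negligible_not_has_vector_derivative_integral:
  fixes f :: "real \<Rightarrow> 'n::euclidean_space"
  assumes f: "f integrable_on {a..b}"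
  shows "negligible {x \<in> {a<..<b}. \<not> ((\<lambda>y. integral {a..y} f) has_vector_derivative f x) (at x)}"
proof -
  define S where "S c = {x \<in> {a<..<b}. \<forall>\<delta>>0. \<exists>h. h \<noteq> 0 \<and> \<bar>h\<bar> < \<delta> \<and> x + h \<in> {a<..<b} \<and>
     norm (integral {a..x + h} f - integral {a..x} f - h *\<^sub>R f x) > c * \<bar>h\<bar>}" for c :: real
  have "negligible (\<Union>n::nat. S (1 / Suc n))"
  proof (rule negligible_Union_nat)
    show "negligible (S (1 / Suc n))" for n
      unfolding S_def by (rule negligible_not_differentiable_at_scale[OF f]) simp
  qed
  moreover have "{x \<in> {a<..<b}. \<not> ((\<lambda>y. integral {a..y} f) has_vector_derivative f x) (at x)}
      \<subseteq> (\<Union>n::nat. S (1 / Suc n))"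
  proof (rule subsetI, rule ccontr)
    fix x assume x: "x \<in> {x \<in> {a<..<b}. \<not> ((\<lambda>y. integral {a..y} f) has_vector_derivative f x) (at x)}"
      and n: "x \<notin> (\<Union>n::nat. S (1 / Suc n))"
    have "((\<lambda>y. integral {a..y} f) has_vector_derivative f x) (at x)"
      unfolding has_vector_derivative_def has_derivative_at_alt
    proof (intro conjI allI impI)
      show "bounded_linear (\<lambda>h. h *\<^sub>R f x)" by (rule bounded_linear_scaleR_left)
      fix e :: real assume "e > 0"
      then obtain k :: nat where k: "1 / Suc k < e" using nat_approx_posE by blast
      from n have "x \<notin> S (1 / Suc k)" by blast
      then obtain \<delta> where \<delta>: "\<delta> > 0" "\<And>h. \<lbrakk>h \<noteq> 0; \<bar>h\<bar> < \<delta>; x + h \<in> {a<..<b}\<rbrakk> \<Longrightarrow>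
        norm (integral {a..x + h} f - integral {a..x} f - h *\<^sub>R f x) \<le> 1 / Suc k * \<bar>h\<bar>"
        using x unfolding S_def by (simp only: mem_Collect_eq not_less[symmetric]) blast
      define d where "d = min \<delta> (min (x - a) (b - x))"
      show "\<exists>d>0. \<forall>y. norm (y - x) < d \<longrightarrow>
        norm (integral {a..y} f - integral {a..x} f - (y - x) *\<^sub>R f x) \<le> e * norm (y - x)"
      proof (intro exI[of _ d] conjI allI impI)
        show "d > 0" using \<delta> x by (auto simp: d_def)
        fix y assume y: "norm (y - x) < d"
        show "norm (integral {a..y} f - integral {a..x} f - (y - x) *\<^sub>R f x) \<le> e * norm (y - x)"
        proof (cases "y = x")
          case False
          have "norm (integral {a..x + (y - x)} f - integral {a..x} f - (y - x) *\<^sub>R f x) \<le> 1 / Suc k * \<bar>y - x\<bar>"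
            by (rule \<delta>(2)) (use False y x in \<open>auto simp: d_def\<close>)
          also have "\<dots> \<le> e * \<bar>y - x\<bar>" using k by (intro mult_right_mono) auto
          finally show ?thesis by simp
        qed auto
      qed
    qed
    then show False using x by simp
  qed
  ultimately show ?thesis by (rule negligible_subset)
qed

section \<open>Convolution\<close>

lemma lborel_shift_invariant:
  fixes f :: "'a::euclidean_space \<Rightarrow> 'b::{banach, second_countable_topology}"
  assumes [measurable]: "f \<in> borel_measurable borel"
  shows "(LINT x|lborel. f (x - y)) = (LINT x|lborel. f x)"
    and "integrable lborel (\<lambda>x. f (x - y)) \<longleftrightarrow> integrable lborel f"
proof -
  have d: "distr lborel borel ((+) (- y)) = (lborel :: 'a measure)" by (rule lborel_distr_plus)
  have "(LINT x|lborel. f x) = (LINT x|distr lborel borel ((+) (- y)). f x)" by (simp add: d)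
  also have "\<dots> = (LINT x|lborel. f (x - y))" by (subst integral_distr) auto
  finally show "(LINT x|lborel. f (x - y)) = (LINT x|lborel. f x)" ..
  have "integrable lborel f \<longleftrightarrow> integrable (distr lborel borel ((+) (- y))) f" by (simp add: d)
  also have "\<dots> \<longleftrightarrow> integrable lborel (\<lambda>x. f (x - y))" by (subst integrable_distr_eq) auto
  finally show "integrable lborel (\<lambda>x. f (x - y)) \<longleftrightarrow> integrable lborel f" ..
qed

lemma lborel_nn_shift_invariant:
  fixes f :: "'a::euclidean_space \<Rightarrow> ennreal"
  assumes [measurable]: "f \<in> borel_measurable borel"
  shows "(\<integral>\<^sup>+x. f (x - y) \<partial>lborel) = (\<integral>\<^sup>+x. f x \<partial>lborel)"
proof -
  have "(\<integral>\<^sup>+x. f x \<partial>lborel) = (\<integral>\<^sup>+x. f x \<partial>distr lborel borel ((+) (- y)))" by (simp add: lborel_distr_plus)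
  also have "\<dots> = (\<integral>\<^sup>+x. f (x - y) \<partial>lborel)" by (subst nn_integral_distr) auto
  finally show ?thesis ..
qed

lemma lborel_nn_reflect_invariant:
  fixes f :: "'a::euclidean_space \<Rightarrow> ennreal"
  assumes [measurable]: "f \<in> borel_measurable borel"
  shows "(\<integral>\<^sup>+x. f (y - x) \<partial>lborel) = (\<integral>\<^sup>+x. f x \<partial>lborel)"
proof -
  have "lborel = distr lborel borel (\<lambda>x. y - x :: 'a)"
    using lborel_affine[of "-1" y] by (simp add: density_1)
  then have "(\<integral>\<^sup>+x. f x \<partial>lborel) = (\<integral>\<^sup>+x. f x \<partial>distr lborel borel (\<lambda>x. y - x))" by simp
  also have "\<dots> = (\<integral>\<^sup>+x. f (y - x) \<partial>lborel)" by (subst nn_integral_distr) auto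
  finally show ?thesis ..
qed

text \<open>At points where the integrand is not integrable the value is 0, which would silently
  break associativity; hence the integrability conditions and the almost-everywhere forms
  below.\<close>

definition conv :: "('a::euclidean_space \<Rightarrow> complex) \<Rightarrow> ('a \<Rightarrow> complex) \<Rightarrow> 'a \<Rightarrow> complex" where
  "conv f g x = (LINT y|lborel. f (x - y) * g y)"

lemma conv_measurable [measurable]:
  assumes [measurable]: "f \<in> borel_measurable borel" "g \<in> borel_measurable borel"
  shows "conv f g \<in> borel_measurable borel"
proof -
  have "(\<lambda>x. LINT y|lborel. f (x - y) * g y) \<in> borel_measurable lborel"
    by (rule lborel.borel_measurable_lebesgue_integral) (simp add: borel_prod)
  then show ?thesis by (simp add: conv_def[abs_def])
qed

text \<open>Integrating over \<open>x\<close> first, shift invariance turns the norm of the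
  integrand into \<open>norm (g y)\<close> times a constant.\<close>

lemma integrable_conv_pair:
  assumes f: "integrable lborel f" and g: "integrable lborel g"
  shows "integrable (lborel \<Otimes>\<^sub>M lborel) (\<lambda>(x, y). f (x - y) * g y :: complex)"
proof -
  have [measurable]: "f \<in> borel_measurable borel" "g \<in> borel_measurable borel"
    using f g by (auto dest: borel_measurable_integrable)
  have "integrable (lborel \<Otimes>\<^sub>M lborel) (\<lambda>(y, x). f (x - y) * g y)"
  proof (rule lborel_pair.Fubini_integrable)
    have "(LINT x|lborel. norm (f (x - y) * g y)) = (LINT x|lborel. norm (f x)) * norm (g y)" for y
      by (simp add: norm_mult lborel_shift_invariant(1)[of "\<lambda>x. norm (f x)"])
    then show "integrable lborel (\<lambda>y. LINT x|lborel. norm (case (y, x) of (y, x) \<Rightarrow> f (x - y) * g y))"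
      using f g by simp
    show "AE y in lborel. integrable lborel (\<lambda>x. case (y, x) of (y, x) \<Rightarrow> f (x - y) * g y)"
      using f by (auto simp: lborel_shift_invariant(2))
  qed (simp add: borel_prod)
  from lborel_pair.integrable_product_swap[OF this] show ?thesis
    by (simp add: case_prod_unfold)
qed

lemma
  assumes f: "integrable lborel f" and g: "integrable lborel g"
  shows AE_integrable_conv: "AE x in lborel. integrable lborel (\<lambda>y. f (x - y) * g y)"
    and integrable_conv: "integrable lborel (conv f g)"
    and integral_conv: "(LINT x|lborel. conv f g x) = (LINT x|lborel. f x) * (LINT x|lborel. g x)"
proof -
  note i = integrable_conv_pair[OF f g]
  have [measurable]: "f \<in> borel_measurable borel"
    using f by (auto dest: borel_measurable_integrable)
  show "AE x in lborel. integrable lborel (\<lambda>y. f (x - y) * g y)"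
    using lborel_pair.AE_integrable_fst[OF i] .
  show "integrable lborel (conv f g)"
    using lborel_pair.integrable_fst[OF i] by (simp add: conv_def[abs_def])
  have "(LINT x|lborel. conv f g x) = (LINT y|lborel. LINT x|lborel. f (x - y) * g y)"
    unfolding conv_def using lborel_pair.Fubini_integral[OF i] by simp
  also have "\<dots> = (LINT x|lborel. f x) * (LINT x|lborel. g x)"
    by (simp add: lborel_shift_invariant(1))
  finally show "(LINT x|lborel. conv f g x) = (LINT x|lborel. f x) * (LINT x|lborel. g x)" .
qed

text \<open>Fubini's theorem at one fixed \<open>x\<close>, followed by the shift of
  \<open>y\<close> by \<open>w\<close>. Joint integrability at this very \<open>x\<close> is the
  price for an equality that is not just almost everywhere.\<close>

lemma conv_assoc_pointwise:
  fixes f g h :: "'a::euclidean_space \<Rightarrow> complex"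
  assumes [measurable]: "f \<in> borel_measurable borel" "g \<in> borel_measurable borel" "h \<in> borel_measurable borel"
    and i: "integrable (lborel \<Otimes>\<^sub>M lborel) (\<lambda>(y, w). f (x - y) * g (y - w) * h w)"
  shows "conv f (conv g h) x = conv (conv f g) h x"
proof -
  have "conv f (conv g h) x = (LINT y|lborel. LINT w|lborel. f (x - y) * g (y - w) * h w)"
    unfolding conv_def by (simp flip: integral_mult_right_zero add: mult_ac)
  also have "\<dots> = (LINT w|lborel. LINT y|lborel. f (x - y) * g (y - w) * h w)"
    using lborel_pair.Fubini_integral[OF i] by simp
  also have "\<dots> = (LINT w|lborel. (LINT y|lborel. f (x - y) * g (y - w)) * h w)"
    by simp
  also have "\<dots> = (LINT w|lborel. conv f g (x - w) * h w)"
  proof (rule Bochner_Integration.integral_cong[OF refl])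
    show "(LINT y|lborel. f (x - y) * g (y - w)) * h w = conv f g (x - w) * h w" for w
      using lborel_shift_invariant(1)[of "\<lambda>y. f (x - w - y) * g y" w] by (simp add: conv_def)
  qed
  finally show ?thesis by (simp add: conv_def)
qed

text \<open>Tonelli's theorem with the substitution of \<open>y + w\<close> for \<open>y\<close>:
  the inner integral becomes the convolution of \<open>norm f\<close> and \<open>norm g\<close> at
  \<open>x - w\<close>. Only that convolution has to be controlled against \<open>h\<close>.\<close>

lemma integrable_conv_triple:
  fixes f g h :: "'a::euclidean_space \<Rightarrow> complex"
  assumes [measurable]: "f \<in> borel_measurable borel" "g \<in> borel_measurable borel" "h \<in> borel_measurable borel"
    and b: "(\<integral>\<^sup>+w. (\<integral>\<^sup>+y. ennreal (norm (f (x - w - y))) * ennreal (norm (g y)) \<partial>lborel) * ennreal (norm (h w)) \<partial>lborel) < \<infinity>"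
  shows "integrable (lborel \<Otimes>\<^sub>M lborel) (\<lambda>(y, w). f (x - y) * g (y - w) * h w)"
proof (rule integrableI_bounded)
  have [measurable]: "(\<lambda>(y, w). f (x - y) * g (y - w) * h w) \<in> borel_measurable (borel \<Otimes>\<^sub>M borel)"
    by measurable
  show "(\<lambda>(y, w). f (x - y) * g (y - w) * h w) \<in> borel_measurable (lborel \<Otimes>\<^sub>M lborel)"
    by (simp add: borel_prod)
  have "(\<integral>\<^sup>+p. ennreal (norm (case p of (y, w) \<Rightarrow> f (x - y) * g (y - w) * h w)) \<partial>(lborel \<Otimes>\<^sub>M lborel)) =
     (\<integral>\<^sup>+w. (\<integral>\<^sup>+y. ennreal (norm (f (x - y) * g (y - w) * h w)) \<partial>lborel) \<partial>lborel)"
    by (subst lborel_pair.nn_integral_snd[symmetric]) simp_all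
  also have "\<dots> = (\<integral>\<^sup>+w. (\<integral>\<^sup>+y. ennreal (norm (f (x - y))) * ennreal (norm (g (y - w))) \<partial>lborel) * ennreal (norm (h w)) \<partial>lborel)"
    by (simp add: norm_mult ennreal_mult nn_integral_multc)
  also have "\<dots> = (\<integral>\<^sup>+w. (\<integral>\<^sup>+y. ennreal (norm (f (x - w - y))) * ennreal (norm (g y)) \<partial>lborel) * ennreal (norm (h w)) \<partial>lborel)"
  proof (rule nn_integral_cong)
    show "(\<integral>\<^sup>+y. ennreal (norm (f (x - y))) * ennreal (norm (g (y - w))) \<partial>lborel) * ennreal (norm (h w)) =
      (\<integral>\<^sup>+y. ennreal (norm (f (x - w - y))) * ennreal (norm (g y)) \<partial>lborel) * ennreal (norm (h w))" for w
      using lborel_nn_shift_invariant[of "\<lambda>y. ennreal (norm (f (x - w - y))) * ennreal (norm (g y))" w] by simp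
  qed
  finally show "(\<integral>\<^sup>+p. ennreal (norm (case p of (y, w) \<Rightarrow> f (x - y) * g (y - w) * h w)) \<partial>(lborel \<Otimes>\<^sub>M lborel)) < \<infinity>"
    using b by simp
qed

text \<open>The norms of \<open>f\<close>, \<open>g\<close>, \<open>h\<close> are themselves
  integrable, so their iterated convolution converges for almost every \<open>x\<close>; this is the
  bound that \<open>integrable_conv_triple\<close> asks for.\<close>

lemma conv_assoc_AE:
  fixes f g h :: "'a::euclidean_space \<Rightarrow> complex"
  assumes f: "integrable lborel f" and g: "integrable lborel g" and h: "integrable lborel h"
  shows "AE x in lborel. conv f (conv g h) x = conv (conv f g) h x"
proof -
  have [measurable]: "f \<in> borel_measurable borel" "g \<in> borel_measurable borel" "h \<in> borel_measurable borel"
    using f g h by (auto dest: borel_measurable_integrable)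
  let ?n = "\<lambda>f x. complex_of_real (norm (f x :: complex))"
  have n: "integrable lborel (?n f)" "integrable lborel (?n g)" "integrable lborel (?n h)"
    using f g h by simp_all
  have "AE x in lborel. integrable lborel (\<lambda>w. conv (?n f) (?n g) (x - w) * ?n h w)"
    by (rule AE_integrable_conv[OF integrable_conv[OF n(1,2)] n(3)])
  \<comment> \<open>Without this, a divergent inner integral would be recorded as 0 by
    \<open>conv\<close> although the nonnegative integral is infinite. Reflection \<open>w\<close>
    to \<open>x - w\<close> preserves the null set of bad arguments, for every
    \<open>x\<close>.\<close>
  moreover have "AE x in lborel. AE w in lborel. integrable lborel (\<lambda>y. ?n f (x - w - y) * ?n g y)"
  proof -
    have "AE v in lborel. integrable lborel (\<lambda>y. ?n f (v - y) * ?n g y)"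
      by (rule AE_integrable_conv[OF n(1,2)])
    then obtain N where N: "N \<in> null_sets lborel" "{v. \<not> integrable lborel (\<lambda>y. ?n f (v - y) * ?n g y)} \<subseteq> N"
      by (auto elim!: AE_E simp: null_sets_def)
    have [measurable]: "N \<in> sets borel" using N by auto
    have "AE w in lborel. x - w \<notin> N" for x
    proof -
      have "(\<integral>\<^sup>+w. indicator N (x - w) \<partial>lborel) = (\<integral>\<^sup>+w. indicator N w \<partial>lborel)"
        by (rule lborel_nn_reflect_invariant) simp
      also have "\<dots> = 0" using N by auto
      finally have "AE w in lborel. indicator N (x - w) = (0::ennreal)"
        by (subst (asm) nn_integral_0_iff_AE) auto
      then show ?thesis by (auto simp: indicator_def elim: eventually_mono)
    qed
    then have "AE w in lborel. integrable lborel (\<lambda>y. ?n f (x - w - y) * ?n g y)" for x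
      by (rule eventually_mono) (use N in blast)
    then show ?thesis by simp
  qed
  ultimately show ?thesis
  proof eventually_elim
    case (elim x)
    have "(\<integral>\<^sup>+w. (\<integral>\<^sup>+y. ennreal (norm (f (x - w - y))) * ennreal (norm (g y)) \<partial>lborel) * ennreal (norm (h w)) \<partial>lborel) =
       (\<integral>\<^sup>+w. ennreal (norm (conv (?n f) (?n g) (x - w) * ?n h w)) \<partial>lborel)"
    proof (rule nn_integral_cong_AE, use elim(2) in eventually_elim)
      case (elim w)
      have i: "integrable lborel (\<lambda>y. norm (f (x - w - y)) * norm (g y))"
        using elim by (simp only: complex_of_real_integrable_eq flip: of_real_mult)
      have "conv (?n f) (?n g) (x - w) = of_real (LINT y|lborel. norm (f (x - w - y)) * norm (g y))"
        unfolding conv_def by (simp flip: of_real_mult)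
      moreover have "(LINT y|lborel. norm (f (x - w - y)) * norm (g y)) \<ge> 0" by simp
      ultimately have "norm (conv (?n f) (?n g) (x - w)) = (LINT y|lborel. norm (f (x - w - y)) * norm (g y))"
        by simp
      also have "ennreal \<dots> = (\<integral>\<^sup>+y. ennreal (norm (f (x - w - y))) * ennreal (norm (g y)) \<partial>lborel)"
        using i by (simp add: nn_integral_eq_integral flip: ennreal_mult)
      finally show ?case by (simp add: norm_mult ennreal_mult)
    qed
    also have "\<dots> < \<infinity>" using elim(1) by (simp only: integrable_iff_bounded)
    finally have "integrable (lborel \<Otimes>\<^sub>M lborel) (\<lambda>(y, w). f (x - y) * g (y - w) * h w)"
      by (intro integrable_conv_triple) auto
    then show ?case by (intro conv_assoc_pointwise) auto
  qed
qed

section \<open>The Beta integral for complex parameters\<close>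

lemma of_real_powr_measurable [measurable]:
  "(\<lambda>x::real. complex_of_real x powr z) \<in> borel_measurable borel"
proof -
  have "complex_of_real x powr z = (if x = 0 then 0 else if x > 0 then exp (z * of_real (ln x))
      else exp (z * (of_real (ln (- x)) + of_real pi * \<i>)))" for x
    using Ln_of_real'[of x] by (auto simp: powr_def Ln_of_real)
  then show ?thesis by simp
qed

lemma of_real_powr_measurable' [measurable (raw)]:
  "f \<in> borel_measurable M \<Longrightarrow> (\<lambda>x. complex_of_real (f x) powr z) \<in> borel_measurable M"
  by (rule measurable_compose[OF _ of_real_powr_measurable])

definition beta_integrand :: "complex \<Rightarrow> complex \<Rightarrow> real \<Rightarrow> real \<Rightarrow> complex" where
  "beta_integrand a b u t =
     (if 0 < t \<and> t < u then of_real (u - t) powr (a - 1) * of_real t powr (b - 1) else 0)"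

text \<open>The factor \<open>exp (- t)\<close> makes the power integrable on the half line, and it
  is multiplicative, so in a convolution it comes out as \<open>exp (- u)\<close> and leaves the
  Beta integrand.\<close>

definition gamma_density :: "complex \<Rightarrow> real \<Rightarrow> complex" where
  "gamma_density a t = (if 0 < t then of_real t powr (a - 1) / of_real (exp t) else 0)"

lemma beta_integrand_measurable [measurable]: "beta_integrand a b u \<in> borel_measurable borel"
  unfolding beta_integrand_def[abs_def] by measurable

lemma gamma_density_measurable [measurable]: "gamma_density a \<in> borel_measurable borel"
  unfolding gamma_density_def[abs_def] by measurable

lemma
  assumes "Re a > 0"
  shows integrable_gamma_density: "integrable lborel (gamma_density a)"
    and integral_gamma_density: "(LINT t|lborel. gamma_density a t) = Gamma a"
proof -
  let ?f = "\<lambda>t. complex_of_real t powr (a - 1) / of_real (exp t)"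
  have eq: "(\<lambda>t. indicator {0<..} t *\<^sub>R ?f t) = gamma_density a"
    by (auto simp: gamma_density_def indicator_def)
  have i: "?f absolutely_integrable_on {0<..}" by (rule absolutely_integrable_Gamma_integral'[OF assms])
  then have "integrable lebesgue (gamma_density a)" by (simp add: set_integrable_def eq)
  then show "integrable lborel (gamma_density a)" by (subst (asm) integrable_completion) auto
  have "(LINT t|lborel. gamma_density a t) = (LINT t|lebesgue. gamma_density a t)"
    by (subst integral_completion) auto
  also have "\<dots> = (LINT t:{0<..}|lebesgue. ?f t)" by (simp add: set_lebesgue_integral_def eq)
  also have "\<dots> = integral {0<..} ?f" by (rule set_lebesgue_integral_eq_integral(2)[OF i])
  also have "\<dots> = Gamma a" by (rule integral_unique[OF Gamma_integral_complex'[OF assms]])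
  finally show "(LINT t|lborel. gamma_density a t) = Gamma a" .
qed

lemma beta_integrand_scale:
  assumes "c > 0" "u > 0"
  shows "beta_integrand a b (c * u) (c * t) = of_real c powr (a + b - 2) * beta_integrand a b u t"
proof (cases "0 < t \<and> t < u")
  case True
  have "complex_of_real (c * u - c * t) = of_real c * of_real (u - t)" by (simp add: algebra_simps)
  then have "of_real (c * u - c * t) powr (a - 1) = of_real c powr (a - 1) * complex_of_real (u - t) powr (a - 1)"
    using True assms by (simp only:) (rule powr_times_real, auto)
  moreover have "of_real (c * t) powr (b - 1) = of_real c powr (b - 1) * complex_of_real t powr (b - 1)"
    unfolding of_real_mult by (rule powr_times_real) (use True assms in auto)
  moreover have "of_real c powr (a + b - 2) = complex_of_real c powr (a - 1) * of_real c powr (b - 1)"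
    by (simp flip: powr_add add: algebra_simps)
  ultimately show ?thesis using True assms by (simp add: beta_integrand_def)
next
  case False
  then have "\<not> (0 < c * t \<and> c * t < c * u)" using assms by (auto simp: zero_less_mult_iff)
  then show ?thesis using False by (auto simp: beta_integrand_def)
qed

lemma integral_beta_integrand_scale:
  assumes "u > 0"
  shows "(LINT t|lborel. beta_integrand a b u t) = of_real u powr (a + b - 1) * (LINT t|lborel. beta_integrand a b 1 t)"
proof -
  have "(LINT t|lborel. beta_integrand a b u t) = \<bar>u\<bar> *\<^sub>R (LINT t|lborel. beta_integrand a b u (0 + u * t))"
    by (rule lborel_integral_real_affine) (use assms in auto)
  also have "\<dots> = u *\<^sub>R (of_real u powr (a + b - 2) * (LINT t|lborel. beta_integrand a b 1 t))"
    using beta_integrand_scale[of u 1 a b] assms by simp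
  finally have 1: "(LINT t|lborel. beta_integrand a b u t) = \<dots>" .
  have "of_real u powr (a + b - 1) = complex_of_real u * of_real u powr (a + b - 2)"
    using assms powr_add[of "complex_of_real u" 1 "a + b - 2"] by (simp add: algebra_simps)
  with 1 show ?thesis by (simp add: scaleR_conv_of_real algebra_simps)
qed

lemma gamma_density_mult:
  "gamma_density a (u - t) * gamma_density b t = beta_integrand a b u t / of_real (exp u)"
  by (auto simp: gamma_density_def beta_integrand_def exp_diff)

text \<open>Convolving two Gamma densities gives integrability for almost every endpoint, hence for
  some positive one, since the unit interval is not a null set; scaling carries it to every
  endpoint.\<close>

lemma integrable_beta_integrand:
  assumes "Re a > 0" "Re b > 0"
  shows "integrable lborel (beta_integrand a b u)"
proof (cases "u > 0")
  case True
  have "AE x in lborel. integrable lborel (\<lambda>t. gamma_density a (x - t) * gamma_density b t)"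
    by (intro AE_integrable_conv integrable_gamma_density assms)
  moreover have "\<not> (AE x in lborel. x \<notin> {0<..<1::real})"
  proof
    assume "AE x in lborel. x \<notin> {0<..<1::real}"
    then have "{0<..<1::real} \<in> null_sets lborel" by (simp add: AE_iff_null_sets)
    then show False by (simp add: null_sets_def)
  qed
  ultimately have "\<exists>x>0. integrable lborel (\<lambda>t. gamma_density a (x - t) * gamma_density b t)"
    by (rule_tac ccontr) (erule notE, erule eventually_mono, auto)
  then obtain x where x: "0 < x" "integrable lborel (\<lambda>t. gamma_density a (x - t) * gamma_density b t)"
    by blast
  from x(2) have "integrable lborel (\<lambda>t. of_real (exp x) * (gamma_density a (x - t) * gamma_density b t))"
    by (rule integrable_mult_right)
  then have "integrable lborel (beta_integrand a b x)"
    by (simp add: gamma_density_mult)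
  then have "integrable lborel (\<lambda>t. of_real (u/x) powr (a + b - 2) * beta_integrand a b x t)"
    by (rule integrable_mult_right)
  also have "(\<lambda>t. of_real (u/x) powr (a + b - 2) * beta_integrand a b x t) =
      (\<lambda>t. beta_integrand a b u (0 + (u/x) * t))"
    using beta_integrand_scale[of "u/x" x a b] x True by simp
  also have "integrable lborel \<dots> \<longleftrightarrow> integrable lborel (beta_integrand a b u)"
    by (rule lborel_integrable_real_affine_iff) (use x True in auto)
  finally show ?thesis .
next
  case False
  then have "beta_integrand a b u = (\<lambda>t. 0)" by (auto simp: beta_integrand_def)
  then show ?thesis by simp
qed

lemma Gamma_nonzero_Re: "Re z > 0 \<Longrightarrow> Gamma z \<noteq> 0"
  by (auto simp: Gamma_eq_zero_iff elim!: nonpos_Ints_cases)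

text \<open>By scaling, the convolution of two Gamma densities is \<open>c\<close> times the density
  of parameter \<open>a + b\<close>. Comparing total integrals determines \<open>c\<close>.\<close>

lemma integral_beta_integrand:
  assumes "Re a > 0" "Re b > 0" "u > 0"
  shows "(LINT t|lborel. beta_integrand a b u t) = Beta a b * of_real u powr (a + b - 1)"
proof -
  define c where "c = (LINT t|lborel. beta_integrand a b 1 t)"
  have "conv (gamma_density a) (gamma_density b) = (\<lambda>u. c * gamma_density (a + b) u)"
  proof
    fix u
    have "conv (gamma_density a) (gamma_density b) u = (LINT t|lborel. beta_integrand a b u t) / of_real (exp u)"
      by (simp add: conv_def gamma_density_mult)
    also have "\<dots> = c * gamma_density (a + b) u"
    proof (cases "u > 0")
      case True
      then show ?thesis
        using integral_beta_integrand_scale[OF True, of a b] by (simp add: c_def gamma_density_def)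
    next
      case False
      then have "beta_integrand a b u = (\<lambda>t. 0)" by (auto simp: beta_integrand_def)
      then show ?thesis using False by (simp add: gamma_density_def)
    qed
    finally show "conv (gamma_density a) (gamma_density b) u = c * gamma_density (a + b) u" .
  qed
  then have "c * Gamma (a + b) = (LINT u|lborel. conv (gamma_density a) (gamma_density b) u)"
    using assms by (simp add: integral_gamma_density)
  also have "\<dots> = Gamma a * Gamma b"
    using assms by (simp add: integral_conv integral_gamma_density integrable_gamma_density)
  finally have "c * Gamma (a + b) = Gamma a * Gamma b" .
  moreover have "Gamma (a + b) \<noteq> 0"
    using assms by (intro Gamma_nonzero_Re) simp
  ultimately have "c = Beta a b" by (simp add: Beta_def field_simps)
  then show ?thesis using integral_beta_integrand_scale[OF assms(3), of a b] by (simp add: c_def)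
qed

lemma norm_of_real_powr: "x > 0 \<Longrightarrow> norm (complex_of_real x powr z) = x powr Re z"
  by (simp add: norm_powr_real_powr)

lemma norm_beta_integrand: "norm (beta_integrand a b u t) = norm (beta_integrand (Re a) (Re b) u t)"
  by (auto simp: beta_integrand_def norm_mult norm_of_real_powr simp del: of_real_diff)

lemma integral_norm_beta_integrand:
  assumes "Re a > 0" "Re b > 0" "u > 0"
  shows "(LINT t|lborel. norm (beta_integrand a b u t)) = Beta (Re a) (Re b) * u powr (Re a + Re b - 1)"
proof -
  have p: "complex_of_real v powr (complex_of_real x - 1) = of_real (v powr (x - 1))" if "v > 0" for v x
    using powr_of_real[of v "x - 1"] that by simp
  have r: "beta_integrand (Re a) (Re b) u t = of_real (norm (beta_integrand a b u t))" for t
    unfolding norm_beta_integrand[of a b] beta_integrand_def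
    using p[of "u - t" "Re a"] p[of t "Re b"] by (simp add: norm_mult norm_of_real_powr del: of_real_diff)
  have "complex_of_real (LINT t|lborel. norm (beta_integrand a b u t)) = (LINT t|lborel. beta_integrand (Re a) (Re b) u t)"
    by (simp add: r)
  also have "\<dots> = Beta (of_real (Re a)) (of_real (Re b)) * of_real u powr (of_real (Re a) + of_real (Re b) - 1)"
    using assms by (intro integral_beta_integrand) auto
  also have "\<dots> = of_real (Beta (Re a) (Re b) * u powr (Re a + Re b - 1))"
    using assms p[of u "Re a + Re b"] by (simp add: Beta_def Gamma_complex_of_real flip: of_real_add)
  finally show ?thesis by (simp only: of_real_eq_iff)
qed

section \<open>Truncated Riemann--Liouville kernels\<close>

text \<open>The truncation at \<open>L\<close> makes the kernel integrable on the whole line; it has no influence on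
  convolutions with functions supported in an interval of length at most \<open>L\<close>, at points of that interval.\<close>
definition rl_kernel :: "real \<Rightarrow> complex \<Rightarrow> real \<Rightarrow> complex" where
  "rl_kernel L a u = (if 0 < u \<and> u < L then of_real u powr (a - 1) * rGamma a else 0)"

lemma rl_kernel_measurable [measurable]: "rl_kernel L a \<in> borel_measurable borel"
  unfolding rl_kernel_def[abs_def] by measurable

lemma norm_rl_kernel: "norm (rl_kernel L a u) = (if 0 < u \<and> u < L then u powr (Re a - 1) * norm (rGamma a) else 0)"
  by (simp add: rl_kernel_def norm_mult norm_of_real_powr)

lemma integrable_rl_kernel:
  assumes "Re a > 0"
  shows "integrable lborel (rl_kernel L a)"
proof (rule Bochner_Integration.integrable_bound)
  show "integrable lborel (\<lambda>u. of_real (exp L) * rGamma a * gamma_density a u)"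
    by (intro integrable_mult_right integrable_gamma_density assms)
  have "norm (rl_kernel L a u) \<le> norm (of_real (exp L) * rGamma a * gamma_density a u)" for u
  proof (cases "0 < u \<and> u < L")
    case True
    then have "exp u \<le> exp L" by simp
    then have "1 \<le> exp L / exp u" by (simp add: field_simps)
    then have "u powr (Re a - 1) * norm (rGamma a) * 1 \<le> u powr (Re a - 1) * norm (rGamma a) * (exp L / exp u)"
      by (intro mult_left_mono) auto
    then show ?thesis using True
      by (simp add: norm_rl_kernel gamma_density_def norm_mult norm_divide norm_of_real_powr mult_ac)
  qed (auto simp: rl_kernel_def)
  then show "AE u in lborel. norm (rl_kernel L a u) \<le> norm (of_real (exp L) * rGamma a * gamma_density a u)" by simp
qed simp

lemma rl_kernel_mult:
  assumes "u \<le> L"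
  shows "rl_kernel L a (u - t) * rl_kernel L b t = rGamma a * rGamma b * beta_integrand a b u t"
  using assms by (auto simp: rl_kernel_def beta_integrand_def)

lemma rGamma_Beta:
  assumes "Re a > 0" "Re b > 0"
  shows "rGamma a * rGamma b * Beta a b = rGamma (a + b :: complex)"
  using assms Gamma_nonzero_Re[of a] Gamma_nonzero_Re[of b]
  by (simp add: Beta_def rGamma_inverse_Gamma field_simps)

lemma
  assumes "Re a > 0" "Re b > 0" "u \<le> L"
  shows integrable_rl_kernel_mult: "integrable lborel (\<lambda>t. rl_kernel L a (u - t) * rl_kernel L b t)"
    and integral_norm_rl_kernel_mult: "(LINT t|lborel. norm (rl_kernel L a (u - t) * rl_kernel L b t)) =
      norm (rGamma a) * norm (rGamma b) * Beta (Re a) (Re b) * (if 0 < u then u powr (Re a + Re b - 1) else 0)"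
proof -
  show "integrable lborel (\<lambda>t. rl_kernel L a (u - t) * rl_kernel L b t)"
    using assms by (simp add: rl_kernel_mult integrable_beta_integrand)
  have "beta_integrand a b u = (\<lambda>t. 0)" if "\<not> 0 < u"
    using that by (auto simp: beta_integrand_def)
  then show "(LINT t|lborel. norm (rl_kernel L a (u - t) * rl_kernel L b t)) =
      norm (rGamma a) * norm (rGamma b) * Beta (Re a) (Re b) * (if 0 < u then u powr (Re a + Re b - 1) else 0)"
    using assms by (auto simp: rl_kernel_mult norm_mult integral_norm_beta_integrand)
qed

text \<open>The Beta integral in the normalisation that makes orders add. The inequality
  \<open>u < L\<close> is strict because the right-hand side is cut to 0 at \<open>u = L\<close>,
  while the left-hand side is not.\<close>

lemma conv_rl_kernel:
  assumes "Re a > 0" "Re b > 0" "u < L"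
  shows "conv (rl_kernel L a) (rl_kernel L b) u = rl_kernel L (a + b) u"
proof (cases "u > 0")
  case True
  then show ?thesis
    using assms rGamma_Beta[OF assms(1,2)]
    by (simp add: conv_def rl_kernel_mult integral_beta_integrand mult.assoc[symmetric]) (simp add: rl_kernel_def)
next
  case False
  then have "beta_integrand a b u = (\<lambda>t. 0)" by (auto simp: beta_integrand_def)
  then have "conv (rl_kernel L a) (rl_kernel L b) u = 0" using assms by (simp add: conv_def rl_kernel_mult)
  then show ?thesis using False by (simp add: rl_kernel_def)
qed

text \<open>Makes the ratio test applicable to \<open>1 / Gamma (z + \<Upsilon> r)\<close> for complex \<open>\<Upsilon>\<close>, since consecutive
  terms have the ratio \<open>Beta (z + \<Upsilon> r) \<Upsilon> / Gamma \<Upsilon>\<close>.\<close>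
lemma Beta_tendsto_0:
  fixes z \<Upsilon> :: complex
  assumes "Re z > 0" "Re \<Upsilon> > 0"
  shows "(\<lambda>r. Beta (z + \<Upsilon> * of_nat r) \<Upsilon>) \<longlonglongrightarrow> 0"
proof -
  have re: "Re (z + \<Upsilon> * of_nat r) > 0" for r
    using assms by (simp add: add_pos_nonneg)
  have "(\<lambda>r. LINT t|lborel. beta_integrand (z + \<Upsilon> * of_nat r) \<Upsilon> 1 t) \<longlonglongrightarrow> (LINT t|(lborel :: real measure). 0)"
  \<comment> \<open>For \<open>0 < t < 1\<close> the norm of the integrand is its value for
    \<open>r = 0\<close> times the \<open>r\<close>-th power of
    \<open>(1 - t) powr Re \<Upsilon> < 1\<close>. So it tends to 0, and the case
    \<open>r = 0\<close> dominates.\<close>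
  proof (rule integral_dominated_convergence)
    show "integrable lborel (\<lambda>t. norm (beta_integrand z \<Upsilon> 1 t))"
      using assms by (intro integrable_norm integrable_beta_integrand)
    show "AE t in lborel. (\<lambda>r. beta_integrand (z + \<Upsilon> * of_nat r) \<Upsilon> 1 t) \<longlonglongrightarrow> 0"
    proof (rule AE_I2)
      fix t :: real
      show "(\<lambda>r. beta_integrand (z + \<Upsilon> * of_nat r) \<Upsilon> 1 t) \<longlonglongrightarrow> 0"
      proof (cases "0 < t \<and> t < 1")
        case True
        define x where "x = (1 - t) powr Re \<Upsilon>"
        have x: "0 < x" "x < 1" using True assms powr_less_mono2[of "Re \<Upsilon>" "1 - t" 1] by (auto simp: x_def)
        have "norm (beta_integrand (z + \<Upsilon> * of_nat r) \<Upsilon> 1 t) = x ^ r * norm (beta_integrand z \<Upsilon> 1 t)" for r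
        proof -
          have "(1 - t) powr (Re z + Re \<Upsilon> * real r - 1) = (1 - t) powr (Re z - 1) * x ^ r"
            using True by (simp add: x_def powr_powr powr_realpow[symmetric] powr_add[symmetric] algebra_simps)
          then show ?thesis using True
            by (simp add: beta_integrand_def norm_mult norm_of_real_powr del: of_real_diff)
        qed
        moreover have "(\<lambda>r. x ^ r * norm (beta_integrand z \<Upsilon> 1 t)) \<longlonglongrightarrow> 0 * norm (beta_integrand z \<Upsilon> 1 t)"
          using x by (intro tendsto_mult LIMSEQ_realpow_zero tendsto_const) auto
        ultimately show ?thesis by (subst tendsto_norm_zero_iff[symmetric]) simp
      next
        case False
        then have "beta_integrand w \<Upsilon> 1 t = 0" for w by (auto simp: beta_integrand_def)
        then show ?thesis by simp
      qed
    qed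
    show "AE t in lborel. norm (beta_integrand (z + \<Upsilon> * of_nat r) \<Upsilon> 1 t) \<le> norm (beta_integrand z \<Upsilon> 1 t)" for r
    proof (rule AE_I2)
      fix t :: real
      show "norm (beta_integrand (z + \<Upsilon> * of_nat r) \<Upsilon> 1 t) \<le> norm (beta_integrand z \<Upsilon> 1 t)"
      proof (cases "0 < t \<and> t < 1")
        case True
        then have "(1 - t) powr (Re z + Re \<Upsilon> * real r - 1) \<le> (1 - t) powr (Re z - 1)"
          using assms by (intro powr_mono') auto
        then show ?thesis using True
          by (simp add: beta_integrand_def norm_mult norm_of_real_powr mult_right_mono del: of_real_diff)
      next
        case False
        then have "beta_integrand w \<Upsilon> 1 t = 0" for w by (auto simp: beta_integrand_def)
        then show ?thesis by simp
      qed
    qed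
  qed simp_all
  then show ?thesis using integral_beta_integrand[OF re assms(2)] by simp
qed

text \<open>The ratio of consecutive terms tends to 0, whatever \<open>x\<close> is; 1/2 is just a
  convenient ratio below 1. The instance \<open>\<Upsilon> = 1\<close> serves the summation over
  \<open>s\<close>.\<close>

lemma summable_power_rGamma:
  fixes z \<Upsilon> :: complex
  assumes z: "Re z > 0" and \<Upsilon>: "Re \<Upsilon> > 0" and x: "x \<ge> 0"
  shows "summable (\<lambda>r. x ^ r * norm (rGamma (z + \<Upsilon> * of_nat r)))"
proof -
  have re: "Re (z + \<Upsilon> * of_nat r) > 0" for r
    using assms by (simp add: add_pos_nonneg)
  have "(\<lambda>r. x * norm (rGamma \<Upsilon>) * norm (Beta (z + \<Upsilon> * of_nat r) \<Upsilon>)) \<longlonglongrightarrow> x * norm (rGamma \<Upsilon>) * norm (0::complex)"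
    by (intro tendsto_intros Beta_tendsto_0 assms)
  then have "eventually (\<lambda>r. x * norm (rGamma \<Upsilon>) * norm (Beta (z + \<Upsilon> * of_nat r) \<Upsilon>) < 1 / 2) sequentially"
    by (rule order_tendstoD) simp
  then obtain N where N: "\<And>r. r \<ge> N \<Longrightarrow> x * norm (rGamma \<Upsilon>) * norm (Beta (z + \<Upsilon> * of_nat r) \<Upsilon>) < 1 / 2"
    by (auto simp: eventually_sequentially)
  show ?thesis
  proof (rule summable_ratio_test)
    fix r assume "r \<ge> N"
    have "z + \<Upsilon> * of_nat (Suc r) = (z + \<Upsilon> * of_nat r) + \<Upsilon>" by (simp add: algebra_simps)
    then have "rGamma (z + \<Upsilon> * of_nat (Suc r)) =
        rGamma (z + \<Upsilon> * of_nat r) * rGamma \<Upsilon> * Beta (z + \<Upsilon> * of_nat r) \<Upsilon>"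
      using rGamma_Beta[OF re[of r] \<Upsilon>] by metis
    then have "norm (x ^ Suc r * norm (rGamma (z + \<Upsilon> * of_nat (Suc r)))) =
       (x * norm (rGamma \<Upsilon>) * norm (Beta (z + \<Upsilon> * of_nat r) \<Upsilon>)) * norm (x ^ r * norm (rGamma (z + \<Upsilon> * of_nat r)))"
      using x by (simp add: norm_mult abs_mult)
    also have "\<dots> \<le> 1 / 2 * norm (x ^ r * norm (rGamma (z + \<Upsilon> * of_nat r)))"
      by (intro mult_right_mono) (use N[OF \<open>r \<ge> N\<close>] in auto)
    finally show "norm (x ^ Suc r * norm (rGamma (z + \<Upsilon> * of_nat (Suc r)))) \<le>
        1 / 2 * norm (x ^ r * norm (rGamma (z + \<Upsilon> * of_nat r)))" .
  qed simp
qed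

text \<open>All terms share the singularity at 0 of the lowest order: the excess power of
  \<open>u\<close> is bounded by the same power of \<open>L\<close>.\<close>

lemma norm_rl_kernel_step_le:
  assumes "Re \<Upsilon> > 0"
  shows "norm (rl_kernel L (z + \<Upsilon> * of_nat r) u) \<le>
    (L powr Re \<Upsilon>) ^ r * norm (rGamma (z + \<Upsilon> * of_nat r)) * (if 0 < u \<and> u < L then u powr (Re z - 1) else 0)"
proof (cases "0 < u \<and> u < L")
  case True
  have "u powr (Re z + Re \<Upsilon> * real r - 1) = u powr (Re z - 1) * (u powr Re \<Upsilon>) ^ r"
    using True by (simp add: powr_powr powr_realpow[symmetric] powr_add[symmetric] algebra_simps)
  also have "\<dots> \<le> u powr (Re z - 1) * (L powr Re \<Upsilon>) ^ r"
    using True assms by (intro mult_left_mono power_mono powr_mono2) auto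
  finally have "u powr (Re z + Re \<Upsilon> * real r - 1) * norm (rGamma (z + \<Upsilon> * of_nat r)) \<le>
     u powr (Re z - 1) * (L powr Re \<Upsilon>) ^ r * norm (rGamma (z + \<Upsilon> * of_nat r))"
    by (rule mult_right_mono) simp
  then show ?thesis using True by (simp add: norm_rl_kernel mult_ac)
qed (auto simp: rl_kernel_def)

section \<open>Double series of Riemann--Liouville kernels\<close>

text \<open>The library's infix \<open>abs_summable_on\<close> is ambiguous between two theories.\<close>
abbreviation abs_set_summable_on (infix "abs'_set'_summable'_on" 50) where
  "f abs_set_summable_on A \<equiv> Infinite_Set_Sum.abs_summable_on f A"

text \<open>Termwise integration as Fubini's theorem for the product of the counting measure with
  \<open>M\<close>.\<close>

lemma
  fixes f :: "'i::countable \<Rightarrow> 'a \<Rightarrow> 'b::{banach, second_countable_topology}"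
  assumes M: "sigma_finite_measure M"
    and f: "\<And>i. integrable M (f i)"
    and s: "(\<lambda>i. LINT x|M. norm (f i x)) abs_set_summable_on UNIV"
  shows integrable_infsetsum: "integrable M (\<lambda>x. infsetsum (\<lambda>i. f i x) UNIV)"
    and integral_infsetsum: "(LINT x|M. infsetsum (\<lambda>i. f i x) UNIV) = infsetsum (\<lambda>i. LINT x|M. f i x) UNIV"
proof -
  interpret M: sigma_finite_measure M by fact
  interpret I: sigma_finite_measure "count_space (UNIV :: 'i set)"
    by (rule sigma_finite_measure_count_space_countable) simp
  interpret pair_sigma_finite "count_space (UNIV :: 'i set)" M ..
  have "integrable (count_space UNIV \<Otimes>\<^sub>M M) (\<lambda>(i, x). f i x)"
  proof (rule Fubini_integrable)
    show "(\<lambda>(i, x). f i x) \<in> borel_measurable (count_space UNIV \<Otimes>\<^sub>M M)"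
      using f by (intro measurable_pair_measure_countable1) auto
    show "integrable (count_space UNIV) (\<lambda>i. LINT x|M. norm (case (i, x) of (i, x) \<Rightarrow> f i x))"
      using s by (simp add: abs_summable_on_def)
  qed (use f in auto)
  from integrable_snd[OF this] Fubini_integral[OF this]
  show "integrable M (\<lambda>x. infsetsum (\<lambda>i. f i x) UNIV)"
    and "(LINT x|M. infsetsum (\<lambda>i. f i x) UNIV) = infsetsum (\<lambda>i. LINT x|M. f i x) UNIV"
    by (simp_all add: infsetsum_def)
qed

definition tensor :: "('a \<Rightarrow> complex) \<Rightarrow> ('b \<Rightarrow> complex) \<Rightarrow> 'a \<times> 'b \<Rightarrow> complex" where
  "tensor g h = (\<lambda>(t, q). g t * h q)"

lemma tensor_measurable [measurable]:
  assumes [measurable]: "g \<in> borel_measurable borel" "h \<in> borel_measurable borel"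
  shows "tensor g h \<in> borel_measurable (borel :: ('a::euclidean_space \<times> 'b::euclidean_space) measure)"
  unfolding tensor_def by (simp add: borel_prod[symmetric])

lemma
  fixes g :: "'a::euclidean_space \<Rightarrow> complex" and h :: "'b::euclidean_space \<Rightarrow> complex"
  assumes g: "integrable lborel g" and h: "integrable lborel h"
  shows integrable_tensor: "integrable lborel (tensor g h)"
    and integral_tensor: "(LINT z|lborel. tensor g h z) = (LINT t|lborel. g t) * (LINT q|lborel. h q)"
proof -
  have [measurable]: "g \<in> borel_measurable borel" "h \<in> borel_measurable borel"
    using g h by (auto dest: borel_measurable_integrable)
  have i: "integrable (lborel \<Otimes>\<^sub>M lborel) (\<lambda>(t, q). g t * h q)"
  proof (rule lborel_pair.Fubini_integrable)
    show "integrable lborel (\<lambda>t. LINT q|lborel. norm (case (t, q) of (t, q) \<Rightarrow> g t * h q))"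
      using g by (simp add: norm_mult)
  qed (use h in \<open>auto simp: borel_prod\<close>)
  then show "integrable lborel (tensor g h)" by (simp add: tensor_def lborel_prod)
  show "(LINT z|lborel. tensor g h z) = (LINT t|lborel. g t) * (LINT q|lborel. h q)"
    using lborel_pair.integral_fst[OF i] by (simp add: tensor_def lborel_prod)
qed

text \<open>An unordered sum, so that products and regroupings of the series need no attention to
  the order of summation. Agreement with the iterated sum of the Mittag-Leffler function is shown in
  \<open>hk_mittag_leffler_kernel\<close>.\<close>

definition series_kernel :: "real \<Rightarrow> real \<Rightarrow> (nat \<times> nat \<Rightarrow> complex) \<Rightarrow> complex \<Rightarrow> complex \<Rightarrow> complex \<Rightarrow> real \<times> real \<Rightarrow> complex" where
  "series_kernel L M a \<kappa> \<rho> \<Upsilon> z =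
     infsetsum (\<lambda>p. a p * tensor (rl_kernel L (\<kappa> + of_nat (fst p))) (rl_kernel M (\<rho> + \<Upsilon> * of_nat (snd p))) z) UNIV"

text \<open>The growth that the reciprocal Gamma factors of the kernels absorb, for every truncation
  length.\<close>

definition geometric_bound :: "(nat \<times> nat \<Rightarrow> complex) \<Rightarrow> bool" where
  "geometric_bound a \<longleftrightarrow> (\<exists>B K N. K \<ge> 0 \<and> N \<ge> 0 \<and> (\<forall>s r. norm (a (s, r)) \<le> B * K ^ s * N ^ r))"

lemma geometric_bound_summable:
  assumes a: "geometric_bound a" and pos: "Re \<kappa> > 0" "Re \<rho> > 0" "Re \<Upsilon> > 0" and L: "L \<ge> 0" "M \<ge> 0"
  shows "(\<lambda>p. norm (a p) * (L ^ fst p * norm (rGamma (\<kappa> + of_nat (fst p)))) *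
     (M ^ snd p * norm (rGamma (\<rho> + \<Upsilon> * of_nat (snd p))))) abs_set_summable_on UNIV"
proof -
  from a obtain B K N where K: "K \<ge> 0" "N \<ge> 0" and b: "\<And>s r. norm (a (s, r)) \<le> B * K ^ s * N ^ r"
    by (auto simp: geometric_bound_def)
  have "norm (a (0, 0)) \<le> B" using b[of 0 0] by simp
  then have B: "B \<ge> 0" using norm_ge_zero order_trans by blast
  have 1: "(\<lambda>s. B * ((K * L) ^ s * norm (rGamma (\<kappa> + 1 * of_nat s)))) abs_set_summable_on UNIV"
    unfolding abs_summable_on_nat_iff' using summable_mult[OF summable_power_rGamma[of \<kappa> 1 "K * L"], of B] assms K B
    by (simp add: abs_mult)
  have 2: "(\<lambda>r. (N * M) ^ r * norm (rGamma (\<rho> + \<Upsilon> * of_nat r))) abs_set_summable_on UNIV"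
    unfolding abs_summable_on_nat_iff' using summable_power_rGamma[of \<rho> \<Upsilon> "N * M"] assms K
    by (auto simp: abs_mult)
  have "(\<lambda>(s, r). (B * ((K * L) ^ s * norm (rGamma (\<kappa> + 1 * of_nat s)))) * ((N * M) ^ r * norm (rGamma (\<rho> + \<Upsilon> * of_nat r))))
     abs_set_summable_on UNIV \<times> UNIV"
    by (rule abs_summable_on_product[OF _ _ 1 2]) auto
  then have "(\<lambda>(s, r). (B * ((K * L) ^ s * norm (rGamma (\<kappa> + of_nat s)))) * ((N * M) ^ r * norm (rGamma (\<rho> + \<Upsilon> * of_nat r))))
     abs_set_summable_on UNIV" by simp
  then show ?thesis
  proof (rule abs_summable_on_comparison_test)
    fix p :: "nat \<times> nat"
    obtain s r where p: "p = (s, r)" by (cases p)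
    have "norm (a (s, r)) * (L ^ s * norm (rGamma (\<kappa> + of_nat s)) * (M ^ r * norm (rGamma (\<rho> + \<Upsilon> * of_nat r))))
       \<le> (B * K ^ s * N ^ r) * (L ^ s * norm (rGamma (\<kappa> + of_nat s)) * (M ^ r * norm (rGamma (\<rho> + \<Upsilon> * of_nat r))))"
      using b L by (intro mult_right_mono) auto
    then show "norm (norm (a p) * (L ^ fst p * norm (rGamma (\<kappa> + of_nat (fst p)))) *
       (M ^ snd p * norm (rGamma (\<rho> + \<Upsilon> * of_nat (snd p))))) \<le>
       norm (case p of (s, r) \<Rightarrow> (B * ((K * L) ^ s * norm (rGamma (\<kappa> + of_nat s)))) * ((N * M) ^ r * norm (rGamma (\<rho> + \<Upsilon> * of_nat r))))"
      using K L B by (simp add: p abs_mult power_mult_distrib mult_ac)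
  qed
qed

abbreviation series_term :: "real \<Rightarrow> real \<Rightarrow> (nat \<times> nat \<Rightarrow> complex) \<Rightarrow> complex \<Rightarrow> complex \<Rightarrow> complex \<Rightarrow> nat \<times> nat \<Rightarrow> real \<times> real \<Rightarrow> complex" where
  "series_term L M a \<kappa> \<rho> \<Upsilon> p z \<equiv>
     a p * tensor (rl_kernel L (\<kappa> + of_nat (fst p))) (rl_kernel M (\<rho> + \<Upsilon> * of_nat (snd p))) z"

lemma norm_rl_kernel_step_le':
  assumes "Re \<Upsilon> > 0" "Re z > 0"
  shows "norm (rl_kernel L (z + \<Upsilon> * of_nat r) u) \<le>
    (L powr Re \<Upsilon>) ^ r * norm (rGamma (z + \<Upsilon> * of_nat r)) * norm (Gamma z * rl_kernel L z u)"
proof -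
  have "norm (Gamma z * rl_kernel L z u) = (if 0 < u \<and> u < L then u powr (Re z - 1) else 0)"
    using Gamma_nonzero_Re[OF assms(2)] by (simp add: norm_mult norm_rl_kernel rGamma_inverse_Gamma norm_inverse)
  then show ?thesis using norm_rl_kernel_step_le[OF assms(1), of L z r u] by simp
qed

text \<open>The majorant separates the index from the point, so it yields summability at every point
  and summability of the integrals at once. The factor \<open>Gamma \<kappa> * Gamma \<rho>\<close>
  in \<open>W\<close> cancels the normalisation of the kernels on the right.\<close>

lemma series_term_bound:
  assumes a: "geometric_bound a" and pos: "Re \<kappa> > 0" "Re \<rho> > 0" "Re \<Upsilon> > 0" and L: "L \<ge> 0" "M \<ge> 0"
  obtains W where "W abs_set_summable_on UNIV"
    "\<And>p z. norm (series_term L M a \<kappa> \<rho> \<Upsilon> p z) \<le> W p * norm (tensor (rl_kernel L \<kappa>) (rl_kernel M \<rho>) z)"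
proof -
  define W where "W p = norm (a p) * (L ^ fst p * norm (rGamma (\<kappa> + of_nat (fst p)))) *
     ((M powr Re \<Upsilon>) ^ snd p * norm (rGamma (\<rho> + \<Upsilon> * of_nat (snd p)))) * norm (Gamma \<kappa> * Gamma \<rho>)" for p
  show ?thesis
  proof
    show "W abs_set_summable_on UNIV"
      unfolding W_def[abs_def]
      by (intro abs_summable_on_cmult_left geometric_bound_summable[OF a pos]) (use L in auto)
    fix p z
    have "norm (rl_kernel L (\<kappa> + of_nat (fst p)) (fst z)) * norm (rl_kernel M (\<rho> + \<Upsilon> * of_nat (snd p)) (snd z)) \<le>
      (L ^ fst p * norm (rGamma (\<kappa> + of_nat (fst p))) * norm (Gamma \<kappa> * rl_kernel L \<kappa> (fst z))) *
      ((M powr Re \<Upsilon>) ^ snd p * norm (rGamma (\<rho> + \<Upsilon> * of_nat (snd p))) * norm (Gamma \<rho> * rl_kernel M \<rho> (snd z)))"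
      using L pos norm_rl_kernel_step_le'[of 1 \<kappa> L "fst p" "fst z"] by (intro mult_mono norm_rl_kernel_step_le') auto
    then have "norm (a p) * (norm (rl_kernel L (\<kappa> + of_nat (fst p)) (fst z)) * norm (rl_kernel M (\<rho> + \<Upsilon> * of_nat (snd p)) (snd z))) \<le>
      norm (a p) * ((L ^ fst p * norm (rGamma (\<kappa> + of_nat (fst p))) * norm (Gamma \<kappa> * rl_kernel L \<kappa> (fst z))) *
      ((M powr Re \<Upsilon>) ^ snd p * norm (rGamma (\<rho> + \<Upsilon> * of_nat (snd p))) * norm (Gamma \<rho> * rl_kernel M \<rho> (snd z))))"
      by (rule mult_left_mono) simp
    then show "norm (series_term L M a \<kappa> \<rho> \<Upsilon> p z) \<le> W p * norm (tensor (rl_kernel L \<kappa>) (rl_kernel M \<rho>) z)"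
      by (simp add: W_def tensor_def case_prod_unfold norm_mult mult_ac)
  qed
qed

lemma integrable_series_term:
  assumes "Re \<kappa> > 0" "Re \<rho> > 0" "Re \<Upsilon> > 0"
  shows "integrable lborel (series_term L M a \<kappa> \<rho> \<Upsilon> p)"
  using assms by (intro integrable_mult_right integrable_tensor integrable_rl_kernel) (auto intro!: add_pos_nonneg)

lemma
  assumes a: "geometric_bound a" and pos: "Re \<kappa> > 0" "Re \<rho> > 0" "Re \<Upsilon> > 0" and L: "L \<ge> 0" "M \<ge> 0"
  shows series_term_summable: "(\<lambda>p. series_term L M a \<kappa> \<rho> \<Upsilon> p z) abs_set_summable_on UNIV"
    and integrable_series_kernel: "integrable lborel (series_kernel L M a \<kappa> \<rho> \<Upsilon>)"
proof -
  obtain W where W: "W abs_set_summable_on UNIV"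
    and le: "\<And>p z. norm (series_term L M a \<kappa> \<rho> \<Upsilon> p z) \<le> W p * norm (tensor (rl_kernel L \<kappa>) (rl_kernel M \<rho>) z)"
    using series_term_bound[OF a pos L] by blast
  have bound: "g abs_set_summable_on UNIV" if "\<And>p. norm (g p) \<le> W p * c" for g :: "nat \<times> nat \<Rightarrow> 'c::{banach, second_countable_topology}" and c
  proof (rule abs_summable_on_comparison_test)
    show "(\<lambda>p. W p * c) abs_set_summable_on UNIV"
      by (intro abs_summable_on_cmult_left) (use W in simp)
    show "norm (g p) \<le> norm (W p * c)" for p
      using that[of p] by (rule order_trans) simp
  qed
  show "(\<lambda>p. series_term L M a \<kappa> \<rho> \<Upsilon> p z) abs_set_summable_on UNIV"
    by (rule bound, rule le)
  have t: "integrable lborel (tensor (rl_kernel L \<kappa>) (rl_kernel M \<rho>))"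
    by (intro integrable_tensor integrable_rl_kernel pos)
  have "integrable lborel (\<lambda>z. infsetsum (\<lambda>p. series_term L M a \<kappa> \<rho> \<Upsilon> p z) UNIV)"
  proof (rule integrable_infsetsum)
    show "(\<lambda>p. LINT z|lborel. norm (series_term L M a \<kappa> \<rho> \<Upsilon> p z)) abs_set_summable_on UNIV"
    proof (rule bound)
      fix p
      have "(LINT z|lborel. norm (series_term L M a \<kappa> \<rho> \<Upsilon> p z)) \<le> (LINT z|lborel. W p * norm (tensor (rl_kernel L \<kappa>) (rl_kernel M \<rho>) z))"
        by (intro integral_mono integrable_norm integrable_series_term pos integrable_mult_right t le)
      then show "norm (LINT z|lborel. norm (series_term L M a \<kappa> \<rho> \<Upsilon> p z)) \<le> W p * (LINT z|lborel. norm (tensor (rl_kernel L \<kappa>) (rl_kernel M \<rho>) z))"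
        by simp
    qed
  qed (intro integrable_series_term pos lborel.sigma_finite_measure_axioms)+
  then show "integrable lborel (series_kernel L M a \<kappa> \<rho> \<Upsilon>)"
    by (simp add: series_kernel_def[abs_def])
qed

lemma conv_tensor_integrand:
  "tensor f g ((u, v) - w) * tensor f' g' w = tensor (\<lambda>t. f (u - t) * f' t) (\<lambda>q. g (v - q) * g' q) w"
  by (cases w) (simp add: tensor_def)

lemma conv_tensor:
  assumes "integrable lborel (\<lambda>t. f (u - t) * f' t)" "integrable lborel (\<lambda>q. g (v - q) * g' q)"
  shows "conv (tensor f g) (tensor f' g') (u, v) = tensor (conv f f') (conv g g') (u, v)"
  using integral_tensor[OF assms] by (simp add: conv_def conv_tensor_integrand) (simp add: tensor_def conv_def)

text \<open>The product of the two series is a series over pairs of indices, integrated term by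
  term. Its terms are bounded by \<open>W (fst i) * W' (snd i) * E w\<close>, where \<open>E\<close>
  does not depend on the indices and is integrable because below \<open>L\<close> and
  \<open>M\<close> it is a product of two Beta integrands.\<close>

lemma conv_series_kernel:
  assumes a: "geometric_bound a" and b: "geometric_bound b"
    and pos: "Re \<kappa> > 0" "Re \<rho> > 0" "Re \<sigma> > 0" "Re \<eta> > 0" "Re \<Upsilon> > 0" and L: "L \<ge> 0" "M \<ge> 0"
    and uv: "u < L" "v < M"
  defines "T \<equiv> \<lambda>i. a (fst i) * b (snd i) *
       tensor (rl_kernel L (\<kappa> + \<sigma> + of_nat (fst (fst i) + fst (snd i)))) (rl_kernel M (\<rho> + \<eta> + \<Upsilon> * of_nat (snd (fst i) + snd (snd i)))) (u, v)"
  shows "T abs_set_summable_on UNIV"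
    and "conv (series_kernel L M a \<kappa> \<rho> \<Upsilon>) (series_kernel L M b \<sigma> \<eta> \<Upsilon>) (u, v) = infsetsum T UNIV"
proof -
  obtain W where W: "W abs_set_summable_on UNIV"
    and le: "\<And>p z. norm (series_term L M a \<kappa> \<rho> \<Upsilon> p z) \<le> W p * norm (tensor (rl_kernel L \<kappa>) (rl_kernel M \<rho>) z)"
    using series_term_bound[OF a pos(1,2,5) L] by blast
  obtain W' where W': "W' abs_set_summable_on UNIV"
    and le': "\<And>p z. norm (series_term L M b \<sigma> \<eta> \<Upsilon> p z) \<le> W' p * norm (tensor (rl_kernel L \<sigma>) (rl_kernel M \<eta>) z)"
    using series_term_bound[OF b pos(3-5) L] by blast
  define f where "f i w = series_term L M a \<kappa> \<rho> \<Upsilon> (fst i) ((u, v) - w) * series_term L M b \<sigma> \<eta> \<Upsilon> (snd i) w" for i w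
  define E where "E w = norm (tensor (rl_kernel L \<kappa>) (rl_kernel M \<rho>) ((u, v) - w) * tensor (rl_kernel L \<sigma>) (rl_kernel M \<eta>) w)" for w
  have E: "integrable lborel E"
    unfolding E_def conv_tensor_integrand
    using pos uv by (intro integrable_norm integrable_tensor integrable_rl_kernel_mult) auto
  have fE: "norm (f i w) \<le> W (fst i) * W' (snd i) * E w" for i w
  proof -
    have "norm (f i w) \<le> (W (fst i) * norm (tensor (rl_kernel L \<kappa>) (rl_kernel M \<rho>) ((u, v) - w))) * (W' (snd i) * norm (tensor (rl_kernel L \<sigma>) (rl_kernel M \<eta>) w))"
      unfolding f_def norm_mult[of "series_term L M a \<kappa> \<rho> \<Upsilon> (fst i) ((u, v) - w)"]
      by (intro mult_mono le le' norm_ge_zero order_trans[OF norm_ge_zero le])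
    then show ?thesis by (simp add: E_def norm_mult mult_ac)
  qed
  have fi: "integrable lborel (f i)" and If: "(LINT w|lborel. f i w) = T i" for i
  proof -
    obtain s r s' r' where i: "i = ((s, r), (s', r'))" by (metis surj_pair)
    have re: "Re (\<kappa> + of_nat s) > 0" "Re (\<rho> + \<Upsilon> * of_nat r) > 0" "Re (\<sigma> + of_nat s') > 0" "Re (\<eta> + \<Upsilon> * of_nat r') > 0"
      using pos by (auto intro!: add_pos_nonneg)
    have f: "f i = (\<lambda>w. (a (s, r) * b (s', r')) *
       (tensor (rl_kernel L (\<kappa> + of_nat s)) (rl_kernel M (\<rho> + \<Upsilon> * of_nat r)) ((u, v) - w) *
        tensor (rl_kernel L (\<sigma> + of_nat s')) (rl_kernel M (\<eta> + \<Upsilon> * of_nat r')) w))"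
      by (auto simp: f_def i mult_ac)
    note i1 = integrable_rl_kernel_mult[OF re(1) re(3) less_imp_le[OF uv(1)]]
    note i2 = integrable_rl_kernel_mult[OF re(2) re(4) less_imp_le[OF uv(2)]]
    show "integrable lborel (f i)"
      unfolding f conv_tensor_integrand by (intro integrable_mult_right integrable_tensor i1 i2)
    have "(LINT w|lborel. f i w) = (a (s, r) * b (s', r')) *
       conv (tensor (rl_kernel L (\<kappa> + of_nat s)) (rl_kernel M (\<rho> + \<Upsilon> * of_nat r)))
        (tensor (rl_kernel L (\<sigma> + of_nat s')) (rl_kernel M (\<eta> + \<Upsilon> * of_nat r'))) (u, v)"
      unfolding f conv_def by (rule integral_mult_right_zero)
    also have "\<dots> = T i"
      unfolding conv_tensor[OF i1 i2]
      using conv_rl_kernel[OF re(1) re(3) uv(1)] conv_rl_kernel[OF re(2) re(4) uv(2)]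
      by (simp add: T_def i tensor_def algebra_simps)
    finally show "(LINT w|lborel. f i w) = T i" .
  qed
  have "(\<lambda>(p, p'). W p * W' p') abs_set_summable_on UNIV \<times> UNIV"
    by (rule abs_summable_on_product[OF _ _ W W']) auto
  then have WW: "(\<lambda>i. W (fst i) * W' (snd i) * c) abs_set_summable_on UNIV" for c
    by (intro abs_summable_on_cmult_left) (simp add: case_prod_unfold)
  have int: "(LINT w|lborel. norm (f i w)) \<le> W (fst i) * W' (snd i) * (LINT w|lborel. E w)" for i
  proof -
    have "(LINT w|lborel. norm (f i w)) \<le> (LINT w|lborel. W (fst i) * W' (snd i) * E w)"
      by (intro integral_mono integrable_norm fi integrable_mult_right E fE)
    then show ?thesis by simp
  qed
  have s: "(\<lambda>i. LINT w|lborel. norm (f i w)) abs_set_summable_on UNIV"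
    using int by (intro abs_summable_on_comparison_test[OF WW[of "LINT w|lborel. E w"]])
      (auto intro: order_trans[OF _ abs_ge_self])
  show "T abs_set_summable_on UNIV"
  proof (rule abs_summable_on_comparison_test[OF s])
    show "norm (T i) \<le> norm (LINT w|lborel. norm (f i w))" for i
      unfolding If[symmetric] using integral_norm_bound[of lborel "f i"] by simp
  qed
  have "conv (series_kernel L M a \<kappa> \<rho> \<Upsilon>) (series_kernel L M b \<sigma> \<eta> \<Upsilon>) (u, v) =
     (LINT w|lborel. infsetsum (\<lambda>i. f i w) UNIV)"
    unfolding conv_def
  proof (rule Bochner_Integration.integral_cong[OF refl])
    fix w
    have "infsetsum (\<lambda>(p, p'). series_term L M a \<kappa> \<rho> \<Upsilon> p ((u, v) - w) * series_term L M b \<sigma> \<eta> \<Upsilon> p' w) (UNIV \<times> UNIV) =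
       series_kernel L M a \<kappa> \<rho> \<Upsilon> ((u, v) - w) * series_kernel L M b \<sigma> \<eta> \<Upsilon> w"
      unfolding series_kernel_def
      by (rule infsetsum_product) (use series_term_summable[OF a] series_term_summable[OF b] pos L in auto)
    then show "series_kernel L M a \<kappa> \<rho> \<Upsilon> ((u, v) - w) * series_kernel L M b \<sigma> \<eta> \<Upsilon> w = infsetsum (\<lambda>i. f i w) UNIV"
      by (simp add: f_def case_prod_unfold)
  qed
  also have "\<dots> = infsetsum T UNIV"
    using integral_infsetsum[OF lborel.sigma_finite_measure_axioms fi s] by (simp add: If)
  finally show "conv (series_kernel L M a \<kappa> \<rho> \<Upsilon>) (series_kernel L M b \<sigma> \<eta> \<Upsilon>) (u, v) = infsetsum T UNIV" .
qed

text \<open>Pairs of indices are regrouped by their componentwise sum \<open>q\<close>: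
  \<open>h\<close> attaches this sum to a pair, and \<open>B q\<close> is the finite fibre over
  \<open>q\<close>.\<close>

lemma infsetsum_double_Cauchy:
  fixes T :: "(nat \<times> nat) \<times> (nat \<times> nat) \<Rightarrow> complex"
  assumes "T abs_set_summable_on UNIV"
  shows "infsetsum T UNIV = infsetsum (\<lambda>q. \<Sum>s\<le>fst q. \<Sum>r\<le>snd q. T ((s, r), (fst q - s, snd q - r))) UNIV"
proof -
  define B where "B q = (\<lambda>(s, r). ((s, r), (fst q - s, snd q - r))) ` ({..fst q} \<times> {..snd q})" for q :: "nat \<times> nat"
  define h where "h = (\<lambda>((s, r), (s', r')). ((s + s', r + r'), ((s, r), (s', r'))) :: (nat \<times> nat) \<times> ((nat \<times> nat) \<times> (nat \<times> nat)))"
  have bij: "bij_betw h UNIV (Sigma UNIV B)"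
  proof (rule bij_betwI')
    show "h x = h y \<longleftrightarrow> x = y" for x y by (auto simp: h_def split: prod.splits)
    show "h x \<in> Sigma UNIV B" for x
    proof -
      obtain s r s' r' where x: "x = ((s, r), (s', r'))" by (metis surj_pair)
      show ?thesis unfolding x h_def B_def by (auto intro!: image_eqI[of _ _ "(s, r)"])
    qed
    show "\<exists>x\<in>UNIV. y = h x" if "y \<in> Sigma UNIV B" for y
      using that by (force simp: h_def B_def split: prod.splits)
  qed
  have snd_h: "snd (h x) = x" for x by (auto simp: h_def split: prod.splits)
  have s: "(\<lambda>y. T (snd y)) abs_set_summable_on Sigma UNIV B"
    using assms abs_summable_on_reindex_bij_betw[OF bij, of "\<lambda>y. T (snd y)"] by (simp add: snd_h)
  have "infsetsum T UNIV = infsetsum (\<lambda>x. T (snd (h x))) UNIV" by (simp add: snd_h)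
  also have "\<dots> = infsetsum (\<lambda>y. T (snd y)) (Sigma UNIV B)"
    by (rule infsetsum_reindex_bij_betw[OF bij])
  also have "\<dots> = infsetsum (\<lambda>q. infsetsum (\<lambda>x. T (snd (q, x))) (B q)) UNIV"
    by (rule infsetsum_Sigma) (use s in auto)
  also have "\<dots> = infsetsum (\<lambda>q. \<Sum>s\<le>fst q. \<Sum>r\<le>snd q. T ((s, r), (fst q - s, snd q - r))) UNIV"
  proof (rule infsetsum_cong)
    fix q
    have fin: "finite (B q)" by (simp add: B_def)
    have "infsetsum (\<lambda>x. T (snd (q, x))) (B q) = (\<Sum>x\<in>B q. T x)" using fin by simp
    also have "\<dots> = (\<Sum>(s, r)\<in>{..fst q} \<times> {..snd q}. T ((s, r), (fst q - s, snd q - r)))"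
      unfolding B_def by (subst sum.reindex) (auto simp: inj_on_def case_prod_unfold)
    also have "\<dots> = (\<Sum>s\<le>fst q. \<Sum>r\<le>snd q. T ((s, r), (fst q - s, snd q - r)))"
      by (simp add: sum.cartesian_product)
    finally show "infsetsum (\<lambda>x. T (snd (q, x))) (B q) = \<dots>" .
  qed simp
  finally show ?thesis .
qed

theorem conv_series_kernel_inverse:
  assumes a: "geometric_bound a" and b: "geometric_bound b"
    and pos: "Re \<kappa> > 0" "Re \<rho> > 0" "Re \<sigma> > 0" "Re \<eta> > 0" "Re \<Upsilon> > 0" and L: "L \<ge> 0" "M \<ge> 0"
    and uv: "u < L" "v < M"
    and inv: "\<And>S R. (\<Sum>s\<le>S. \<Sum>r\<le>R. a (s, r) * b (S - s, R - r)) = (if S = 0 \<and> R = 0 then 1 else 0)"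
  shows "conv (series_kernel L M a \<kappa> \<rho> \<Upsilon>) (series_kernel L M b \<sigma> \<eta> \<Upsilon>) (u, v) =
    tensor (rl_kernel L (\<kappa> + \<sigma>)) (rl_kernel M (\<rho> + \<eta>)) (u, v)"
proof -
  let ?G = "\<lambda>q. tensor (rl_kernel L (\<kappa> + \<sigma> + of_nat (fst q))) (rl_kernel M (\<rho> + \<eta> + \<Upsilon> * of_nat (snd q))) (u, v)"
  note c = conv_series_kernel[OF a b pos L uv]
  have "conv (series_kernel L M a \<kappa> \<rho> \<Upsilon>) (series_kernel L M b \<sigma> \<eta> \<Upsilon>) (u, v) =
    infsetsum (\<lambda>q. \<Sum>s\<le>fst q. \<Sum>r\<le>snd q. a (s, r) * b (fst q - s, snd q - r) * ?G q) UNIV"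
    unfolding c(2) infsetsum_double_Cauchy[OF c(1)] by (intro infsetsum_cong sum.cong) auto
  also have "\<dots> = infsetsum (\<lambda>q. (if fst q = 0 \<and> snd q = 0 then 1 else 0) * ?G q) UNIV"
    by (simp only: inv flip: sum_distrib_right)
  also have "\<dots> = infsetsum (\<lambda>q. ?G q) {(0, 0)}"
    by (rule infsetsum_cong_neutral) auto
  finally show ?thesis by simp
qed

section \<open>The Mittag-Leffler kernel\<close>

text \<open>What remains of the Mittag-Leffler coefficient, in its cancelled form, when the
  reciprocal Gamma factors are given to the kernels; the powers of \<nu> and \<open>w\<close> are
  included.\<close>

definition hk_weight :: "complex \<Rightarrow> complex \<Rightarrow> complex \<Rightarrow> complex \<Rightarrow> nat \<times> nat \<Rightarrow> complex" where
  "hk_weight g1 g2 \<nu> w = (\<lambda>(s, r). (pochhammer (g1 / 2) s / fact s) * (pochhammer (g2 + of_nat s) r / fact r) * (4 * \<nu>) ^ s * w ^ r)"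

lemma norm_pochhammer_le: "norm (pochhammer z n) \<le> pochhammer (norm z) n" for z :: complex
  unfolding pochhammer_prod prod_norm[symmetric]
  by (intro prod_mono) (auto intro: order_trans[OF norm_triangle_ineq])

lemma pochhammer_nat_fact: "pochhammer (real (Suc N)) n / fact n = real (N + n choose n)"
proof -
  have "fact N * pochhammer (real (Suc N)) n = (fact (N + n) :: real)"
    using pochhammer_product[of N "N + n" "1::real"] by (simp add: pochhammer_fact add.commute)
  moreover have "fact N * (fact n * real (N + n choose n)) = fact (N + n)"
    using binomial_fact[of n "N + n", where 'a=real] by (simp add: field_simps)
  ultimately have "fact N * pochhammer (real (Suc N)) n = fact N * (fact n * real (N + n choose n))" by simp
  then have "pochhammer (real (Suc N)) n = fact n * real (N + n choose n)"
    by (subst (asm) mult_cancel_left) (simp del: of_nat_Suc)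
  then show ?thesis by simp
qed

lemma pochhammer_mono:
  assumes "0 \<le> x" "x \<le> (y::real)" shows "pochhammer x n \<le> pochhammer y n"
  using assms unfolding pochhammer_prod by (intro prod_mono) auto

text \<open>Comparison with the parameter \<open>Suc N\<close>, for which the quotient is a binomial
  coefficient.\<close>

lemma norm_pochhammer_fact_le:
  fixes z :: complex
  assumes "norm z \<le> real (Suc N)"
  shows "norm (pochhammer z n / fact n) \<le> 2 ^ (N + n)"
proof -
  have "norm (pochhammer z n / fact n) = norm (pochhammer z n) / fact n" by (simp add: norm_divide)
  also have "\<dots> \<le> pochhammer (real (Suc N)) n / fact n"
    by (intro divide_right_mono order_trans[OF norm_pochhammer_le] pochhammer_mono assms) auto
  also have "\<dots> = real (N + n choose n)" by (rule pochhammer_nat_fact)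
  also have "\<dots> \<le> real (2 ^ (N + n))" by (simp only: of_nat_le_iff binomial_le_pow2)
  finally show ?thesis by simp
qed

lemma geometric_bound_hk_weight: "geometric_bound (hk_weight g1 g2 \<nu> w)"
proof -
  obtain N1 N2 where N: "norm (g1 / 2) \<le> real N1" "norm g2 \<le> real N2" using real_arch_simple by meson
  \<comment> \<open>16 is 2 * 2 * 4: a factor 2 from the first Pochhammer symbol, a factor 2 because
    the shift of \<open>g2\<close> by \<open>s\<close> enlarges the bound for the second one, and
    the 4 of the weight.\<close>
  have "norm (hk_weight g1 g2 \<nu> w (s, r)) \<le> 2 ^ (N1 + N2) * (16 * norm \<nu>) ^ s * (2 * norm w) ^ r" for s r
  proof -
    have "norm (g2 + of_nat s) \<le> real (Suc (N2 + s))"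
      using N(2) norm_triangle_ineq[of g2 "of_nat s"] by simp
    then have "norm (pochhammer (g1 / 2) s / fact s) * norm (pochhammer (g2 + of_nat s) r / fact r) \<le> 2 ^ (N1 + s) * 2 ^ (N2 + s + r)"
      using N by (intro mult_mono norm_pochhammer_fact_le) auto
    then have "norm (hk_weight g1 g2 \<nu> w (s, r)) \<le> 2 ^ (N1 + s) * 2 ^ (N2 + s + r) * (norm ((4 * \<nu>) ^ s) * norm (w ^ r))"
      unfolding hk_weight_def prod.case norm_mult by (simp only: mult.assoc[symmetric]) (intro mult_right_mono, auto)
    also have "\<dots> = 2 ^ (N1 + N2) * (16 * norm \<nu>) ^ s * (2 * norm w) ^ r"
    proof -
      have "(16::real) ^ s = 2 ^ s * 2 ^ s * 4 ^ s" unfolding power_mult_distrib[symmetric] by simp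
      then show ?thesis by (simp add: norm_power norm_mult power_add power_mult_distrib)
    qed
    finally show ?thesis .
  qed
  then show ?thesis unfolding geometric_bound_def
    by (intro exI[of _ "2 ^ (N1 + N2)"] exI[of _ "16 * norm \<nu>"] exI[of _ "2 * norm w"]) auto
qed

lemma pochhammer_Vandermonde:
  "(\<Sum>k\<le>n. (pochhammer a k / fact k) * (pochhammer b (n - k) / fact (n - k))) = pochhammer (a + b) n / fact n"
  for a b :: complex
proof -
  have "(\<Sum>k\<le>n. (pochhammer a k / fact k) * (pochhammer b (n - k) / fact (n - k))) =
     (\<Sum>k\<le>n. of_nat (n choose k) * pochhammer a k * pochhammer b (n - k)) / fact n"
    unfolding sum_divide_distrib by (intro sum.cong refl) (simp add: binomial_fact)
  then show ?thesis by (simp add: pochhammer_binomial_sum)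
qed

text \<open>In the sum over \<open>r\<close> the parameters \<open>- g2 + s\<close> and
  \<open>g2 + (S - s)\<close> add up to \<open>S\<close>, so Vandermonde's identity gives
  \<open>pochhammer S R / fact R\<close>, which is free of \<open>s\<close>. The sum over
  \<open>s\<close> then has parameters adding up to 0 and vanishes unless \<open>S = 0\<close>; in
  that case the factor left from the first step is \<open>pochhammer 0 R / fact R\<close>, which
  vanishes unless \<open>R = 0\<close>.\<close>

lemma hk_weight_inverse:
  "(\<Sum>s\<le>S. \<Sum>r\<le>R. hk_weight (- g1) (- g2) \<nu> w (s, r) * hk_weight g1 g2 \<nu> w (S - s, R - r)) = (if S = 0 \<and> R = 0 then 1 else 0)"
proof -
  have inner: "(\<Sum>r\<le>R. hk_weight (- g1) (- g2) \<nu> w (s, r) * hk_weight g1 g2 \<nu> w (S - s, R - r)) =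
     (pochhammer (- (g1 / 2)) s / fact s) * (pochhammer (g1 / 2) (S - s) / fact (S - s)) *
     ((4 * \<nu>) ^ S * w ^ R * (pochhammer (of_nat S) R / fact R))" if "s \<le> S" for s
  proof -
    have "(\<Sum>r\<le>R. hk_weight (- g1) (- g2) \<nu> w (s, r) * hk_weight g1 g2 \<nu> w (S - s, R - r)) =
      (\<Sum>r\<le>R. ((pochhammer (- (g1 / 2)) s / fact s) * (pochhammer (g1 / 2) (S - s) / fact (S - s)) * ((4 * \<nu>) ^ S * w ^ R)) *
      ((pochhammer (- g2 + of_nat s) r / fact r) * (pochhammer (g2 + of_nat (S - s)) (R - r) / fact (R - r))))"
    proof (intro sum.cong refl)
      fix r assume "r \<in> {..R}"
      then have p: "(4 * \<nu>) ^ S = (4 * \<nu>) ^ s * (4 * \<nu>) ^ (S - s)" "w ^ R = w ^ r * w ^ (R - r)"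
        using that by (metis le_add_diff_inverse power_add) (metis \<open>r \<in> {..R}\<close> atMost_iff le_add_diff_inverse power_add)
      show "hk_weight (- g1) (- g2) \<nu> w (s, r) * hk_weight g1 g2 \<nu> w (S - s, R - r) =
        ((pochhammer (- (g1 / 2)) s / fact s) * (pochhammer (g1 / 2) (S - s) / fact (S - s)) * ((4 * \<nu>) ^ S * w ^ R)) *
        ((pochhammer (- g2 + of_nat s) r / fact r) * (pochhammer (g2 + of_nat (S - s)) (R - r) / fact (R - r)))"
        unfolding p hk_weight_def prod.case by (simp add: mult_ac)
    qed
    also have "\<dots> = ((pochhammer (- (g1 / 2)) s / fact s) * (pochhammer (g1 / 2) (S - s) / fact (S - s)) * ((4 * \<nu>) ^ S * w ^ R)) *
       (pochhammer (of_nat S) R / fact R)"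
      unfolding sum_distrib_left[symmetric] pochhammer_Vandermonde using that by (simp add: of_nat_diff)
    finally show ?thesis by (simp only: mult.assoc)
  qed
  have "(\<Sum>s\<le>S. \<Sum>r\<le>R. hk_weight (- g1) (- g2) \<nu> w (s, r) * hk_weight g1 g2 \<nu> w (S - s, R - r)) =
     (\<Sum>s\<le>S. (pochhammer (- (g1 / 2)) s / fact s) * (pochhammer (g1 / 2) (S - s) / fact (S - s))) *
     ((4 * \<nu>) ^ S * w ^ R * (pochhammer (of_nat S) R / fact R))"
    unfolding sum_distrib_right by (intro sum.cong refl inner) simp
  also have "\<dots> = (pochhammer 0 S / fact S) * ((4 * \<nu>) ^ S * w ^ R * (pochhammer (of_nat S) R / fact R))"
    unfolding pochhammer_Vandermonde by simp
  finally show ?thesis by (simp add: pochhammer_0_left)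
qed

text \<open>Absolute convergence identifies the unordered sum with the iterated one. Summability of
  the bare series \<open>f\<close> comes from that of the kernel series, divided by the nonzero
  power factor \<open>c\<close>.\<close>

lemma hk_mittag_leffler_kernel:
  assumes pos: "Re \<kappa> > 0" "Re \<rho> > 0" "Re \<Upsilon> > 0" and t: "0 < t" "t < L" and q: "0 < q" "q < M"
  shows "of_real t powr (\<kappa> - 1) * of_real q powr (\<rho> - 1) *
     hk_mittag_leffler \<kappa> \<rho> \<Upsilon> g1 g2 ((g1 + 1) / 2) g2 (\<nu> * of_real t) (\<lambda>r. w ^ r * of_real q powr (\<Upsilon> * of_nat r)) =
     series_kernel L M (hk_weight g1 g2 \<nu> w) \<kappa> \<rho> \<Upsilon> (t, q)"
proof -
  define c where "c = complex_of_real t powr (\<kappa> - 1) * of_real q powr (\<rho> - 1)"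
  define f where "f p = hk_coeff g1 g2 ((g1 + 1) / 2) g2 (fst p) (snd p) * (\<nu> * of_real t) ^ fst p * (w ^ snd p * of_real q powr (\<Upsilon> * of_nat (snd p))) /
        (Gamma (\<kappa> + of_nat (fst p)) * Gamma (\<rho> + \<Upsilon> * of_nat (snd p)) * fact (snd p) * fact (fst p))" for p
  have c0: "c \<noteq> 0" using t q by (simp add: c_def)
  have trm: "series_term L M (hk_weight g1 g2 \<nu> w) \<kappa> \<rho> \<Upsilon> p (t, q) = c * f p" for p
  proof -
    obtain s r where p: "p = (s, r)" by (cases p)
    have "complex_of_real t powr (\<kappa> + of_nat s - 1) = of_real t powr (\<kappa> - 1) * of_real t ^ s"
      using t powr_add[of "complex_of_real t" "\<kappa> - 1" "of_nat s"] by (simp add: algebra_simps)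
    moreover have "complex_of_real q powr (\<rho> + \<Upsilon> * of_nat r - 1) = of_real q powr (\<rho> - 1) * of_real q powr (\<Upsilon> * of_nat r)"
      using powr_add[of "complex_of_real q" "\<rho> - 1" "\<Upsilon> * of_nat r"] by (simp add: algebra_simps)
    ultimately show ?thesis using t q
      by (simp add: p f_def c_def tensor_def rl_kernel_def hk_weight_def hk_coeff_def rGamma_inverse_Gamma power_mult_distrib
          field_simps)
  qed
  have s: "(\<lambda>p. c * f p) abs_set_summable_on UNIV"
    using series_term_summable[OF geometric_bound_hk_weight pos, of L M g1 g2 \<nu> w "(t, q)"] t q by (simp add: trm)
  then have "(\<lambda>p. (1 / c) * (c * f p)) abs_set_summable_on UNIV" by (rule abs_summable_on_cmult_right)
  then have fs: "f abs_set_summable_on UNIV \<times> UNIV" using c0 by simp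
  have inner: "infsetsum (\<lambda>r. f (s, r)) UNIV = (\<Sum>r. f (s, r))" for s
    using abs_summable_on_Sigma_project2[OF fs, of s] by (intro infsetsum_nat') simp
  have "infsetsum f UNIV = infsetsum (\<lambda>s. infsetsum (\<lambda>r. f (s, r)) UNIV) UNIV"
    using infsetsum_Times[OF _ _ fs] by simp
  also have "\<dots> = (\<Sum>s. infsetsum (\<lambda>r. f (s, r)) UNIV)"
    by (rule infsetsum_nat', rule abs_summable_on_Sigma_project1') (use fs in auto)
  also have "\<dots> = (\<Sum>s. \<Sum>r. f (s, r))" by (simp only: inner)
  finally have "infsetsum f UNIV = hk_mittag_leffler \<kappa> \<rho> \<Upsilon> g1 g2 ((g1 + 1) / 2) g2 (\<nu> * of_real t) (\<lambda>r. w ^ r * of_real q powr (\<Upsilon> * of_nat r))"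
    by (simp add: hk_mittag_leffler_def f_def)
  moreover have "series_kernel L M (hk_weight g1 g2 \<nu> w) \<kappa> \<rho> \<Upsilon> (t, q) = c * infsetsum f UNIV"
    unfolding series_kernel_def trm by (rule infsetsum_cmult_right) (use fs in auto)
  ultimately show ?thesis by (simp add: c_def)
qed

section \<open>Iterated integrals as convolutions\<close>

text \<open>The bridge from the \<open>lebesgue\<close> integrals of the definitions to Borel
  functions: the completed measure makes \<open>f\<close> measurable as soon as it agrees with
  \<open>g\<close> off a null set.\<close>

lemma
  fixes f g :: "'a::euclidean_space \<Rightarrow> 'b::{banach, second_countable_topology}"
  assumes [measurable]: "g \<in> borel_measurable borel" and eq: "AE x in lborel. f x = g x"
  shows integral_lebesgue_AE: "integral\<^sup>L lebesgue f = integral\<^sup>L lborel g"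
    and integrable_lebesgue_AE: "integrable lebesgue f \<longleftrightarrow> integrable lborel g"
proof -
  have eq': "AE x in lebesgue. f x = g x" using eq by (rule AE_completion)
  have g: "g \<in> borel_measurable lebesgue" by (intro measurable_completion) simp
  have f: "f \<in> borel_measurable lebesgue"
  proof (rule measurableI)
    fix S :: "'b set" assume S: "S \<in> sets borel"
    show "f -` S \<inter> space lebesgue \<in> sets lebesgue"
    proof (rule completion.in_sets_AE)
      show "g -` S \<inter> space lebesgue \<in> sets lebesgue" using g S by (rule measurable_sets)
      show "AE x in lebesgue. x \<in> g -` S \<inter> space lebesgue \<longleftrightarrow> x \<in> f -` S \<inter> space lebesgue"
        using eq' by eventually_elim simp
    qed simp
  qed simp
  show "integral\<^sup>L lebesgue f = integral\<^sup>L lborel g"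
    using integral_cong_AE[OF f g eq'] by (simp add: integral_completion)
  show "integrable lebesgue f \<longleftrightarrow> integrable lborel g"
    using integrable_cong_AE[OF f g eq'] by (simp add: integrable_completion)
qed

text \<open>The set where \<open>P\<close> fails need not be Borel, so Fubini's theorem is applied
  to a Borel null set containing it.\<close>

lemma
  fixes P :: "'a::euclidean_space \<times> 'b::euclidean_space \<Rightarrow> bool"
  assumes "AE z in lborel. P z"
  shows AE_lborel_fst: "AE x in lborel. AE y in lborel. P (x, y)"
    and AE_lborel_snd: "AE y in lborel. AE x in lborel. P (x, y)"
proof -
  obtain N where N: "N \<in> null_sets lborel" "{z. \<not> P z} \<subseteq> N"
    using assms by (auto elim!: AE_E simp: null_sets_def)
  have [measurable]: "N \<in> sets (borel \<Otimes>\<^sub>M borel)" unfolding borel_prod using N(1) by (simp add: null_sets_def)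
  have "AE z in lborel. z \<notin> N" using N(1) by (rule AE_not_in)
  then have "AE z in lborel \<Otimes>\<^sub>M lborel. z \<notin> N" unfolding lborel_prod .
  then have 1: "AE x in lborel. AE y in lborel. (x, y) \<notin> N" by (rule lborel_pair.AE_pair)
  then show "AE x in lborel. AE y in lborel. P (x, y)"
    using N(2) by (elim eventually_mono) auto
  have "AE y in lborel. AE x in lborel. (x, y) \<notin> N"
  proof (subst lborel_pair.AE_commute[symmetric])
    have "{x \<in> space (lborel \<Otimes>\<^sub>M lborel). (fst x, snd x) \<notin> N} = space (lborel \<Otimes>\<^sub>M lborel) - N" by auto
    also have "\<dots> \<in> sets (lborel \<Otimes>\<^sub>M lborel)"
      using N(1) by (intro sets.compl_sets) (simp add: lborel_prod null_sets_def)
    finally show "{x \<in> space (lborel \<Otimes>\<^sub>M lborel). (fst x, snd x) \<notin> N} \<in> sets (lborel \<Otimes>\<^sub>M lborel)" .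
  qed (rule 1)
  then show "AE y in lborel. AE x in lborel. P (x, y)"
    using N(2) by (elim eventually_mono) auto
qed

text \<open>\<open>K\<close> is the kernel formula of a definition and \<open>k\<close> its
  truncated Borel version on the plane. The supports of \<open>k\<close> and \<open>f0\<close> take
  over the role of the limits of integration. Both orders are needed: \<open>hk_integral\<close>
  integrates over the first variable inside, the fractional integrals over the second.\<close>

lemma
  fixes k f f0 :: "real \<times> real \<Rightarrow> complex"
  assumes [measurable]: "k \<in> borel_measurable borel" "f0 \<in> borel_measurable borel"
    and k_off: "\<And>t q. k (t, q) \<noteq> 0 \<Longrightarrow> 0 < t \<and> 0 < q"
    and f0_off: "\<And>t q. f0 (t, q) \<noteq> 0 \<Longrightarrow> A < t \<and> C < q"
    and K: "\<And>t q. \<lbrakk>0 < t; t < X - A; 0 < q; q < Y - C\<rbrakk> \<Longrightarrow> K t q = k (t, q)"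
    and f: "AE z in lborel. z \<in> {A<..<X} \<times> {C<..<Y} \<longrightarrow> f z = f0 z"
    and i: "integrable lborel (\<lambda>w. k ((X, Y) - w) * f0 w)"
  shows iterated_integral_conv: "(LINT q:{C<..<Y}|lebesgue. (LINT t:{A<..<X}|lebesgue. K (X - t) (Y - q) * f (t, q))) = conv k f0 (X, Y)"
    and iterated_integral_conv': "(LINT t:{A<..<X}|lebesgue. (LINT q:{C<..<Y}|lebesgue. K (X - t) (Y - q) * f (t, q))) = conv k f0 (X, Y)"
proof -
  have [measurable]: "k \<in> borel_measurable (borel \<Otimes>\<^sub>M borel)" "f0 \<in> borel_measurable (borel \<Otimes>\<^sub>M borel)"
    by (simp_all add: borel_prod)
  let ?g = "\<lambda>t q. k (X - t, Y - q) * f0 (t, q)"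
  have "(\<lambda>w. k ((X, Y) - w) * f0 w) = (\<lambda>(t, q). ?g t q)" by auto
  then have i': "integrable (lborel \<Otimes>\<^sub>M lborel) (\<lambda>(t, q). ?g t q)"
    and c: "conv k f0 (X, Y) = integral\<^sup>L (lborel \<Otimes>\<^sub>M lborel) (\<lambda>(t, q). ?g t q)"
    using i by (simp_all add: lborel_prod conv_def)
  have pt: "indicator {C<..<Y} q *\<^sub>R indicator {A<..<X} t *\<^sub>R (K (X - t) (Y - q) * f (t, q)) = ?g t q"
    if "(t, q) \<in> {A<..<X} \<times> {C<..<Y} \<longrightarrow> f (t, q) = f0 (t, q)" for t q
    using that K[of "X - t" "Y - q"] k_off[of "X - t" "Y - q"] f0_off[of t q]
    by (cases "?g t q = 0") (auto simp: indicator_def)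
  have off: "?g t q = 0" if "q \<notin> {C<..<Y} \<or> t \<notin> {A<..<X}" for t q
    using that k_off[of "X - t" "Y - q"] f0_off[of t q] by (cases "?g t q = 0") auto
  have "(LINT q:{C<..<Y}|lebesgue. (LINT t:{A<..<X}|lebesgue. K (X - t) (Y - q) * f (t, q))) =
     (LINT q|lborel. LINT t|lborel. ?g t q)"
    unfolding set_lebesgue_integral_def[where A="{C<..<Y}"]
  proof (rule integral_lebesgue_AE)
    show "AE q in lborel. indicator {C<..<Y} q *\<^sub>R (LINT t:{A<..<X}|lebesgue. K (X - t) (Y - q) * f (t, q)) = (LINT t|lborel. ?g t q)"
      using AE_lborel_snd[OF f]
    proof eventually_elim
      case (elim q)
      show ?case
      proof (cases "q \<in> {C<..<Y}")
        case True
        have "(LINT t:{A<..<X}|lebesgue. K (X - t) (Y - q) * f (t, q)) = (LINT t|lborel. ?g t q)"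
          unfolding set_lebesgue_integral_def
        proof (rule integral_lebesgue_AE)
          show "AE t in lborel. indicator {A<..<X} t *\<^sub>R (K (X - t) (Y - q) * f (t, q)) = ?g t q"
            using elim
          proof eventually_elim
            case (elim t)
            show ?case using pt[of t q, OF elim] True by simp
          qed
        qed measurable
        then show ?thesis using True by simp
      next
        case False
        then have "(\<lambda>t. ?g t q) = (\<lambda>t. 0)" by (intro ext off) simp
        then show ?thesis using False by simp
      qed
    qed
  qed measurable
  then show "(LINT q:{C<..<Y}|lebesgue. (LINT t:{A<..<X}|lebesgue. K (X - t) (Y - q) * f (t, q))) = conv k f0 (X, Y)"
    using lborel_pair.integral_snd[OF i'] c by simp
  have "(LINT t:{A<..<X}|lebesgue. (LINT q:{C<..<Y}|lebesgue. K (X - t) (Y - q) * f (t, q))) =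
     (LINT t|lborel. LINT q|lborel. ?g t q)"
    unfolding set_lebesgue_integral_def[where A="{A<..<X}"]
  proof (rule integral_lebesgue_AE)
    show "AE t in lborel. indicator {A<..<X} t *\<^sub>R (LINT q:{C<..<Y}|lebesgue. K (X - t) (Y - q) * f (t, q)) = (LINT q|lborel. ?g t q)"
      using AE_lborel_fst[OF f]
    proof eventually_elim
      case (elim t)
      show ?case
      proof (cases "t \<in> {A<..<X}")
        case True
        have "(LINT q:{C<..<Y}|lebesgue. K (X - t) (Y - q) * f (t, q)) = (LINT q|lborel. ?g t q)"
          unfolding set_lebesgue_integral_def
        proof (rule integral_lebesgue_AE)
          show "AE q in lborel. indicator {C<..<Y} q *\<^sub>R (K (X - t) (Y - q) * f (t, q)) = ?g t q"
            using elim
          proof eventually_elim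
            case (elim q)
            show ?case using pt[of t q, OF elim] True by simp
          qed
        qed measurable
        then show ?thesis using True by simp
      next
        case False
        then have "(\<lambda>q. ?g t q) = (\<lambda>q. 0)" by (intro ext off) simp
        then show ?thesis using False by simp
      qed
    qed
  qed measurable
  then show "(LINT t:{A<..<X}|lebesgue. (LINT q:{C<..<Y}|lebesgue. K (X - t) (Y - q) * f (t, q))) = conv k f0 (X, Y)"
    using lborel_pair.integral_fst[OF i'] c by simp
qed

text \<open>If the convolution of the norms of \<open>f\<close> and \<open>g\<close> is at most
  \<open>c\<close> at \<open>x - w\<close> for all \<open>w\<close> in the support of
  \<open>h\<close>, the triple integral is at most \<open>c\<close> times the norm of
  \<open>h\<close>. No exceptional \<open>x\<close> arises.\<close>

lemma integrable_conv_triple_bounded: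
  fixes f g h :: "'a::euclidean_space \<Rightarrow> complex"
  assumes [measurable]: "f \<in> borel_measurable borel" "g \<in> borel_measurable borel" and h: "integrable lborel h"
    and i: "\<And>w. h w \<noteq> 0 \<Longrightarrow> integrable lborel (\<lambda>y. f (x - w - y) * g y)"
    and b: "\<And>w. h w \<noteq> 0 \<Longrightarrow> (LINT y|lborel. norm (f (x - w - y) * g y)) \<le> c"
  shows "integrable (lborel \<Otimes>\<^sub>M lborel) (\<lambda>(y, w). f (x - y) * g (y - w) * h w)"
proof (rule integrable_conv_triple)
  have [measurable]: "h \<in> borel_measurable borel" using h by (auto dest: borel_measurable_integrable)
  show "h \<in> borel_measurable borel" by measurable
  have "(\<integral>\<^sup>+y. ennreal (norm (f (x - w - y))) * ennreal (norm (g y)) \<partial>lborel) * ennreal (norm (h w)) \<le> ennreal c * ennreal (norm (h w))" for w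
  proof (cases "h w = 0")
    case False
    have "(\<integral>\<^sup>+y. ennreal (norm (f (x - w - y))) * ennreal (norm (g y)) \<partial>lborel) =
       (\<integral>\<^sup>+y. ennreal (norm (f (x - w - y) * g y)) \<partial>lborel)"
      by (simp add: norm_mult ennreal_mult)
    also have "\<dots> = ennreal (LINT y|lborel. norm (f (x - w - y) * g y))"
      using i[OF False] by (intro nn_integral_eq_integral) auto
    also have "\<dots> \<le> ennreal c" using b[OF False] by (rule ennreal_leI)
    finally show ?thesis by (rule mult_right_mono) simp
  qed simp
  then have "(\<integral>\<^sup>+w. (\<integral>\<^sup>+y. ennreal (norm (f (x - w - y))) * ennreal (norm (g y)) \<partial>lborel) * ennreal (norm (h w)) \<partial>lborel) \<le>
     (\<integral>\<^sup>+w. ennreal c * ennreal (norm (h w)) \<partial>lborel)" by (intro nn_integral_mono)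
  also have "\<dots> = ennreal c * (\<integral>\<^sup>+w. ennreal (norm (h w)) \<partial>lborel)" by (rule nn_integral_cmult) simp
  also have "\<dots> < \<infinity>" using h by (auto simp: integrable_iff_bounded ennreal_mult_less_top)
  finally show "(\<integral>\<^sup>+w. (\<integral>\<^sup>+y. ennreal (norm (f (x - w - y))) * ennreal (norm (g y)) \<partial>lborel) * ennreal (norm (h w)) \<partial>lborel) < \<infinity>" .
qed measurable

lemma integrable_conv_fst:
  fixes f g h :: "'a::euclidean_space \<Rightarrow> complex"
  assumes "integrable (lborel \<Otimes>\<^sub>M lborel) (\<lambda>(y, w). f (x - y) * g (y - w) * h w)"
  shows "integrable lborel (\<lambda>y. f (x - y) * conv g h y)"
  using lborel_pair.integrable_fst[OF assms]
  by (simp add: conv_def mult.assoc)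

definition rl_kernel_bound :: "real \<Rightarrow> complex \<Rightarrow> complex \<Rightarrow> real" where
  "rl_kernel_bound L a b = norm (rGamma a) * norm (rGamma b) * Beta (Re a) (Re b) * L powr (Re a + Re b - 1)"

text \<open>The integral is a multiple of \<open>u powr (Re a + Re b - 1)\<close>. This stays
  bounded near 0 because the exponent is nonnegative, and it is largest at
  \<open>u = L\<close>.\<close>

lemma integral_norm_rl_kernel_mult_le:
  assumes "Re a > 0" "Re b > 0" "Re a + Re b \<ge> 1" "u < L" "L > 0"
  shows "(LINT t|lborel. norm (rl_kernel L a (u - t) * rl_kernel L b t)) \<le> rl_kernel_bound L a b"
proof -
  have "Beta (Re a) (Re b) \<ge> 0" using assms by (simp add: Beta_def)
  then show ?thesis
    unfolding integral_norm_rl_kernel_mult[OF assms(1,2) less_imp_le[OF assms(4)]] rl_kernel_bound_def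
    using assms by (intro mult_left_mono) (auto intro: powr_mono2)
qed

text \<open>The semigroup law of fractional integration at every point; \<open>p_off\<close> keeps
  the arguments of the composed kernel below the truncation.\<close>

lemma conv_rl_kernel_assoc:
  fixes p :: "real \<Rightarrow> complex"
  assumes pos: "Re a > 0" "Re b > 0" "Re a + Re b \<ge> 1" and p: "integrable lborel p"
    and p_off: "\<And>t. p t \<noteq> 0 \<Longrightarrow> x - t < L" and L: "L > 0"
  shows "conv (rl_kernel L a) (conv (rl_kernel L b) p) x = conv (rl_kernel L (a + b)) p x"
proof -
  have [measurable]: "p \<in> borel_measurable borel" using p by (auto dest: borel_measurable_integrable)
  have i: "integrable (lborel \<Otimes>\<^sub>M lborel) (\<lambda>(y, w). rl_kernel L a (x - y) * rl_kernel L b (y - w) * p w)"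
    using pos p L less_imp_le[OF p_off]
    by (intro integrable_conv_triple_bounded[where c="rl_kernel_bound L a b"] integrable_rl_kernel_mult integral_norm_rl_kernel_mult_le p_off) auto
  have "conv (rl_kernel L a) (conv (rl_kernel L b) p) x = conv (conv (rl_kernel L a) (rl_kernel L b)) p x"
    by (rule conv_assoc_pointwise[OF _ _ _ i]) auto
  also have "\<dots> = conv (rl_kernel L (a + b)) p x"
    unfolding conv_def[of _ p]
  proof (rule Bochner_Integration.integral_cong[OF refl])
    show "conv (rl_kernel L a) (rl_kernel L b) (x - y) * p y = rl_kernel L (a + b) (x - y) * p y" for y
      using conv_rl_kernel[OF pos(1,2) p_off] by (cases "p y = 0") auto
  qed
  finally show ?thesis .
qed

text \<open>The norm of a tensor product integrates to the product of the integrals, so the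
  one-dimensional bounds multiply and associativity holds at the given point. The second conclusion
  is the integrability needed to write the iterated fractional integral as a convolution.\<close>

lemma
  fixes p :: "real \<times> real \<Rightarrow> complex"
  assumes pos: "Re a > 0" "Re b > 0" "Re a + Re b \<ge> 1" "Re c > 0" "Re d > 0" "Re c + Re d \<ge> 1"
    and p: "integrable lborel p"
    and p_off: "\<And>t q. p (t, q) \<noteq> 0 \<Longrightarrow> x - t < L \<and> y - q < M" and L: "L > 0" "M > 0"
  shows conv_tensor_assoc: "conv (tensor (rl_kernel L a) (rl_kernel M c)) (conv (tensor (rl_kernel L b) (rl_kernel M d)) p) (x, y) =
      conv (tensor (rl_kernel L (a + b)) (rl_kernel M (c + d))) p (x, y)"
    and integrable_tensor_conv: "integrable lborel (\<lambda>w. tensor (rl_kernel L a) (rl_kernel M c) ((x, y) - w) * conv (tensor (rl_kernel L b) (rl_kernel M d)) p w)"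
proof -
  have [measurable]: "p \<in> borel_measurable borel" using p by (auto dest: borel_measurable_integrable)
  have int: "integrable lborel (\<lambda>z. tensor (rl_kernel L a) (rl_kernel M c) ((x, y) - w - z) * tensor (rl_kernel L b) (rl_kernel M d) z)" 
    and bd: "(LINT z|lborel. norm (tensor (rl_kernel L a) (rl_kernel M c) ((x, y) - w - z) * tensor (rl_kernel L b) (rl_kernel M d) z)) \<le> rl_kernel_bound L a b * rl_kernel_bound M c d"
    and cv: "conv (tensor (rl_kernel L a) (rl_kernel M c)) (tensor (rl_kernel L b) (rl_kernel M d)) ((x, y) - w) = tensor (rl_kernel L (a + b)) (rl_kernel M (c + d)) ((x, y) - w)"
    if "p w \<noteq> 0" for w
  proof -
    obtain t q where w: "w = (t, q)" by (cases w)
    have lt: "x - t < L" "y - q < M" using p_off[of t q] that w by auto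
    note i1 = integrable_rl_kernel_mult[OF pos(1,2) less_imp_le[OF lt(1)]]
    note i2 = integrable_rl_kernel_mult[OF pos(4,5) less_imp_le[OF lt(2)]]
    have xy: "(x, y) - w = (x - t, y - q)" by (simp add: w)
    show "integrable lborel (\<lambda>z. tensor (rl_kernel L a) (rl_kernel M c) ((x, y) - w - z) * tensor (rl_kernel L b) (rl_kernel M d) z)"
      unfolding xy conv_tensor_integrand by (intro integrable_tensor i1 i2)
    show "conv (tensor (rl_kernel L a) (rl_kernel M c)) (tensor (rl_kernel L b) (rl_kernel M d)) ((x, y) - w) = tensor (rl_kernel L (a + b)) (rl_kernel M (c + d)) ((x, y) - w)"
      unfolding xy conv_tensor[OF i1 i2] using conv_rl_kernel[OF pos(1,2) lt(1)] conv_rl_kernel[OF pos(4,5) lt(2)]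
      by (simp add: tensor_def)
    let ?g = "\<lambda>z. complex_of_real (norm (rl_kernel L a (x - t - z) * rl_kernel L b z))" and ?h = "\<lambda>z. complex_of_real (norm (rl_kernel M c (y - q - z) * rl_kernel M d z))"
    have g: "integrable lborel ?g" "integrable lborel ?h" using i1 i2 by auto
    have "complex_of_real (LINT z|lborel. norm (tensor (rl_kernel L a) (rl_kernel M c) ((x, y) - w - z) * tensor (rl_kernel L b) (rl_kernel M d) z)) =
       (LINT z|lborel. tensor ?g ?h z)"
      unfolding xy conv_tensor_integrand by (simp add: tensor_def case_prod_unfold norm_mult flip: integral_complex_of_real)
    also have "\<dots> = of_real ((LINT z|lborel. norm (rl_kernel L a (x - t - z) * rl_kernel L b z)) * (LINT z|lborel. norm (rl_kernel M c (y - q - z) * rl_kernel M d z)))"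
      unfolding integral_tensor[OF g] by (simp only: integral_complex_of_real of_real_mult)
    finally have eq: "(LINT z|lborel. norm (tensor (rl_kernel L a) (rl_kernel M c) ((x, y) - w - z) * tensor (rl_kernel L b) (rl_kernel M d) z)) =
       (LINT z|lborel. norm (rl_kernel L a (x - t - z) * rl_kernel L b z)) * (LINT z|lborel. norm (rl_kernel M c (y - q - z) * rl_kernel M d z))"
      by (simp only: of_real_eq_iff)
    show "(LINT z|lborel. norm (tensor (rl_kernel L a) (rl_kernel M c) ((x, y) - w - z) * tensor (rl_kernel L b) (rl_kernel M d) z)) \<le> rl_kernel_bound L a b * rl_kernel_bound M c d"
      unfolding eq using integral_norm_rl_kernel_mult_le[OF pos(1-3) lt(1) L(1)] integral_norm_rl_kernel_mult_le[OF pos(4-6) lt(2) L(2)]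
      by (intro mult_mono) (auto intro: order_trans[rotated])
  qed
  have i: "integrable (lborel \<Otimes>\<^sub>M lborel) (\<lambda>(z, w). tensor (rl_kernel L a) (rl_kernel M c) ((x, y) - z) * tensor (rl_kernel L b) (rl_kernel M d) (z - w) * p w)"
    by (rule integrable_conv_triple_bounded[where c="rl_kernel_bound L a b * rl_kernel_bound M c d"]) (use p int bd in auto)
  have "conv (tensor (rl_kernel L a) (rl_kernel M c)) (conv (tensor (rl_kernel L b) (rl_kernel M d)) p) (x, y) = conv (conv (tensor (rl_kernel L a) (rl_kernel M c)) (tensor (rl_kernel L b) (rl_kernel M d))) p (x, y)"
    by (rule conv_assoc_pointwise[OF _ _ _ i]) auto
  also have "\<dots> = conv (tensor (rl_kernel L (a + b)) (rl_kernel M (c + d))) p (x, y)"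
    unfolding conv_def[of _ p]
  proof (rule Bochner_Integration.integral_cong[OF refl])
    show "conv (tensor (rl_kernel L a) (rl_kernel M c)) (tensor (rl_kernel L b) (rl_kernel M d)) ((x, y) - w) * p w = tensor (rl_kernel L (a + b)) (rl_kernel M (c + d)) ((x, y) - w) * p w" for w
      using cv[of w] by (cases "p w = 0") auto
  qed
  finally show "conv (tensor (rl_kernel L a) (rl_kernel M c)) (conv (tensor (rl_kernel L b) (rl_kernel M d)) p) (x, y) =
      conv (tensor (rl_kernel L (a + b)) (rl_kernel M (c + d))) p (x, y)" .
  show "integrable lborel (\<lambda>w. tensor (rl_kernel L a) (rl_kernel M c) ((x, y) - w) * conv (tensor (rl_kernel L b) (rl_kernel M d)) p w)"
    by (rule integrable_conv_fst[OF i])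
qed

section \<open>Higher derivatives of iterated integrals\<close>

text \<open>The induction needs agreement near each point close to \<open>x\<close>; agreement near
  \<open>x\<close> provides it.\<close>

lemma has_nth_derivative_cong:
  assumes "eventually (\<lambda>y. f y = g y) (nhds x)"
  shows "has_nth_derivative k f x d \<longleftrightarrow> has_nth_derivative k g x d"
  using assms
proof (induction k arbitrary: x d)
  case 0
  then show ?case using eventually_nhds_x_imp_x by fastforce
next
  case (Suc k)
  have "eventually (\<lambda>y. \<forall>d. has_nth_derivative k f y d \<longleftrightarrow> has_nth_derivative k g y d) (nhds x)"
  proof -
    have "eventually (\<lambda>y. eventually (\<lambda>z. f z = g z) (nhds y)) (nhds x)"
      using Suc.prems by (simp add: eventually_eventually)
    then show ?thesis by (rule eventually_mono) (use Suc.IH in blast)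
  qed
  then have "eventually (\<lambda>y. has_nth_derivative k f y (h y)) (nhds x) \<longleftrightarrow> eventually (\<lambda>y. has_nth_derivative k g y (h y)) (nhds x)" for h
    by (intro eventually_subst) (auto elim: eventually_mono)
  then show ?case by simp
qed

lemma has_vector_derivative_cong_nhds:
  assumes "eventually (\<lambda>y. f y = g y) (nhds x)"
  shows "(f has_vector_derivative d) (at x) \<longleftrightarrow> (g has_vector_derivative d) (at x)"
  by (intro has_vector_derivative_cong_ev eventually_nhds_x_imp_x[OF assms] eventually_mono[OF assms]) simp

lemma has_nth_derivative_unique:
  assumes "has_nth_derivative k f x d" "has_nth_derivative k f x d'"
  shows "d = d'"
  using assms
proof (induction k arbitrary: x d d')
  case (Suc k)
  then obtain h h' where h: "\<forall>\<^sub>F y in nhds x. has_nth_derivative k f y (h y)" "(h has_vector_derivative d) (at x)"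
    and h': "\<forall>\<^sub>F y in nhds x. has_nth_derivative k f y (h' y)" "(h' has_vector_derivative d') (at x)"
    by auto
  have "\<forall>\<^sub>F y in nhds x. h y = h' y"
    using h(1) h'(1) by eventually_elim (rule Suc.IH)
  then have "(h' has_vector_derivative d) (at x)"
    using h(2) by (simp add: has_vector_derivative_cong_nhds)
  then show ?case using h'(2) by (rule vector_derivative_unique_at)
qed simp

lemma has_mixed_derivative_unique:
  assumes "has_mixed_derivative n m g z d" "has_mixed_derivative n m g z d'"
  shows "d = d'"
proof -
  obtain X Y where z: "z = (X, Y)" by (cases z)
  from assms obtain h h' where h: "\<forall>\<^sub>F x in nhds X. has_nth_derivative m (\<lambda>y. g (x, y)) Y (h x)" "has_nth_derivative n h X d"
    and h': "\<forall>\<^sub>F x in nhds X. has_nth_derivative m (\<lambda>y. g (x, y)) Y (h' x)" "has_nth_derivative n h' X d'"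
    unfolding has_mixed_derivative_def z by auto
  have "\<forall>\<^sub>F x in nhds X. h x = h' x"
    using h(1) h'(1) by eventually_elim (rule has_nth_derivative_unique)
  from has_nth_derivative_cong[OF this, of n d] h(2) h'(2) show ?thesis
    by (auto intro: has_nth_derivative_unique)
qed

lemma conv_rl_kernel_one:
  assumes p: "integrable lborel p" and off: "\<And>t. p t \<noteq> 0 \<Longrightarrow> C < t" and y: "y \<le> C + M"
  shows "conv (rl_kernel M 1) p y = integral {C..y} p"
proof -
  have [measurable]: "p \<in> borel_measurable borel" using p by (auto dest: borel_measurable_integrable)
  have "conv (rl_kernel M 1) p y = (LINT t:{C..y}|lborel. p t)"
    unfolding conv_def set_lebesgue_integral_def
  proof (rule integral_cong_AE)
    \<comment> \<open>At \<open>t = y\<close> the kernel of order 1 is 0 but the indicator of the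
      closed interval is 1.\<close>
    have "AE t in lborel. t \<noteq> y" by (rule AE_lborel_singleton)
    then show "AE t in lborel. rl_kernel M 1 (y - t) * p t = indicator {C..y} t *\<^sub>R p t"
    proof eventually_elim
      case (elim t)
      then show ?case using off[of t] y by (cases "p t = 0") (auto simp: rl_kernel_def indicator_def)
    qed
  qed auto
  also have "\<dots> = integral {C..y} p"
    using p by (intro set_borel_integral_eq_integral) (auto simp: set_integrable_def intro: integrable_mult_indicator)
  finally show ?thesis .
qed

lemma integrable_on_interval:
  fixes p :: "real \<Rightarrow> 'b::euclidean_space"
  assumes "integrable lborel p"
  shows "p integrable_on {a..b}"
proof (rule set_borel_integral_eq_integral(1))
  show "set_integrable lborel {a..b} p"
    using assms by (auto simp: set_integrable_def intro: integrable_mult_indicator)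
qed

section \<open>Kernels of integer order on an interval\<close>

context
  fixes p :: "real \<Rightarrow> complex" and C D M :: real
  assumes p: "integrable lborel p" and off: "\<And>t. p t \<noteq> 0 \<Longrightarrow> C < t \<and> t < D" and CD: "C < D" and M: "M = D - C"
begin

lemma conv_rl_kernel_Suc:
  assumes y: "C < y" "y < D" and j: "j \<ge> 1"
  shows "conv (rl_kernel M (of_nat (Suc j))) p y = integral {C..y} (conv (rl_kernel M (of_nat j)) p)"
proof -
  have "conv (rl_kernel M (of_nat (Suc j))) p y = conv (rl_kernel M (1 + of_nat j)) p y" by simp
  also have "\<dots> = conv (rl_kernel M 1) (conv (rl_kernel M (of_nat j)) p) y"
    by (rule conv_rl_kernel_assoc[symmetric]) (use p off CD M y j in \<open>force+\<close>)
  also have "\<dots> = integral {C..y} (conv (rl_kernel M (of_nat j)) p)"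
  proof (rule conv_rl_kernel_one)
    show "integrable lborel (conv (rl_kernel M (of_nat j)) p)"
      using j by (intro integrable_conv integrable_rl_kernel p) simp
    fix t assume "conv (rl_kernel M (of_nat j)) p t \<noteq> 0"
    then have "(\<lambda>w. rl_kernel M (of_nat j) (t - w) * p w) \<noteq> (\<lambda>w. 0)"
      unfolding conv_def by (metis Bochner_Integration.integral_zero)
    then obtain w where "rl_kernel M (of_nat j) (t - w) \<noteq> 0" "p w \<noteq> 0" by (auto simp: fun_eq_iff)
    then show "C < t" using off[of w] by (auto simp: rl_kernel_def split: if_splits)
  qed (use y M in auto)
  finally show ?thesis .
qed

lemma continuous_conv_rl_kernel:
  assumes j: "j \<ge> 1"
  shows "continuous_on {C<..<D} (conv (rl_kernel M (of_nat j)) p)"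
proof -
  \<comment> \<open>\<open>j = 1\<close> is separate: since \<open>rGamma 0 = 0\<close>, the kernel
    of order 0 is the zero function and does not act as the identity.\<close>
  define f where "f = (if j = 1 then p else conv (rl_kernel M (of_nat (j - 1))) p)"
  have "integrable lborel f"
    using j p by (auto simp: f_def intro!: integrable_conv integrable_rl_kernel)
  then have "continuous_on {C..D} (\<lambda>y. integral {C..y} f)"
    by (intro indefinite_integral_continuous_1 integrable_on_interval)
  then have "continuous_on {C<..<D} (\<lambda>y. integral {C..y} f)"
    by (rule continuous_on_subset) auto
  moreover have "conv (rl_kernel M (of_nat j)) p y = integral {C..y} f" if "y \<in> {C<..<D}" for y
    using that conv_rl_kernel_one[OF p, of C y M] off M conv_rl_kernel_Suc[of y "j - 1"] j
    by (cases "j = 1") (auto simp: f_def)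
  ultimately show ?thesis by (subst continuous_on_cong) auto
qed

text \<open>From order 2 on, the convolution is the indefinite integral of a continuous function, so
  lowering the order by one is possible at every point.\<close>

lemma has_vector_derivative_conv_rl_kernel_Suc:
  assumes y: "C < y" "y < D" and j: "j \<ge> 1"
  shows "(conv (rl_kernel M (of_nat (Suc j))) p has_vector_derivative conv (rl_kernel M (of_nat j)) p y) (at y)"
proof -
  let ?f = "conv (rl_kernel M (of_nat j)) p"
  have i: "?f integrable_on {C..D}"
    using j p by (intro integrable_on_interval integrable_conv integrable_rl_kernel) auto
  have "continuous (at y) ?f"
    using continuous_conv_rl_kernel[OF j] y by (simp add: continuous_on_eq_continuous_at)
  then have "((\<lambda>u. integral {C..u} ?f) has_vector_derivative ?f y) (at y within {C..D})"
    using integral_has_vector_derivative_continuous_at[OF i, of y "{}"] y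
    by (auto intro: continuous_at_imp_continuous_at_within)
  then have *: "((\<lambda>u. integral {C..u} ?f) has_vector_derivative ?f y) (at y)"
    by (subst (asm) at_within_interior) (use y in auto)
  have "\<forall>\<^sub>F u in nhds y. u \<in> {C<..<D}" using y by (intro eventually_nhds_in_open) auto
  then have "\<forall>\<^sub>F u in nhds y. conv (rl_kernel M (of_nat (Suc j))) p u = integral {C..u} ?f"
    by eventually_elim (use conv_rl_kernel_Suc j in auto)
  from has_vector_derivative_cong_nhds[OF this] *
  show ?thesis by blast
qed

lemma has_nth_derivative_conv_rl_kernel:
  assumes y: "C < y" "y < D" and j: "j \<ge> 1"
  shows "has_nth_derivative k (conv (rl_kernel M (of_nat (k + j))) p) y (conv (rl_kernel M (of_nat j)) p y)"
  using y j
proof (induction k arbitrary: j y)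
  case (Suc k)
  have "\<forall>\<^sub>F u in nhds y. u \<in> {C<..<D}" using Suc.prems by (intro eventually_nhds_in_open) auto
  then have "\<forall>\<^sub>F u in nhds y. has_nth_derivative k (conv (rl_kernel M (of_nat (k + Suc j))) p) u (conv (rl_kernel M (of_nat (Suc j))) p u)"
    by eventually_elim (rule Suc.IH, auto)
  then show ?case using has_vector_derivative_conv_rl_kernel_Suc[OF Suc.prems] by auto
qed simp

text \<open>All derivatives down to order 1 exist everywhere in the interval. Only the last one
  depends on \<open>y\<close>, and it is what the hypothesis on the indefinite integral
  supplies.\<close>

theorem has_nth_derivative_conv_rl_kernel_self:
  assumes y: "C < y" "y < D" and m: "m \<ge> 1"
    and d: "((\<lambda>u. integral {C..u} p) has_vector_derivative d) (at y)"
  shows "has_nth_derivative m (conv (rl_kernel M (of_nat m)) p) y d"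
proof -
  obtain k where k: "m = Suc k" using m by (cases m) auto
  have ev: "\<forall>\<^sub>F u in nhds y. u \<in> {C<..<D}" using y by (intro eventually_nhds_in_open) auto
  then have nth: "\<forall>\<^sub>F u in nhds y. has_nth_derivative k (conv (rl_kernel M (of_nat (k + 1))) p) u (conv (rl_kernel M (of_nat 1)) p u)"
    by eventually_elim (rule has_nth_derivative_conv_rl_kernel, auto)
  have "\<forall>\<^sub>F u in nhds y. conv (rl_kernel M (of_nat 1)) p u = integral {C..u} p"
    using ev by eventually_elim (use conv_rl_kernel_one[OF p, of C _ M] off M in auto)
  from has_vector_derivative_cong_nhds[OF this] d
  have "(conv (rl_kernel M (of_nat 1)) p has_vector_derivative d) (at y)" by blast
  then show ?thesis using nth unfolding k has_nth_derivative.simps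
    by (intro exI[of _ "conv (rl_kernel M (of_nat 1)) p"]) simp
qed

end

section \<open>Exceptional null sets\<close>

lemma integral_between:
  fixes f :: "real \<Rightarrow> 'b::euclidean_space"
  assumes f: "f integrable_on {C..D}" and y: "y \<in> {C..D}" "Y \<in> {C..D}"
  shows "integral {C..y} f - integral {C..Y} f = sgn (y - Y) *\<^sub>R integral {min Y y..max Y y} f"
proof -
  have i: "f integrable_on {C..u}" if "u \<le> D" for u
    using f by (rule integrable_subinterval_real) (use that in auto)
  show ?thesis
  proof (cases y Y rule: linorder_cases)
    case less
    have "integral {C..y} f + integral {y..Y} f = integral {C..Y} f"
      by (rule Henstock_Kurzweil_Integration.integral_combine) (use less y i in auto)
    then show ?thesis using less by (simp add: algebra_simps)
  next
    case greater
    have "integral {C..Y} f + integral {Y..y} f = integral {C..y} f"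
      by (rule Henstock_Kurzweil_Integration.integral_combine) (use greater y i in auto)
    then show ?thesis using greater by (simp add: algebra_simps)
  qed simp
qed

lemma has_vector_derivative_at_alt:
  "(f has_vector_derivative d) (at Y) \<longleftrightarrow>
    (\<forall>e>0. \<exists>\<delta>>0. \<forall>y. \<bar>y - Y\<bar> < \<delta> \<longrightarrow> norm (f y - f Y - (y - Y) *\<^sub>R d) \<le> e * \<bar>y - Y\<bar>)"
  unfolding has_vector_derivative_def has_derivative_at_alt
  by (simp add: bounded_linear_scaleR_left)

text \<open>The indefinite integrals of the members of the family \<open>G\<close> are differentiable
  outside a null set that does not depend on the member: it suffices to treat the members
  with a rational index, because \<open>V\<close> controls the increments of \<open>G\<close>.\<close>
lemma uniform_exceptional_set:
  fixes G :: "real \<Rightarrow> real \<Rightarrow> complex" and V :: "real \<Rightarrow> real \<Rightarrow> real"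
  assumes G: "\<And>x. G x integrable_on {C..D}" and V: "\<And>x. V x integrable_on {C..D}"
    and le: "\<And>q x x'. \<lbrakk>A < x'; x' \<le> x; x < B\<rbrakk> \<Longrightarrow> norm (G x q - G x' q) \<le> V x q - V x' q"
    and cont: "\<And>q. continuous_on {A<..<B} (\<lambda>x. V x q)"
  obtains N where "negligible N"
    "\<And>x Y. \<lbrakk>A < x; x < B; C < Y; Y < D; Y \<notin> N\<rbrakk> \<Longrightarrow> ((\<lambda>y. integral {C..y} (G x)) has_vector_derivative G x Y) (at Y)"
proof -
  \<comment> \<open>The majorant \<open>V x\<close> has to be differentiable at the rational indices
    as well, since its increments bound those of \<open>G\<close>.\<close>
  define bad where "bad x = {Y \<in> {C<..<D}. \<not> ((\<lambda>y. integral {C..y} (G x)) has_vector_derivative G x Y) (at Y)} \<union>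
     {Y \<in> {C<..<D}. \<not> ((\<lambda>y. integral {C..y} (V x)) has_vector_derivative V x Y) (at Y)}" for x
  define N where "N = (\<Union>x\<in>\<rat>. bad x)"
  show ?thesis
  proof
    show "negligible N" unfolding N_def
    proof (rule negligible_countable_Union)
      show "countable (bad ` \<rat>)" by (intro countable_image countable_rat)
      fix S assume "S \<in> bad ` \<rat>"
      then obtain x where "S = bad x" by auto
      then show "negligible S" unfolding bad_def
        by (simp only:) (intro negligible_Un negligible_not_has_vector_derivative_integral G V)
    qed
    fix x Y assume x: "A < x" "x < B" and Y: "C < Y" "Y < D" "Y \<notin> N"
    show "((\<lambda>y. integral {C..y} (G x)) has_vector_derivative G x Y) (at Y)"
      unfolding has_vector_derivative_at_alt
    proof (intro allI impI)
      fix e :: real assume e: "e > 0"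
      have "isCont (\<lambda>x. V x Y) x"
        using cont[of Y] x by (simp add: continuous_on_eq_continuous_at)
      from this[unfolded continuous_at_eps_delta, rule_format, of "e / 10"] e
      obtain d where d: "d > 0" "\<And>x'. \<bar>x' - x\<bar> < d \<Longrightarrow> \<bar>V x' Y - V x Y\<bar> < e / 10"
        by (auto simp: dist_real_def)
      obtain a where a: "a \<in> \<rat>" "max A (x - d) < a" "a < x"
        using Rats_dense_in_real[of "max A (x - d)" x] x d by auto
      obtain b where b: "b \<in> \<rat>" "x < b" "b < min B (x + d)"
        using Rats_dense_in_real[of x "min B (x + d)"] x d by auto
      have VV: "V b Y - V a Y < e / 5"
        using d(2)[of a] d(2)[of b] a b by (simp add: abs_if split: if_splits)
      have good: "((\<lambda>y. integral {C..y} (G a)) has_vector_derivative G a Y) (at Y)"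
        "((\<lambda>y. integral {C..y} (V a)) has_vector_derivative V a Y) (at Y)"
        "((\<lambda>y. integral {C..y} (V b)) has_vector_derivative V b Y) (at Y)"
        using Y a(1) b(1) by (auto simp: N_def bad_def)
      \<comment> \<open>Five parts of \<open>e / 5\<close>: three for comparing \<open>G x\<close>
        with \<open>G a\<close> over the increment (two derivative errors of \<open>V\<close> and
        the gap \<open>VV\<close>), one for the derivative error of \<open>G a\<close>, one for
        \<open>G x Y - G a Y\<close>.\<close>
      have e5: "e / 5 > 0" using e by simp
      from good(1) e5 obtain d1 where d1: "d1 > 0" "\<And>y. \<bar>y - Y\<bar> < d1 \<Longrightarrow>
          norm (integral {C..y} (G a) - integral {C..Y} (G a) - (y - Y) *\<^sub>R G a Y) \<le> e / 5 * \<bar>y - Y\<bar>"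
        unfolding has_vector_derivative_at_alt by blast
      from good(2) e5 obtain d2 where d2: "d2 > 0" "\<And>y. \<bar>y - Y\<bar> < d2 \<Longrightarrow>
          norm (integral {C..y} (V a) - integral {C..Y} (V a) - (y - Y) *\<^sub>R V a Y) \<le> e / 5 * \<bar>y - Y\<bar>"
        unfolding has_vector_derivative_at_alt by blast
      from good(3) e5 obtain d3 where d3: "d3 > 0" "\<And>y. \<bar>y - Y\<bar> < d3 \<Longrightarrow>
          norm (integral {C..y} (V b) - integral {C..Y} (V b) - (y - Y) *\<^sub>R V b Y) \<le> e / 5 * \<bar>y - Y\<bar>"
        unfolding has_vector_derivative_at_alt by blast
      define \<delta> where "\<delta> = min (min (Y - C) (D - Y)) (min d1 (min d2 d3))"
      show "\<exists>\<delta>>0. \<forall>y. \<bar>y - Y\<bar> < \<delta> \<longrightarrow> norm (integral {C..y} (G x) - integral {C..Y} (G x) - (y - Y) *\<^sub>R G x Y) \<le> e * \<bar>y - Y\<bar>"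
      proof (intro exI[of _ \<delta>] conjI allI impI)
        show "\<delta> > 0" using Y d1 d2 d3 by (simp add: \<delta>_def)
        fix y assume y: "\<bar>y - Y\<bar> < \<delta>"
        define h where "h = \<bar>y - Y\<bar>"
        have yC: "y \<in> {C..D}" "Y \<in> {C..D}" using y Y by (auto simp: \<delta>_def)
        let ?I = "{min Y y..max Y y}"
        have int: "f integrable_on ?I" if "f integrable_on {C..D}" for f :: "real \<Rightarrow> 'z::euclidean_space"
          using that by (rule integrable_subinterval_real) (use yC in auto)
        let ?\<Delta> = "\<lambda>f. integral {C..y} f - integral {C..Y} f"
        let ?\<Delta>V = "\<lambda>f. integral {C..y} f - integral {C..Y} f :: real"
        \<comment> \<open>The derivative of the integral of \<open>V x\<close> at the arbitrary
          index \<open>x\<close> is unknown, so \<open>V x\<close> is replaced by the larger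
          \<open>V b\<close> with rational \<open>b\<close>.\<close>
        have 1: "norm (?\<Delta> (G x) - ?\<Delta> (G a)) \<le> \<bar>?\<Delta>V (V b) - ?\<Delta>V (V a)\<bar>"
        proof (cases "y = Y")
          case False
          have "?\<Delta> (G x) - ?\<Delta> (G a) = sgn (y - Y) *\<^sub>R integral ?I (\<lambda>q. G x q - G a q)"
            unfolding integral_between[OF G yC] by (subst integral_diff) (auto intro: int G simp: algebra_simps)
          then have "norm (?\<Delta> (G x) - ?\<Delta> (G a)) = norm (integral ?I (\<lambda>q. G x q - G a q))"
            using False by (simp add: sgn_if)
          also have "\<dots> \<le> integral ?I (\<lambda>q. V b q - V a q)"
          proof (rule integral_norm_bound_integral)
            fix q
            have "norm (G x q - G a q) \<le> V x q - V a q" using le[of a x q] a x by simp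
            moreover have "0 \<le> V b q - V x q" using order_trans[OF norm_ge_zero le[of x b q]] b x by simp
            ultimately show "norm (G x q - G a q) \<le> V b q - V a q" by simp
          qed (auto intro!: integrable_diff int G V)
          also have "\<dots> \<le> \<bar>integral ?I (\<lambda>q. V b q - V a q)\<bar>" by simp
          also have "\<dots> = \<bar>?\<Delta>V (V b) - ?\<Delta>V (V a)\<bar>"
          proof -
            have "?\<Delta>V (V b) - ?\<Delta>V (V a) = sgn (y - Y) *\<^sub>R integral ?I (\<lambda>q. V b q - V a q)"
              unfolding integral_between[OF V yC] by (subst integral_diff) (auto intro: int V simp: algebra_simps)
            then show ?thesis using False by (simp add: sgn_if abs_mult)
          qed
          finally show ?thesis .
        qed simp
        have "\<bar>?\<Delta>V (V b) - ?\<Delta>V (V a)\<bar> \<le> \<bar>(y - Y) * (V b Y - V a Y)\<bar> + e / 5 * h + e / 5 * h"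
        proof -
          have "\<bar>?\<Delta>V (V a) - (y - Y) * V a Y\<bar> \<le> e / 5 * h" "\<bar>?\<Delta>V (V b) - (y - Y) * V b Y\<bar> \<le> e / 5 * h"
            using d2(2)[of y] d3(2)[of y] y unfolding h_def by (simp_all add: \<delta>_def)
          moreover have "?\<Delta>V (V b) - ?\<Delta>V (V a) = (y - Y) * (V b Y - V a Y) +
             ((?\<Delta>V (V b) - (y - Y) * V b Y) - (?\<Delta>V (V a) - (y - Y) * V a Y))" by (simp add: algebra_simps)
          ultimately show ?thesis by linarith
        qed
        also have "\<bar>(y - Y) * (V b Y - V a Y)\<bar> \<le> h * (e / 5)"
        proof -
          have "0 \<le> V b Y - V a Y" using order_trans[OF norm_ge_zero le[of a b Y]] a b by simp
          then show ?thesis using VV unfolding h_def abs_mult by (intro mult_left_mono) auto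
        qed
        finally have 2: "norm (?\<Delta> (G x) - ?\<Delta> (G a)) \<le> 3 * (e / 5 * h)" using 1 by simp
        have 3: "norm (?\<Delta> (G a) - (y - Y) *\<^sub>R G a Y) \<le> e / 5 * h"
          using d1(2)[of y] y unfolding h_def by (simp add: \<delta>_def)
        have "norm (G x Y - G a Y) \<le> V x Y - V a Y" using le[of a x Y] a x by simp
        also have "\<dots> \<le> e / 5"
          using VV order_trans[OF norm_ge_zero le[of x b Y]] b x by simp
        finally have "\<bar>y - Y\<bar> * norm (G x Y - G a Y) \<le> \<bar>y - Y\<bar> * (e / 5)" by (rule mult_left_mono) simp
        then have 4: "norm ((y - Y) *\<^sub>R (G x Y - G a Y)) \<le> e / 5 * h" by (simp add: h_def mult.commute)
        have "?\<Delta> (G x) - (y - Y) *\<^sub>R G x Y = (?\<Delta> (G x) - ?\<Delta> (G a)) + (?\<Delta> (G a) - (y - Y) *\<^sub>R G a Y) - (y - Y) *\<^sub>R (G x Y - G a Y)"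
          by (simp add: algebra_simps)
        also have "norm \<dots> \<le> 3 * (e / 5 * h) + e / 5 * h + e / 5 * h"
          using norm_triangle_ineq4[of "(?\<Delta> (G x) - ?\<Delta> (G a)) + (?\<Delta> (G a) - (y - Y) *\<^sub>R G a Y)" "(y - Y) *\<^sub>R (G x Y - G a Y)"]
            norm_triangle_ineq[of "?\<Delta> (G x) - ?\<Delta> (G a)" "?\<Delta> (G a) - (y - Y) *\<^sub>R G a Y"] 2 3 4 by linarith
        finally show "norm (?\<Delta> (G x) - (y - Y) *\<^sub>R G x Y) \<le> e * \<bar>y - Y\<bar>" by (simp add: h_def)
      qed
    qed
  qed
qed

section \<open>Differentiability in the first variable\<close>

lemma le_of_rational_le:
  fixes \<phi> :: "real \<Rightarrow> real"
  assumes c: "\<And>h. \<bar>h\<bar> < d \<Longrightarrow> isCont \<phi> h" and le: "\<And>h. \<lbrakk>h \<in> \<rat>; h \<noteq> 0; \<bar>h\<bar> < d\<rbrakk> \<Longrightarrow> \<phi> h \<le> 0" and h: "\<bar>h\<bar> < d"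
  shows "\<phi> h \<le> 0"
proof (rule ccontr)
  assume "\<not> \<phi> h \<le> 0"
  then have "\<forall>\<^sub>F u in nhds h. \<phi> u > 0"
    using c[OF h] by (intro order_tendstoD(1)) (auto simp: continuous_at tendsto_at_iff_tendsto_nhds)
  moreover have "\<forall>\<^sub>F u in nhds h. u \<in> {-d<..<d}" using h by (intro eventually_nhds_in_open) auto
  ultimately have "\<forall>\<^sub>F u in nhds h. \<phi> u > 0 \<and> u \<in> {-d<..<d}" by (rule eventually_conj)
  then obtain S where S: "open S" "h \<in> S" "\<And>u. u \<in> S \<Longrightarrow> \<phi> u > 0 \<and> u \<in> {-d<..<d}"
    by (auto simp: eventually_nhds)
  then obtain r where r: "r > 0" "ball h r \<subseteq> S" by (meson openE)
  \<comment> \<open>Rational points right of \<open>h\<close>, kept negative when \<open>h\<close>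
    is negative: this avoids 0, where nothing is assumed.\<close>
  obtain u where u: "u \<in> \<rat>" "max h 0 < u \<or> u < 0" "h < u" "u < h + r" 
  proof (cases "h < 0")
    case True
    obtain u where "u \<in> \<rat>" "h < u" "u < min 0 (h + r)"
      using Rats_dense_in_real[of h "min 0 (h + r)"] True r by auto
    then show ?thesis by (intro that[of u]) auto
  next
    case False
    obtain u where "u \<in> \<rat>" "h < u" "u < h + r"
      using Rats_dense_in_real[of h "h + r"] r by auto
    then show ?thesis using False by (intro that[of u]) auto
  qed
  then have "u \<in> S" using r by (auto simp: dist_real_def)
  then have "\<phi> u > 0" "\<bar>u\<bar> < d" using S(3)[of u] by auto
  moreover have "u \<noteq> 0" using u by auto
  ultimately show False using le[OF u(1)] by force
qed

text \<open>Differentiability is tested with rational increments only, so that the exceptional set is Borel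
  and Fubini's theorem applies to it.\<close>
lemma AE_has_vector_derivative_fst:
  fixes p :: "real \<times> real \<Rightarrow> complex"
  assumes p[measurable]: "p \<in> borel_measurable borel" and int: "\<And>q. integrable lborel (\<lambda>t. p (t, q))"
  shows "AE z in lborel. A < fst z \<and> fst z < B \<longrightarrow>
     ((\<lambda>x. integral {A..x} (\<lambda>t. p (t, snd z))) has_vector_derivative p z) (at (fst z))"
proof -
  have [measurable]: "p \<in> borel_measurable (borel \<Otimes>\<^sub>M borel)" by (simp add: borel_prod)
  \<comment> \<open>The indefinite integral as a Lebesgue integral with parameters, which gives
    measurability jointly in \<open>x\<close> and \<open>q\<close>.\<close>
  define F where "F x q = (LINT t|lborel. (if A \<le> t \<and> t \<le> x then p (t, q) else 0))" for x q
  have F: "F x q = integral {A..x} (\<lambda>t. p (t, q))" for x q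
  proof -
    have "F x q = (LINT t:{A..x}|lborel. p (t, q))"
      unfolding F_def set_lebesgue_integral_def by (intro Bochner_Integration.integral_cong) auto
    also have "\<dots> = integral {A..x} (\<lambda>t. p (t, q))"
      using int[of q] by (intro set_borel_integral_eq_integral) (auto simp: set_integrable_def intro: integrable_mult_indicator)
    finally show ?thesis .
  qed
  have [measurable]: "(\<lambda>(x, q). F x q) \<in> borel_measurable (borel \<Otimes>\<^sub>M borel)"
  proof -
    have "(\<lambda>z. LINT t|lborel. (if A \<le> t \<and> t \<le> fst z then p (t, snd z) else 0)) \<in> borel_measurable (borel \<Otimes>\<^sub>M borel)"
      by measurable
    then show ?thesis by (simp add: F_def case_prod_unfold)
  qed
  define good where "good z \<longleftrightarrow> (\<forall>k::nat. \<exists>j::nat. \<forall>h::rat. real_of_rat h \<noteq> 0 \<and> \<bar>real_of_rat h\<bar> < 1 / Suc j \<longrightarrow>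
     norm (F (fst z + of_rat h) (snd z) - F (fst z) (snd z) - of_rat h *\<^sub>R p z) \<le> 1 / Suc k * \<bar>of_rat h\<bar>)" for z
  have good_deriv: "((\<lambda>x. F x q) has_vector_derivative p (x, q)) (at x)" if g: "good (x, q)" and x: "A < x" "x < B" for x q
    unfolding has_vector_derivative_at_alt
  proof (intro allI impI)
    fix e :: real assume "e > 0"
    then obtain k :: nat where k: "1 / Suc k < e" using nat_approx_posE by blast
    from g obtain j :: nat where j: "\<And>h::rat. \<lbrakk>real_of_rat h \<noteq> 0; \<bar>real_of_rat h\<bar> < 1 / Suc j\<rbrakk> \<Longrightarrow>
     norm (F (x + of_rat h) q - F x q - of_rat h *\<^sub>R p (x, q)) \<le> 1 / Suc k * \<bar>of_rat h\<bar>"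
      unfolding good_def fst_conv snd_conv by blast
    define d where "d = min (1 / Suc j) (min (x - A) (B - x))"
    have "continuous_on {A..B} (\<lambda>x. F x q)"
      unfolding F by (intro indefinite_integral_continuous_1 integrable_on_interval int)
    then have "continuous_on {A<..<B} (\<lambda>x. F x q)" by (rule continuous_on_subset) auto
    then have cont: "isCont (\<lambda>x. F x q) u" if "A < u" "u < B" for u
      using that by (simp add: continuous_on_eq_continuous_at)
    have le: "norm (F (x + h) q - F x q - h *\<^sub>R p (x, q)) - 1 / Suc k * \<bar>h\<bar> \<le> 0" if h: "\<bar>h\<bar> < d" for h
    proof (rule le_of_rational_le[OF _ _ h])
      fix h assume h: "\<bar>h\<bar> < d"
      have "isCont (\<lambda>h. F (x + h) q) h"
        using cont[of "x + h"] h by (intro isCont_o2[of _ "\<lambda>h. x + h" "\<lambda>x. F x q"]) (auto simp: d_def)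
      then show "isCont (\<lambda>h. norm (F (x + h) q - F x q - h *\<^sub>R p (x, q)) - 1 / Suc k * \<bar>h\<bar>) h"
        by (intro continuous_intros)
    next
      fix h assume h: "h \<in> \<rat>" "h \<noteq> 0" "\<bar>h\<bar> < d"
      then obtain r where "h = real_of_rat r" by (auto elim: Rats_cases)
      with j[of r] h show "norm (F (x + h) q - F x q - h *\<^sub>R p (x, q)) - 1 / Suc k * \<bar>h\<bar> \<le> 0"
        by (simp add: d_def)
    qed
    show "\<exists>\<delta>>0. \<forall>y. \<bar>y - x\<bar> < \<delta> \<longrightarrow> norm (F y q - F x q - (y - x) *\<^sub>R p (x, q)) \<le> e * \<bar>y - x\<bar>"
    proof (intro exI[of _ d] conjI allI impI)
      show "d > 0" using x by (simp add: d_def)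
      fix y assume "\<bar>y - x\<bar> < d"
      then have "norm (F y q - F x q - (y - x) *\<^sub>R p (x, q)) \<le> 1 / Suc k * \<bar>y - x\<bar>"
        using le[of "y - x"] by simp
      also have "\<dots> \<le> e * \<bar>y - x\<bar>" using k by (intro mult_right_mono) auto
      finally show "norm (F y q - F x q - (y - x) *\<^sub>R p (x, q)) \<le> e * \<bar>y - x\<bar>" .
    qed
  qed
  have deriv_good: "good (x, q)" if d: "((\<lambda>x. F x q) has_vector_derivative p (x, q)) (at x)" for x q
    unfolding good_def fst_conv snd_conv
  proof
    fix k :: nat
    from d obtain \<delta> where \<delta>: "\<delta> > 0" "\<And>y. \<bar>y - x\<bar> < \<delta> \<Longrightarrow> norm (F y q - F x q - (y - x) *\<^sub>R p (x, q)) \<le> 1 / Suc k * \<bar>y - x\<bar>"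
      unfolding has_vector_derivative_at_alt by (metis divide_pos_pos of_nat_0_less_iff zero_less_Suc zero_less_one)
    obtain j :: nat where j: "1 / Suc j < \<delta>" using \<delta>(1) nat_approx_posE by blast
    show "\<exists>j::nat. \<forall>h::rat. real_of_rat h \<noteq> 0 \<and> \<bar>real_of_rat h\<bar> < 1 / Suc j \<longrightarrow>
     norm (F (x + of_rat h) q - F x q - of_rat h *\<^sub>R p (x, q)) \<le> 1 / Suc k * \<bar>of_rat h\<bar>"
    proof (intro exI[of _ j] allI impI)
      fix h :: rat assume "real_of_rat h \<noteq> 0 \<and> \<bar>real_of_rat h\<bar> < 1 / Suc j"
      then show "norm (F (x + of_rat h) q - F x q - of_rat h *\<^sub>R p (x, q)) \<le> 1 / Suc k * \<bar>of_rat h\<bar>"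
        using \<delta>(2)[of "x + of_rat h"] j by simp
    qed
  qed
  let ?P = "\<lambda>z. A < fst z \<and> fst z < B \<longrightarrow> good z"
  have [measurable]: "Measurable.pred (borel \<Otimes>\<^sub>M borel) ?P"
    unfolding good_def by measurable
  have "AE q in lborel. AE x in lborel. ?P (x, q)"
  proof (rule AE_I2)
    fix q :: real
    let ?S = "{x \<in> {A<..<B}. \<not> ((\<lambda>y. integral {A..y} (\<lambda>t. p (t, q))) has_vector_derivative p (x, q)) (at x)}"
    have "negligible ?S"
      by (rule negligible_not_has_vector_derivative_integral[OF integrable_on_interval[OF int]])
    then have "AE x in lebesgue. x \<notin> ?S" unfolding negligible_iff_null_sets by (rule AE_not_in)
    then have "AE x in lborel. x \<notin> ?S" by (simp add: AE_completion_iff)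
    then show "AE x in lborel. ?P (x, q)"
      by eventually_elim (use deriv_good in \<open>auto simp: F\<close>)
  qed
  then have "AE x in lborel. AE q in lborel. ?P (x, q)"
  proof (subst lborel_pair.AE_commute)
    have "{z \<in> space (borel \<Otimes>\<^sub>M borel). ?P (fst z, snd z)} \<in> sets (borel \<Otimes>\<^sub>M borel)" by measurable
    then show "{z \<in> space (lborel \<Otimes>\<^sub>M lborel). ?P (fst z, snd z)} \<in> sets (lborel \<Otimes>\<^sub>M lborel)"
      by (simp add: space_pair_measure cong: sets_pair_measure_cong)
  qed
  then have "AE z in lborel \<Otimes>\<^sub>M lborel. ?P z"
  proof (rule lborel_pair.AE_pair_measure[rotated])
    have "{z \<in> space (borel \<Otimes>\<^sub>M borel). ?P z} \<in> sets (borel \<Otimes>\<^sub>M borel)" by measurable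
    then show "{z \<in> space (lborel \<Otimes>\<^sub>M lborel). ?P z} \<in> sets (lborel \<Otimes>\<^sub>M lborel)"
      by (simp add: space_pair_measure cong: sets_pair_measure_cong)
  qed
  then have "AE z in lborel. ?P z" by (simp only: lborel_prod)
  then show ?thesis
    by eventually_elim (use good_deriv in \<open>auto simp: F\<close>)
qed

section \<open>Bounds and increments of kernels of integer order\<close>

lemma rl_kernel_of_nat:
  assumes "n \<ge> 1"
  shows "rl_kernel L (of_nat n) u = (if 0 < u \<and> u < L then of_real (u ^ (n - 1) / fact (n - 1)) else 0)"
proof -
  obtain k where k: "n = Suc k" using assms by (cases n) auto
  show ?thesis by (simp add: rl_kernel_def k rGamma_inverse_Gamma Gamma_fact field_simps)
qed

lemma power_Lipschitz:
  assumes "L \<ge> 0"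
  shows "\<exists>c\<ge>0. \<forall>u v::real. 0 \<le> u \<and> u \<le> L \<and> 0 \<le> v \<and> v \<le> L \<longrightarrow> \<bar>u ^ k - v ^ k\<bar> \<le> c * \<bar>u - v\<bar>"
proof (induction k)
  case 0
  show ?case by (intro exI[of _ 0]) auto
next
  case (Suc k)
  then obtain c where c: "c \<ge> 0" "\<And>u v::real. \<lbrakk>0 \<le> u; u \<le> L; 0 \<le> v; v \<le> L\<rbrakk> \<Longrightarrow> \<bar>u ^ k - v ^ k\<bar> \<le> c * \<bar>u - v\<bar>"
    by blast
  show ?case
  proof (intro exI[of _ "L * c + L ^ k"] conjI allI impI)
    show "0 \<le> L * c + L ^ k" using c assms by simp
    fix u v :: real assume uv: "0 \<le> u \<and> u \<le> L \<and> 0 \<le> v \<and> v \<le> L"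
    have "u ^ Suc k - v ^ Suc k = u * (u ^ k - v ^ k) + (u - v) * v ^ k" by (simp add: algebra_simps)
    then have "\<bar>u ^ Suc k - v ^ Suc k\<bar> \<le> \<bar>u\<bar> * \<bar>u ^ k - v ^ k\<bar> + \<bar>u - v\<bar> * \<bar>v ^ k\<bar>"
      by (metis abs_mult abs_triangle_ineq)
    also have "\<dots> \<le> L * (c * \<bar>u - v\<bar>) + \<bar>u - v\<bar> * L ^ k"
      using uv c by (intro add_mono mult_mono) (auto intro: power_mono)
    finally show "\<bar>u ^ Suc k - v ^ Suc k\<bar> \<le> (L * c + L ^ k) * \<bar>u - v\<bar>" by (simp add: algebra_simps)
  qed
qed

lemma rl_kernel_of_nat_bounded:
  assumes "n \<ge> 1" "L \<ge> 0"
  shows "norm (rl_kernel L (of_nat n) u) \<le> L ^ (n - 1)"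
proof (cases "0 < u \<and> u < L")
  case True
  have "u ^ (n - 1) / fact (n - 1) \<le> u ^ (n - 1) / 1"
    using True by (intro divide_left_mono) (auto simp: fact_ge_1)
  also have "\<dots> \<le> L ^ (n - 1)" using True by (auto intro: power_mono)
  finally show ?thesis using True by (simp add: rl_kernel_of_nat[OF assms(1)] norm_divide norm_power)
qed (use assms in \<open>auto simp: rl_kernel_of_nat\<close>)

text \<open>For \<open>t < x'\<close> both values are powers divided by a factorial, and Lipschitz
  continuity gives the term \<open>x - x'\<close>. For \<open>t\<close> between \<open>x'\<close>
  and \<open>x\<close> only the first kernel is active; the indicator covers this case, including
  the jump of the kernel of order 1 at 0.\<close>

lemma rl_kernel_of_nat_increment:
  assumes n: "n \<ge> 1" and L: "L \<ge> 0"
  obtains c where "c \<ge> 0"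
    "\<And>x x' t. \<lbrakk>x' \<le> x; x - t < L\<rbrakk> \<Longrightarrow>
      norm (rl_kernel L (of_nat n) (x - t) - rl_kernel L (of_nat n) (x' - t)) \<le> c * (indicator {x'..x} t + (x - x'))"
proof -
  obtain c where c: "c \<ge> 0" "\<And>u v::real. \<lbrakk>0 \<le> u; u \<le> L; 0 \<le> v; v \<le> L\<rbrakk> \<Longrightarrow> \<bar>u ^ (n - 1) - v ^ (n - 1)\<bar> \<le> c * \<bar>u - v\<bar>"
    using power_Lipschitz[OF L, of "n - 1"] by blast
  show ?thesis
  proof
    show "c + L ^ (n - 1) \<ge> 0" using c L by simp
    fix x x' t :: real assume x: "x' \<le> x" "x - t < L"
    show "norm (rl_kernel L (of_nat n) (x - t) - rl_kernel L (of_nat n) (x' - t)) \<le> (c + L ^ (n - 1)) * (indicator {x'..x} t + (x - x'))"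
    proof (cases "t < x'")
      case True
      have "norm (rl_kernel L (of_nat n) (x - t) - rl_kernel L (of_nat n) (x' - t)) =
        norm (complex_of_real ((x - t) ^ (n - 1) / fact (n - 1) - (x' - t) ^ (n - 1) / fact (n - 1)))"
        using True x by (simp add: rl_kernel_of_nat[OF n] del: of_real_divide)
      also have "\<dots> = \<bar>(x - t) ^ (n - 1) - (x' - t) ^ (n - 1)\<bar> / fact (n - 1)"
        by (simp only: norm_of_real flip: diff_divide_distrib) simp
      also have "\<dots> \<le> \<bar>(x - t) ^ (n - 1) - (x' - t) ^ (n - 1)\<bar> / 1"
        by (intro divide_left_mono) (auto simp: fact_ge_1)
      also have "\<dots> \<le> c * (x - x')" using c(2)[of "x - t" "x' - t"] True x by simp
      also have "\<dots> \<le> (c + L ^ (n - 1)) * (indicator {x'..x} t + (x - x'))"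
        using x c L by (intro mult_mono) auto
      finally show ?thesis .
    next
      case False
      then have "norm (rl_kernel L (of_nat n) (x - t) - rl_kernel L (of_nat n) (x' - t)) = norm (rl_kernel L (of_nat n) (x - t))"
        by (simp add: rl_kernel_def)
      also have "\<dots> \<le> L ^ (n - 1) * indicator {x'..x} t"
        using rl_kernel_of_nat_bounded[OF n L, of "x - t"] False by (auto simp: indicator_def rl_kernel_def)
      also have "\<dots> \<le> (c + L ^ (n - 1)) * (indicator {x'..x} t + (x - x'))"
        using x c L by (intro mult_mono) auto
      finally show ?thesis .
    qed
  qed
qed

lemma integrable_bounded_mult:
  fixes g f :: "'a \<Rightarrow> complex"
  assumes f: "integrable M f" and [measurable]: "g \<in> borel_measurable M" and b: "\<And>x. norm (g x) \<le> c"
  shows "integrable M (\<lambda>x. g x * f x)"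
proof (rule Bochner_Integration.integrable_bound)
  have [measurable]: "f \<in> borel_measurable M" using f by (rule borel_measurable_integrable)
  show "integrable M (\<lambda>x. c * norm (f x))" using f by simp
  show "(\<lambda>x. g x * f x) \<in> borel_measurable M" by measurable
  show "AE x in M. norm (g x * f x) \<le> norm (c * norm (f x))"
  proof (rule AE_I2)
    fix x
    have "c \<ge> 0" using b[of x] norm_ge_zero order_trans by blast
    then show "norm (g x * f x) \<le> norm (c * norm (f x))"
      using mult_right_mono[OF b[of x], of "norm (f x)"] by (simp add: norm_mult)
  qed
qed

lemma AE_lborel_sndI:
  fixes P :: "'b::euclidean_space \<Rightarrow> bool"
  assumes "AE q in lborel. P q"
  shows "AE z in (lborel :: ('a::euclidean_space \<times> 'b) measure). P (snd z)"
proof -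
  obtain N where N: "N \<in> null_sets lborel" "{q. \<not> P q} \<subseteq> N"
    using assms by (auto elim!: AE_E simp: null_sets_def)
  have [measurable]: "N \<in> sets borel" using N(1) by (simp add: null_sets_def)
  have "AE z in (lborel :: 'a measure) \<Otimes>\<^sub>M (lborel :: 'b measure). snd z \<notin> N"
  proof (rule lborel_pair.AE_pair_measure)
    show "{z \<in> space ((lborel :: 'a measure) \<Otimes>\<^sub>M (lborel :: 'b measure)). snd z \<notin> N} \<in> sets (lborel \<Otimes>\<^sub>M lborel)"
      by measurable
    show "AE x in (lborel :: 'a measure). AE q in lborel. snd (x, q) \<notin> N"
      using AE_not_in[OF N(1)] by simp
  qed
  then have "AE z in (lborel :: ('a \<times> 'b) measure). snd z \<notin> N" by (simp only: lborel_prod)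
  then show ?thesis by eventually_elim (use N(2) in auto)
qed

lemma borel_measurable_pair_lborel:
  fixes p :: "'a::euclidean_space \<times> 'b::euclidean_space \<Rightarrow> complex"
  assumes "integrable lborel p"
  shows "p \<in> borel_measurable borel" "p \<in> borel_measurable (borel \<Otimes>\<^sub>M borel)"
  using assms by (auto dest: borel_measurable_integrable simp: borel_prod)

lemma integrable_pair_lborel:
  fixes p :: "'a::euclidean_space \<times> 'b::euclidean_space \<Rightarrow> complex"
  shows "integrable lborel p \<Longrightarrow> integrable (lborel \<Otimes>\<^sub>M lborel) (\<lambda>(t, q). p (t, q))"
  by (simp add: lborel_prod)

section \<open>Functions on a rectangle with integrable rows\<close>

context
  fixes p :: "real \<times> real \<Rightarrow> complex" and A B C D L M :: real
  assumes AB: "A < B" and CD: "C < D" and L: "L = B - A" and M: "M = D - C"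
    and p: "integrable lborel p"
    and off: "\<And>t q. p (t, q) \<noteq> 0 \<Longrightarrow> A < t \<and> t < B \<and> C < q \<and> q < D"
    and rows: "\<And>q. integrable lborel (\<lambda>t. p (t, q))"
begin

lemma integrable_partial_conv:
  assumes n: "n \<ge> 1"
  shows "integrable lborel (\<lambda>q. conv (rl_kernel L (of_nat n)) (\<lambda>t. p (t, q)) x)"
proof -
  note [measurable] = borel_measurable_pair_lborel[OF p]
  have "integrable (lborel \<Otimes>\<^sub>M lborel) (\<lambda>z. rl_kernel L (of_nat n) (x - fst z) * (case z of (t, q) \<Rightarrow> p (t, q)))"
    using AB L by (intro integrable_bounded_mult[OF integrable_pair_lborel[OF p], where c="L ^ (n - 1)"] rl_kernel_of_nat_bounded n) auto
  then have "integrable (lborel \<Otimes>\<^sub>M lborel) (\<lambda>(t, q). rl_kernel L (of_nat n) (x - t) * p (t, q))"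
    by (simp add: case_prod_unfold)
  from lborel_pair.integrable_snd[OF this] show ?thesis by (simp add: conv_def)
qed

text \<open>Kernels of integer order at least 1 are bounded, so Fubini's theorem splits the
  convolution at every point.\<close>

lemma conv_tensor_partial:
  assumes n: "n \<ge> 1" and m: "m \<ge> 1"
  shows "conv (tensor (rl_kernel L (of_nat n)) (rl_kernel M (of_nat m))) p (x, y) =
    conv (rl_kernel M (of_nat m)) (\<lambda>q. conv (rl_kernel L (of_nat n)) (\<lambda>t. p (t, q)) x) y"
proof -
  note [measurable] = borel_measurable_pair_lborel[OF p]
  have "norm (rl_kernel L (of_nat n) (x - fst z) * rl_kernel M (of_nat m) (y - snd z)) \<le> L ^ (n - 1) * M ^ (m - 1)" for z
    unfolding norm_mult using AB CD L M by (intro mult_mono rl_kernel_of_nat_bounded n m) auto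
  then have "integrable (lborel \<Otimes>\<^sub>M lborel) (\<lambda>z. (rl_kernel L (of_nat n) (x - fst z) * rl_kernel M (of_nat m) (y - snd z)) * (case z of (t, q) \<Rightarrow> p (t, q)))"
    by (intro integrable_bounded_mult[OF integrable_pair_lborel[OF p]]) auto
  then have i: "integrable (lborel \<Otimes>\<^sub>M lborel) (\<lambda>(t, q). rl_kernel M (of_nat m) (y - q) * (rl_kernel L (of_nat n) (x - t) * p (t, q)))"
    by (simp add: case_prod_unfold mult_ac)
  have "conv (tensor (rl_kernel L (of_nat n)) (rl_kernel M (of_nat m))) p (x, y) =
    integral\<^sup>L (lborel \<Otimes>\<^sub>M lborel) (\<lambda>(t, q). rl_kernel M (of_nat m) (y - q) * (rl_kernel L (of_nat n) (x - t) * p (t, q)))"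
    unfolding conv_def lborel_prod by (intro Bochner_Integration.integral_cong) (auto simp: tensor_def)
  also have "\<dots> = (LINT q|lborel. LINT t|lborel. rl_kernel M (of_nat m) (y - q) * (rl_kernel L (of_nat n) (x - t) * p (t, q)))"
    using lborel_pair.integral_snd[OF i] by simp
  finally show ?thesis by (simp add: conv_def)
qed

lemma partial_conv_exceptional:
  assumes n: "n \<ge> 1"
  obtains N where "negligible N"
    "\<And>x Y. \<lbrakk>A < x; x < B; C < Y; Y < D; Y \<notin> N\<rbrakk> \<Longrightarrow>
      ((\<lambda>y. integral {C..y} (\<lambda>q. conv (rl_kernel L (of_nat n)) (\<lambda>t. p (t, q)) x)) has_vector_derivative
        conv (rl_kernel L (of_nat n)) (\<lambda>t. p (t, Y)) x) (at Y)"
proof -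
  note [measurable] = borel_measurable_pair_lborel[OF p]
  have L0: "L \<ge> 0" using AB L by simp
  obtain c where c: "c \<ge> 0" "\<And>x x' t. \<lbrakk>x' \<le> x; x - t < L\<rbrakk> \<Longrightarrow>
      norm (rl_kernel L (of_nat n) (x - t) - rl_kernel L (of_nat n) (x' - t)) \<le> c * (indicator {x'..x} t + (x - x'))"
    using rl_kernel_of_nat_increment[OF n L0] by blast
  \<comment> \<open>Its increment from \<open>x'\<close> to \<open>x\<close> is the integral of
    \<open>norm (p (t, q))\<close> against the bound
    \<open>c * (indicator {x'..x} t + (x - x'))\<close> for the increment of the kernel.\<close>
  define V where "V x q = c * (integral {A..x} (\<lambda>t. norm (p (t, q))) + x * (LINT t|lborel. norm (p (t, q))))" for x q
  have row_i: "integrable lborel (\<lambda>t. indicator {a..b} t * norm (p (t, q)))" for a b q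
    using integrable_mult_indicator[OF _ integrable_norm[OF rows[of q]], of "{a..b}"] by simp
  have I: "integral {a..b} (\<lambda>t. norm (p (t, q))) = (LINT t|lborel. indicator {a..b} t * norm (p (t, q)))" for a b q
  proof -
    have "(LINT t:{a..b}|lborel. norm (p (t, q))) = integral {a..b} (\<lambda>t. norm (p (t, q)))"
      using row_i by (intro set_borel_integral_eq_integral) (simp add: set_integrable_def)
    then show ?thesis by (simp add: set_lebesgue_integral_def)
  qed
  show ?thesis
  proof (rule uniform_exceptional_set[where G = "\<lambda>x q. conv (rl_kernel L (of_nat n)) (\<lambda>t. p (t, q)) x" and V = V and A = A and B = B and C = C and D = D])
    show "(\<lambda>q. conv (rl_kernel L (of_nat n)) (\<lambda>t. p (t, q)) x) integrable_on {C..D}" for x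
      by (intro integrable_on_interval integrable_partial_conv n)
    show "V x integrable_on {C..D}" for x
    proof (rule integrable_on_interval)
      have np: "integrable (lborel \<Otimes>\<^sub>M lborel) (\<lambda>(t, q). norm (p (t, q)))"
        using integrable_norm[OF integrable_pair_lborel[OF p]] by (simp add: case_prod_unfold)
      have "integrable (lborel \<Otimes>\<^sub>M lborel) (\<lambda>(t, q). indicator {A..x} t * norm (p (t, q)))"
      proof (rule Bochner_Integration.integrable_bound[OF np])
        show "AE z in lborel \<Otimes>\<^sub>M lborel. norm (case z of (t, q) \<Rightarrow> indicator {A..x} t * norm (p (t, q))) \<le> norm (case z of (t, q) \<Rightarrow> norm (p (t, q)))"
          by (auto simp: indicator_def)
      qed measurable
      from lborel_pair.integrable_snd[OF this] lborel_pair.integrable_snd[OF np]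
      show "integrable lborel (V x)"
        unfolding V_def[abs_def] I by (intro integrable_mult_right Bochner_Integration.integrable_add)
    qed
    show "continuous_on {A<..<B} (\<lambda>x. V x q)" for q
    proof -
      have "continuous_on {A..B} (\<lambda>x. integral {A..x} (\<lambda>t. norm (p (t, q))))"
        by (intro indefinite_integral_continuous_1 integrable_on_interval integrable_norm rows)
      then have "continuous_on {A<..<B} (\<lambda>x. integral {A..x} (\<lambda>t. norm (p (t, q))))"
        by (rule continuous_on_subset) auto
      then show ?thesis unfolding V_def by (intro continuous_intros)
    qed
    fix q x x' assume x: "A < x'" "x' \<le> x" "x < B"
    have ri: "integrable lborel (\<lambda>t. rl_kernel L (of_nat n) (u - t) * p (t, q))" for u
      by (rule integrable_bounded_mult[OF rows, where c="L ^ (n - 1)"]) (use rl_kernel_of_nat_bounded[OF n L0] in auto)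
    have "conv (rl_kernel L (of_nat n)) (\<lambda>t. p (t, q)) x - conv (rl_kernel L (of_nat n)) (\<lambda>t. p (t, q)) x' =
      (LINT t|lborel. (rl_kernel L (of_nat n) (x - t) - rl_kernel L (of_nat n) (x' - t)) * p (t, q))"
      unfolding conv_def by (subst Bochner_Integration.integral_diff[symmetric, OF ri ri]) (simp add: algebra_simps)
    also have "norm \<dots> \<le> (LINT t|lborel. c * (indicator {x'..x} t * norm (p (t, q))) + c * (x - x') * norm (p (t, q)))"
    proof (rule Bochner_Integration.integral_norm_bound_integral)
      show "integrable lborel (\<lambda>t. (rl_kernel L (of_nat n) (x - t) - rl_kernel L (of_nat n) (x' - t)) * p (t, q))"
        unfolding left_diff_distrib by (intro Bochner_Integration.integrable_diff ri)
      show "integrable lborel (\<lambda>t. c * (indicator {x'..x} t * norm (p (t, q))) + c * (x - x') * norm (p (t, q)))"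
        by (intro Bochner_Integration.integrable_add integrable_mult_right row_i integrable_norm rows)
      fix t
      show "norm ((rl_kernel L (of_nat n) (x - t) - rl_kernel L (of_nat n) (x' - t)) * p (t, q)) \<le>
        c * (indicator {x'..x} t * norm (p (t, q))) + c * (x - x') * norm (p (t, q))"
      proof (cases "p (t, q) = 0")
        case False
        then have "x - t < L" using off[of t q] x L by auto
        then have "norm (rl_kernel L (of_nat n) (x - t) - rl_kernel L (of_nat n) (x' - t)) * norm (p (t, q)) \<le> c * (indicator {x'..x} t + (x - x')) * norm (p (t, q))"
          using c(2) x by (intro mult_right_mono) auto
        then show ?thesis unfolding norm_mult by (simp only: distrib_left distrib_right mult.assoc)
      qed simp
    qed
    also have "\<dots> = c * integral {x'..x} (\<lambda>t. norm (p (t, q))) + c * (x - x') * (LINT t|lborel. norm (p (t, q)))"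
      unfolding I by (subst Bochner_Integration.integral_add) (auto intro!: integrable_mult_right row_i integrable_norm rows)
    also have "integral {x'..x} (\<lambda>t. norm (p (t, q))) = integral {A..x} (\<lambda>t. norm (p (t, q))) - integral {A..x'} (\<lambda>t. norm (p (t, q)))"
      using Henstock_Kurzweil_Integration.integral_combine[of A x' x "\<lambda>t. norm (p (t, q))"] x
        integrable_on_interval[OF integrable_norm[OF rows[of q]], of A x] by simp
    finally show "norm (conv (rl_kernel L (of_nat n)) (\<lambda>t. p (t, q)) x - conv (rl_kernel L (of_nat n)) (\<lambda>t. p (t, q)) x') \<le> V x q - V x' q"
      by (simp add: V_def algebra_simps)
  qed (use that in blast)
qed

text \<open>Outside \<open>N\<close>, differentiating in Y leaves \<open>G x Y\<close> for all
  \<open>x\<close> near X. As a function of \<open>x\<close> this is the convolution of order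
  \<open>n\<close> of the row at \<open>Y\<close>, which is differentiated down to \<open>p\<close>
  at a Lebesgue point of that row.\<close>

theorem AE_has_mixed_derivative:
  assumes n: "n \<ge> 1" and m: "m \<ge> 1"
  shows "AE z in lborel. z \<in> {A<..<B} \<times> {C<..<D} \<longrightarrow>
    has_mixed_derivative n m (conv (tensor (rl_kernel L (of_nat n)) (rl_kernel M (of_nat m))) p) z (p z)"
proof -
  define G where "G x q = conv (rl_kernel L (of_nat n)) (\<lambda>t. p (t, q)) x" for x q
  obtain N where N: "negligible N"
    "\<And>x Y. \<lbrakk>A < x; x < B; C < Y; Y < D; Y \<notin> N\<rbrakk> \<Longrightarrow>
      ((\<lambda>y. integral {C..y} (G x)) has_vector_derivative G x Y) (at Y)"
    using partial_conv_exceptional[OF n] unfolding G_def by blast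
  have "AE q in lebesgue. q \<notin> N" using N(1) unfolding negligible_iff_null_sets by (rule AE_not_in)
  then have "AE q in lborel. q \<notin> N" by (simp add: AE_completion_iff)
  then have "AE z in (lborel :: (real \<times> real) measure). snd z \<notin> N" by (rule AE_lborel_sndI)
  moreover have "AE z in lborel. A < fst z \<and> fst z < B \<longrightarrow>
     ((\<lambda>x. integral {A..x} (\<lambda>t. p (t, snd z))) has_vector_derivative p z) (at (fst z))"
    by (intro AE_has_vector_derivative_fst borel_measurable_pair_lborel[OF p] rows)
  ultimately show ?thesis
  proof eventually_elim
    case (elim z)
    obtain X Y where z: "z = (X, Y)" by (cases z)
    show ?case
    proof
      assume "z \<in> {A<..<B} \<times> {C<..<D}"
      then have XY: "A < X" "X < B" "C < Y" "Y < D" by (auto simp: z)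
      have "\<forall>\<^sub>F x in nhds X. x \<in> {A<..<B}" using XY by (intro eventually_nhds_in_open) auto
      then have "\<forall>\<^sub>F x in nhds X. has_nth_derivative m (\<lambda>y. conv (tensor (rl_kernel L (of_nat n)) (rl_kernel M (of_nat m))) p (x, y)) Y (G x Y)"
      proof eventually_elim
        case (elim x)
        have "has_nth_derivative m (conv (rl_kernel M (of_nat m)) (G x)) Y (G x Y)"
        proof (rule has_nth_derivative_conv_rl_kernel_self[OF _ _ CD M XY(3,4) m])
          show "integrable lborel (G x)" unfolding G_def[abs_def] by (rule integrable_partial_conv[OF n])
          show "C < q \<and> q < D" if "G x q \<noteq> 0" for q
          proof (rule ccontr)
            assume "\<not> (C < q \<and> q < D)"
            then have "(\<lambda>t. p (t, q)) = (\<lambda>t. 0)" using off by blast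
            then show False using that by (simp add: G_def conv_def)
          qed
          show "((\<lambda>y. integral {C..y} (G x)) has_vector_derivative G x Y) (at Y)"
            using N(2) elim XY \<open>snd z \<notin> N\<close> by (simp add: z)
        qed
        then show ?case by (simp add: conv_tensor_partial[OF n m] G_def[abs_def])
      qed
      moreover have "has_nth_derivative n (\<lambda>x. G x Y) X (p (X, Y))"
      proof -
        have "has_nth_derivative n (conv (rl_kernel L (of_nat n)) (\<lambda>t. p (t, Y))) X (p (X, Y))"
          by (rule has_nth_derivative_conv_rl_kernel_self[OF rows _ AB L XY(1,2) n]) (use off elim(2) XY in \<open>auto simp: z\<close>)
        then show ?thesis by (simp add: G_def)
      qed
      ultimately show "has_mixed_derivative n m (conv (tensor (rl_kernel L (of_nat n)) (rl_kernel M (of_nat m))) p) z (p z)"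
        unfolding has_mixed_derivative_def z by auto
    qed
  qed
qed

end

section \<open>The left inverse\<close>

lemma AE_integrable_rows:
  fixes p :: "real \<times> real \<Rightarrow> complex"
  assumes "integrable lborel p"
  shows "AE z in lborel. integrable lborel (\<lambda>t. p (t, snd z))"
proof -
  have "AE q in lborel. integrable lborel (\<lambda>t. p (t, q))" by (intro lborel_pair.AE_integrable_snd integrable_pair_lborel assms)
  then show ?thesis by (rule AE_lborel_sndI)
qed

text \<open>A Borel version of the function, set to 0 on the rows that are not integrable. By
  Fubini's theorem these rows form a null set, so the change is invisible almost everywhere.\<close>

lemma borel_representative:
  fixes \<psi> :: "real \<times> real \<Rightarrow> complex"
  assumes \<psi>: "\<psi> absolutely_integrable_on ({A<..<B} \<times> {C<..<D})"
  obtains p where "integrable lborel p"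
    "\<And>t q. p (t, q) \<noteq> 0 \<Longrightarrow> A < t \<and> t < B \<and> C < q \<and> q < D"
    "\<And>q. integrable lborel (\<lambda>t. p (t, q))"
    "AE z in lborel. z \<in> {A<..<B} \<times> {C<..<D} \<longrightarrow> \<psi> z = p z"
proof -
  let ?R = "{A<..<B} \<times> {C<..<D}"
  let ?f = "\<lambda>z. indicator ?R z *\<^sub>R \<psi> z"
  have f: "integrable lebesgue ?f" using \<psi> by (simp add: set_integrable_def)
  then have fm: "?f \<in> borel_measurable lebesgue" by (rule borel_measurable_integrable)
  have re: "(\<lambda>z. Re (?f z)) \<in> borel_measurable lebesgue" and im: "(\<lambda>z. Im (?f z)) \<in> borel_measurable lebesgue"
    using fm unfolding borel_measurable_complex_iff by blast+
  obtain u where u: "u \<in> borel_measurable lborel" "AE z in lborel. Re (?f z) = u z"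
    using completion_ex_borel_measurable_real[OF re] by blast
  obtain v where v: "v \<in> borel_measurable lborel" "AE z in lborel. Im (?f z) = v z"
    using completion_ex_borel_measurable_real[OF im] by blast
  define p0 where "p0 z = indicator ?R z *\<^sub>R Complex (u z) (v z)" for z
  have [measurable]: "u \<in> borel_measurable borel" "v \<in> borel_measurable borel" using u v by simp_all
  have R: "?R \<in> sets borel" by (intro borel_open open_Times) auto
  have p0m: "p0 \<in> borel_measurable borel"
    unfolding p0_def[abs_def] Complex_eq using R by measurable
  have [measurable]: "p0 \<in> borel_measurable (borel \<Otimes>\<^sub>M borel)" using p0m by (simp add: borel_prod)
  have p0_eq: "AE z in lborel. ?f z = p0 z"
    using u(2) v(2)
  proof eventually_elim
    case (elim z)
    then show ?case by (cases "z \<in> ?R") (simp_all add: p0_def complex_eq_iff)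
  qed
  have p0: "integrable lborel p0"
    using integrable_lebesgue_AE[OF p0m p0_eq] f by simp
  \<comment> \<open>Integrability of a row is expressed by a finite nonnegative integral, which
    makes \<open>S\<close> a Borel set.\<close>
  define S where "S = {q. (\<integral>\<^sup>+t. ennreal (norm (p0 (t, q))) \<partial>lborel) < \<infinity>}"
  have S: "q \<in> S \<longleftrightarrow> integrable lborel (\<lambda>t. p0 (t, q))" for q
  proof -
    have "(\<lambda>t. p0 (t, q)) \<in> borel_measurable lborel" by measurable
    then show ?thesis by (simp add: S_def integrable_iff_bounded)
  qed
  have [measurable]: "S \<in> sets borel"
  proof -
    have "{q \<in> space borel. (\<integral>\<^sup>+t. ennreal (norm (p0 (t, q))) \<partial>lborel) < \<infinity>} \<in> sets borel" by measurable
    then show ?thesis by (simp add: S_def)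
  qed
  define p where "p z = (if snd z \<in> S then p0 z else 0)" for z
  have "p \<in> borel_measurable (borel \<Otimes>\<^sub>M borel)" unfolding p_def[abs_def] by measurable
  then have pm: "p \<in> borel_measurable lborel" by (simp add: borel_prod)
  show ?thesis
  proof
    show "integrable lborel p"
      by (rule Bochner_Integration.integrable_bound[OF p0 pm]) (auto simp: p_def)
    show "A < t \<and> t < B \<and> C < q \<and> q < D" if "p (t, q) \<noteq> 0" for t q
      using that by (auto simp: p_def p0_def indicator_def split: if_splits)
    show "integrable lborel (\<lambda>t. p (t, q))" for q
      using S[of q] by (cases "q \<in> S") (auto simp: p_def)
    show "AE z in lborel. z \<in> ?R \<longrightarrow> \<psi> z = p z"
      using p0_eq AE_integrable_rows[OF p0] by eventually_elim (auto simp: p_def S)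
  qed
qed

lemma series_kernel_off: "series_kernel L M a \<kappa> \<rho> \<Upsilon> (t, q) \<noteq> 0 \<Longrightarrow> 0 < t \<and> 0 < q"
  by (rule ccontr) (auto simp: series_kernel_def tensor_def rl_kernel_def intro!: infsetsum_all_0)

lemma tensor_rl_kernel_off: "tensor (rl_kernel L a) (rl_kernel M b) (t, q) \<noteq> 0 \<Longrightarrow> 0 < t \<and> 0 < q"
  by (auto simp: tensor_def rl_kernel_def split: if_splits)

lemma conv_off:
  fixes k f :: "real \<times> real \<Rightarrow> complex"
  assumes k: "\<And>t q. k (t, q) \<noteq> 0 \<Longrightarrow> 0 < t \<and> 0 < q" and f: "\<And>t q. f (t, q) \<noteq> 0 \<Longrightarrow> A < t \<and> C < q"
    and "conv k f (t, q) \<noteq> 0"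
  shows "A < t \<and> C < q"
proof -
  have "(\<lambda>w. k ((t, q) - w) * f w) \<noteq> (\<lambda>w. 0)"
    using assms(3) unfolding conv_def by (metis Bochner_Integration.integral_zero)
  then obtain w where w: "k ((t, q) - w) \<noteq> 0" "f w \<noteq> 0" by (auto simp: fun_eq_iff)
  obtain t' q' where "w = (t', q')" by (cases w)
  with w k[of "t - t'" "q - q'"] f[of t' q'] show ?thesis by auto
qed

lemma hk_integral_eq_conv:
  assumes pos: "Re \<kappa> > 0" "Re \<rho> > 0" "Re \<Upsilon> > 0"
    and f0: "f0 \<in> borel_measurable borel" "\<And>t q. f0 (t, q) \<noteq> 0 \<Longrightarrow> A < t \<and> C < q"
    and f: "AE z in lborel. z \<in> {A<..<B} \<times> {C<..<D} \<longrightarrow> f z = f0 z"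
    and z: "z \<in> {A<..<B} \<times> {C<..<D}"
    and i: "integrable lborel (\<lambda>y. series_kernel (B - A) (D - C) (hk_weight g1 g2 \<nu> w) \<kappa> \<rho> \<Upsilon> (z - y) * f0 y)"
  shows "hk_integral A C \<kappa> \<rho> \<Upsilon> \<nu> w g1 g2 ((g1 + 1) / 2) g2 f z =
    conv (series_kernel (B - A) (D - C) (hk_weight g1 g2 \<nu> w) \<kappa> \<rho> \<Upsilon>) f0 z"
proof -
  let ?k = "series_kernel (B - A) (D - C) (hk_weight g1 g2 \<nu> w) \<kappa> \<rho> \<Upsilon>"
  obtain X Y where XY: "z = (X, Y)" by (cases z)
  have lt: "A < X" "X < B" "C < Y" "Y < D" using z by (auto simp: XY)
  have km: "?k \<in> borel_measurable borel"
    using integrable_series_kernel[OF geometric_bound_hk_weight pos, of "B - A" "D - C"] lt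
    by (auto dest: borel_measurable_integrable)
  show ?thesis
    unfolding hk_integral_def XY prod.case
    by (rule iterated_integral_conv[OF km f0(1) series_kernel_off f0(2)])
      (use lt i f in \<open>auto simp: XY intro!: hk_mittag_leffler_kernel[OF pos] elim: eventually_mono\<close>)
qed

lemma rl_integral_eq_conv:
  assumes pos: "Re l > 0" "Re l' > 0"
    and f0: "f0 \<in> borel_measurable borel" "\<And>t q. f0 (t, q) \<noteq> 0 \<Longrightarrow> A < t \<and> C < q"
    and f: "AE z in lborel. z \<in> {A<..<B} \<times> {C<..<D} \<longrightarrow> f z = f0 z"
    and lt: "A < X" "X < B" "C < Y" "Y < D"
    and i: "integrable lborel (\<lambda>y. tensor (rl_kernel (B - A) l) (rl_kernel (D - C) l') ((X, Y) - y) * f0 y)"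
  shows "rl_integral_X A l (rl_integral_Y C l' f) (X, Y) = conv (tensor (rl_kernel (B - A) l) (rl_kernel (D - C) l')) f0 (X, Y)"
proof -
  let ?K = "\<lambda>t q. (rGamma l * of_real t powr (l - 1)) * (rGamma l' * of_real q powr (l' - 1))"
  have "(LINT t:{A<..<X}|lebesgue. (LINT q:{C<..<Y}|lebesgue. ?K (X - t) (Y - q) * f (t, q))) =
     conv (tensor (rl_kernel (B - A) l) (rl_kernel (D - C) l')) f0 (X, Y)"
  proof (rule iterated_integral_conv'[OF _ f0(1) tensor_rl_kernel_off f0(2)])
    show "?K t q = tensor (rl_kernel (B - A) l) (rl_kernel (D - C) l') (t, q)" if "0 < t" "t < X - A" "0 < q" "q < Y - C" for t q
      using that lt by (simp add: tensor_def rl_kernel_def)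
    show "AE z in lborel. z \<in> {A<..<X} \<times> {C<..<Y} \<longrightarrow> f z = f0 z"
      using f by eventually_elim (use lt in auto)
  qed (use i in auto)
  then show ?thesis
    by (simp add: rl_integral_X_def rl_integral_Y_def rl_integral_def set_lebesgue_integral_def
        rGamma_inverse_Gamma scaleR_conv_of_real divide_inverse mult.assoc mult.left_commute
        flip: integral_mult_right_zero)
qed

text \<open>The open rectangle is a neighbourhood of each of its points. Equality almost everywhere
  would not suffice here.\<close>

lemma has_mixed_derivative_cong:
  assumes eq: "\<And>z. z \<in> {A<..<B} \<times> {C<..<D} \<Longrightarrow> f z = g z" and z: "z \<in> {A<..<B} \<times> {C<..<D}"
    and g: "has_mixed_derivative n m g z d"
  shows "has_mixed_derivative n m f z d"
proof -
  obtain X Y where XY: "z = (X, Y)" by (cases z)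
  from g obtain h where h: "\<forall>\<^sub>F x in nhds X. has_nth_derivative m (\<lambda>y. g (x, y)) Y (h x)" "has_nth_derivative n h X d"
    unfolding has_mixed_derivative_def XY by auto
  have "\<forall>\<^sub>F x in nhds X. x \<in> {A<..<B}" using z XY by (intro eventually_nhds_in_open) auto
  with h(1) have "\<forall>\<^sub>F x in nhds X. has_nth_derivative m (\<lambda>y. f (x, y)) Y (h x)"
  proof eventually_elim
    case (elim x)
    have "\<forall>\<^sub>F y in nhds Y. y \<in> {C<..<D}" using z XY by (intro eventually_nhds_in_open) auto
    then have "\<forall>\<^sub>F y in nhds Y. f (x, y) = g (x, y)"
      by eventually_elim (use elim eq in auto)
    from has_nth_derivative_cong[OF this] elim show ?case by blast
  qed
  with h(2) show ?thesis unfolding has_mixed_derivative_def XY by auto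
qed

theorem theorem21:
  fixes A B C D :: real
    and \<kappa> \<rho> \<sigma> \<eta> \<Upsilon> \<gamma>1 \<gamma>2 \<nu>1 \<nu>2 w :: complex
    and \<psi> :: "real \<times> real \<Rightarrow> complex"
  assumes "A < B" and "C < D"
    and "Re \<kappa> > 0" and "Re \<rho> > 0" and "Re \<sigma> > 0" and "Re \<eta> > 0" and "Re \<Upsilon> > 0"
    and "power_value \<nu>2 \<Upsilon> w"
    and "\<psi> absolutely_integrable_on ({A<..<B} \<times> {C<..<D})"
  shows "hk_integral A C \<kappa> \<rho> \<Upsilon> \<nu>1 w \<gamma>1 \<gamma>2 ((\<gamma>1 + 1) / 2) \<gamma>2 \<psi>
           absolutely_integrable_on ({A<..<B} \<times> {C<..<D})
       \<and> (AE z in lebesgue. z \<in> {A<..<B} \<times> {C<..<D} \<longrightarrow>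
            hk_derivative_exists A C \<kappa> \<rho> \<sigma> \<eta> \<Upsilon> \<nu>1 w \<gamma>1 \<gamma>2
              (hk_integral A C \<kappa> \<rho> \<Upsilon> \<nu>1 w \<gamma>1 \<gamma>2 ((\<gamma>1 + 1) / 2) \<gamma>2 \<psi>) z \<and>
            hk_derivative A C \<kappa> \<rho> \<sigma> \<eta> \<Upsilon> \<nu>1 w \<gamma>1 \<gamma>2
              (hk_integral A C \<kappa> \<rho> \<Upsilon> \<nu>1 w \<gamma>1 \<gamma>2 ((\<gamma>1 + 1) / 2) \<gamma>2 \<psi>) z = \<psi> z)"
proof -
  note pos = assms(3-7)
  let ?R = "{A<..<B} \<times> {C<..<D}"
  define L M where "L = B - A" and "M = D - C"
  have LM: "L > 0" "M > 0" using assms(1,2) by (simp_all add: L_def M_def)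
  obtain p where p: "integrable lborel p"
    and off: "\<And>t q. p (t, q) \<noteq> 0 \<Longrightarrow> A < t \<and> t < B \<and> C < q \<and> q < D"
    and rows: "\<And>q. integrable lborel (\<lambda>t. p (t, q))"
    and \<psi>p: "AE z in lborel. z \<in> ?R \<longrightarrow> \<psi> z = p z"
    using borel_representative[OF assms(9)] by blast
  have off': "A < t \<and> C < q" if "p (t, q) \<noteq> 0" for t q using off that by blast
  define k1 where "k1 = series_kernel L M (hk_weight \<gamma>1 \<gamma>2 \<nu>1 w) \<kappa> \<rho> \<Upsilon>"
  define k2 where "k2 = series_kernel L M (hk_weight (- \<gamma>1) (- \<gamma>2) \<nu>1 w) \<sigma> \<eta> \<Upsilon>"
  define \<Phi> where "\<Phi> = tensor (rl_kernel L (\<kappa> + \<sigma>)) (rl_kernel M (\<rho> + \<eta>))"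
  have k1: "integrable lborel k1" and k2: "integrable lborel k2"
    unfolding k1_def k2_def using LM pos by (auto intro!: integrable_series_kernel geometric_bound_hk_weight)
  have \<Phi>: "integrable lborel \<Phi>" unfolding \<Phi>_def using pos by (intro integrable_tensor integrable_rl_kernel) auto
  define f1 where "f1 = hk_integral A C \<kappa> \<rho> \<Upsilon> \<nu>1 w \<gamma>1 \<gamma>2 ((\<gamma>1 + 1) / 2) \<gamma>2 \<psi>"
  define f2 where "f2 = hk_integral A C \<sigma> \<eta> \<Upsilon> \<nu>1 w (- \<gamma>1) (- \<gamma>2) ((- \<gamma>1 + 1) / 2) (- \<gamma>2) f1"
  have p_meas: "p \<in> borel_measurable borel" using p by (auto dest: borel_measurable_integrable)
  have c1: "integrable lborel (conv k1 p)" by (rule integrable_conv[OF k1 p])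
  have c1_meas: "conv k1 p \<in> borel_measurable borel" using c1 by (auto dest: borel_measurable_integrable)
  have c1_off: "A < t \<and> C < q" if "conv k1 p (t, q) \<noteq> 0" for t q
    by (rule conv_off[OF _ off' that]) (auto simp: k1_def dest: series_kernel_off)
  have f1_eq: "AE z in lborel. z \<in> ?R \<longrightarrow> f1 z = conv k1 p z"
    using AE_integrable_conv[OF k1 p]
  proof eventually_elim
    case (elim z)
    then show ?case unfolding f1_def k1_def L_def M_def
      by (intro impI hk_integral_eq_conv pos p_meas off' \<psi>p)
  qed
  have "f1 absolutely_integrable_on ?R"
  proof -
    have R: "?R \<in> sets borel" by (intro borel_open open_Times) auto
    have i: "integrable lborel (\<lambda>z. indicator ?R z *\<^sub>R conv k1 p z)"
      using R by (intro integrable_mult_indicator c1) simp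
    have "AE z in lborel. indicator ?R z *\<^sub>R f1 z = indicator ?R z *\<^sub>R conv k1 p z"
      using f1_eq by eventually_elim (auto simp: indicator_def)
    then have "integrable lebesgue (\<lambda>z. indicator ?R z *\<^sub>R f1 z)"
      using i by (subst integrable_lebesgue_AE[where g="\<lambda>z. indicator ?R z *\<^sub>R conv k1 p z"])
        (auto dest: borel_measurable_integrable)
    then show ?thesis by (simp add: set_integrable_def)
  qed
  moreover
  have f2_eq: "AE z in lborel. z \<in> ?R \<longrightarrow> f2 z = conv \<Phi> p z"
    using AE_integrable_conv[OF k2 c1] conv_assoc_AE[OF k2 k1 p]
  proof eventually_elim
    case (elim z)
    show ?case
    proof
      assume z: "z \<in> ?R"
      have "f2 z = conv k2 (conv k1 p) z"
        unfolding f2_def k2_def L_def M_def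
        using elim(1) z by (intro hk_integral_eq_conv pos c1_meas c1_off f1_eq) (auto simp: k2_def L_def M_def)
      also have "\<dots> = conv (conv k2 k1) p z" by (rule elim(2))
      also have "\<dots> = conv \<Phi> p z"
        unfolding conv_def[of _ p]
      proof (rule Bochner_Integration.integral_cong[OF refl])
        fix y
        obtain u v where uv: "z - y = (u, v)" by (cases "z - y")
        have "conv k2 k1 (u, v) = \<Phi> (u, v)" if "p y \<noteq> 0"
        proof -
          have "u < L" "v < M" using off[of "fst y" "snd y"] that z uv
            by (cases z; cases y; auto simp: L_def M_def)+
          \<comment> \<open>\<open>hk_weight_inverse\<close> has the weight with negated parameters
            as its first factor, which matches \<open>k2\<close> on the left; the orders then come
            out as \<open>\<sigma> + \<kappa>\<close> and \<open>\<eta> + \<rho>\<close>.\<close>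
          then show ?thesis
            unfolding k1_def k2_def \<Phi>_def add.commute[of \<kappa>] add.commute[of \<rho>]
            using LM pos by (intro conv_series_kernel_inverse geometric_bound_hk_weight hk_weight_inverse) auto
        qed
        then show "conv k2 k1 (z - y) * p y = \<Phi> (z - y) * p y" by (auto simp: uv)
      qed
      finally show "f2 z = conv \<Phi> p z" .
    qed
  qed
  define n m where "n = nat \<lfloor>Re (\<kappa> + \<sigma>)\<rfloor> + 1" and "m = nat \<lfloor>Re (\<rho> + \<eta>)\<rfloor> + 1"
  define f3 where "f3 = rl_integral_X A (of_nat n - (\<kappa> + \<sigma>)) (rl_integral_Y C (of_nat m - (\<rho> + \<eta>)) f2)"
  have nm: "n \<ge> 1" "m \<ge> 1" by (simp_all add: n_def m_def)
  \<comment> \<open>The real parts are positive, so \<open>nat\<close> does not alter the floor, and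
    the floor plus one exceeds the real part strictly.\<close>
  have re: "Re (of_nat n - (\<kappa> + \<sigma>)) > 0" "Re (of_nat m - (\<rho> + \<eta>)) > 0"
    using pos unfolding n_def m_def by (simp_all add: of_nat_nat) linarith+
  have c2_meas: "conv \<Phi> p \<in> borel_measurable borel"
    using integrable_conv[OF \<Phi> p] by (auto dest: borel_measurable_integrable)
  have c2_off: "A < t \<and> C < q" if "conv \<Phi> p (t, q) \<noteq> 0" for t q
    by (rule conv_off[OF _ off' that]) (auto simp: \<Phi>_def dest: tensor_rl_kernel_off)
  \<comment> \<open>The formula for \<open>f2\<close> holds only almost everywhere, but
    \<open>f3\<close> depends on \<open>f2\<close> only through integrals, so this formula holds at
    every point of the rectangle.\<close>
  have f3_eq: "f3 z = conv (tensor (rl_kernel L (of_nat n)) (rl_kernel M (of_nat m))) p z" if z: "z \<in> ?R" for z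
  proof -
    obtain X Y where XY: "z = (X, Y)" by (cases z)
    have lt: "A < X" "X < B" "C < Y" "Y < D" using z by (auto simp: XY)
    have off2: "X - t < L \<and> Y - q < M" if "p (t, q) \<noteq> 0" for t q
      using off[OF that] lt by (auto simp: L_def M_def)
    \<comment> \<open>The imaginary parts cancel and the orders add up to \<open>n\<close> and
      \<open>m\<close>, so the condition for associativity at a single point is
      \<open>n \<ge> 1\<close> and \<open>m \<ge> 1\<close>.\<close>
    have re1: "Re (of_nat n - (\<kappa> + \<sigma>)) + Re (\<kappa> + \<sigma>) \<ge> 1" "Re (of_nat m - (\<rho> + \<eta>)) + Re (\<rho> + \<eta>) \<ge> 1"
      using nm by simp_all
    have pos': "Re (\<kappa> + \<sigma>) > 0" "Re (\<rho> + \<eta>) > 0" using pos by simp_all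
    note t = integrable_tensor_conv[OF re(1) pos'(1) re1(1) re(2) pos'(2) re1(2) p off2 LM]
      conv_tensor_assoc[OF re(1) pos'(1) re1(1) re(2) pos'(2) re1(2) p off2 LM]
    have "f3 z = conv (tensor (rl_kernel L (of_nat n - (\<kappa> + \<sigma>))) (rl_kernel M (of_nat m - (\<rho> + \<eta>)))) (conv \<Phi> p) z"
      unfolding f3_def XY L_def M_def
      by (rule rl_integral_eq_conv[OF re c2_meas c2_off f2_eq lt]) (use t(1) in \<open>simp_all add: \<Phi>_def L_def M_def\<close>)
    also have "\<dots> = conv (tensor (rl_kernel L (of_nat n)) (rl_kernel M (of_nat m))) p z"
      using t(2) by (simp add: XY \<Phi>_def)
    finally show ?thesis .
  qed
  have "AE z in lborel. z \<in> ?R \<longrightarrow>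
      has_mixed_derivative n m (conv (tensor (rl_kernel L (of_nat n)) (rl_kernel M (of_nat m))) p) z (p z)"
    by (rule AE_has_mixed_derivative[OF assms(1,2) L_def M_def p _ rows nm]) (rule off)
  with \<psi>p have "AE z in lborel. z \<in> ?R \<longrightarrow> has_mixed_derivative n m f3 z (\<psi> z)"
  proof eventually_elim
    case (elim z)
    then show ?case using has_mixed_derivative_cong[OF f3_eq] by auto
  qed
  then have "AE z in lborel. z \<in> ?R \<longrightarrow>
            hk_derivative_exists A C \<kappa> \<rho> \<sigma> \<eta> \<Upsilon> \<nu>1 w \<gamma>1 \<gamma>2 f1 z \<and>
            hk_derivative A C \<kappa> \<rho> \<sigma> \<eta> \<Upsilon> \<nu>1 w \<gamma>1 \<gamma>2 f1 z = \<psi> z"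
  proof eventually_elim
    case (elim z)
    have rl: "has_rl_derivative A C (\<kappa> + \<sigma>) (\<rho> + \<eta>) f2 z d \<longleftrightarrow> has_mixed_derivative n m f3 z d" for d
      by (simp add: has_rl_derivative_def Let_def n_def m_def f3_def)
    show ?case
      using elim unfolding hk_derivative_exists_def hk_derivative_def rl_derivative_def f2_def[symmetric] rl
      by (auto intro!: the_equality dest: has_mixed_derivative_unique)
  qed
  then have "AE z in lebesgue. z \<in> ?R \<longrightarrow>
            hk_derivative_exists A C \<kappa> \<rho> \<sigma> \<eta> \<Upsilon> \<nu>1 w \<gamma>1 \<gamma>2 f1 z \<and>
            hk_derivative A C \<kappa> \<rho> \<sigma> \<eta> \<Upsilon> \<nu>1 w \<gamma>1 \<gamma>2 f1 z = \<psi> z"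
    by (rule AE_completion)
  ultimately show ?thesis unfolding f1_def by blast
qed

end
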